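(* Let $\mathcal{K}(\ell_2)$ be the space of compact operators on $\ell_2$, let $\mathcal{K}(\ell_2)^*$ be its operator space dual, and let $C$ be the column operator space on $\ell_2$. Then $$C\otimes_{\min} \big(\mathcal{K}(\ell_2)^*\otimes_{\min} \mathcal{K}(\ell_2)^*\big) \neq C\otimes_{\min} \big(\mathcal{K}(\ell_2)^*\otimes_{\mu} \mathcal{K}(\ell_2)^*\big)\quad\text{isomorphically},$$ that is, the norms of $C\otimes_{\min} (\mathcal{K}(\ell_2)^*\otimes_{\min} \mathcal{K}(\ell_2)^* )$ and of $C\otimes_{\min} (\mathcal{K}(\ell_2)^*\otimes_{\mu} \mathcal{K}(\ell_2)^* )$ are not equivalent on the algebraic tensor product $C\otimes \mathcal{K}(\ell_2)^*\otimes \mathcal{K}(\ell_2)^*$.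
   Context: An operator space is a closed subspace $X\subset\mathcal B(H)$ with the induced norms on $M_n(X)\subset \mathcal B(H^{\oplus n})$. The dual $X^*$ carries the operator space structure $M_n(X^* )=CB(X,M_n)$ (completely bounded maps with the cb norm). The column operator space is $C=\mathcal B(\mathbb C,\ell_2)$. Minimal tensor product: if $X\subset\mathcal B(H)$, $Y\subset\mathcal B(K)$, then $X\otimes_{\min}Y\subset\mathcal B(H\otimes_2K)$ completely isometrically. Haagerup tensor product: for $w\in M_n(X\otimes Y)$, $\|w\|_{M_n(X\otimes_hY)}=\inf\|u\|_{M_{n,r}(X)}\|v\|_{M_{r,n}(Y)}$, the infimum over $r\in\mathbb N$ and $u,v$ with $w_{i,j}=\sum_{k=1}^r u_{i,k}\otimes v_{k,j}$ for all $i,j$. Symmetrized Haagerup tensor product $X\otimes_\mu Y$: for $w\in M_n(X\otimes Y)$, $$\|w\|_\mu=\inf\{\|w_1\|_{M_n(X\otimes_hY)}+\|w_2^T\|_{M_n(Y\otimes_hX)}:\ w=w_1+w_2\},$$ where for $w_2=\sum_i a_i\otimes x_i\otimes y_i$ (with $a_i\in M_n$, $x_i\in X$, $y_i\in Y$) one sets $w_2^T=\sum_i a_i\otimes y_i\otimes x_i$. *)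

theory Defs
  imports "HOL-Analysis.Analysis"
begin

text \<open>
  Every Hilbert space is, up to unitary equivalence, the space of square summable functions on
  an index set, here a type.  A bounded operator from l2(I) to l2(J) is identified with its
  matrix \<open>a :: 'j \<Rightarrow> 'i \<Rightarrow> complex\<close> (row index first) with respect to the standard bases; the
  Hilbert space tensor product of l2(I) and l2(J) is l2(I x J).
\<close>

definition ell2 :: "('i \<Rightarrow> complex) set" where
  "ell2 = {\<xi>. (\<lambda>i. (cmod (\<xi> i))\<^sup>2) summable_on UNIV}"

definition ell2_norm :: "('i \<Rightarrow> complex) \<Rightarrow> real" where
  "ell2_norm \<xi> = sqrt (\<Sum>\<^sub>\<infinity>i. (cmod (\<xi> i))\<^sup>2)"

definition mat_app :: "('j \<Rightarrow> 'i \<Rightarrow> complex) \<Rightarrow> ('i \<Rightarrow> complex) \<Rightarrow> 'j \<Rightarrow> complex" where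
  "mat_app a \<xi> = (\<lambda>j. \<Sum>\<^sub>\<infinity>i. a j i * \<xi> i)"

definition bounded_mat :: "('j \<Rightarrow> 'i \<Rightarrow> complex) \<Rightarrow> bool" where
  "bounded_mat a \<longleftrightarrow>
     (\<exists>B. \<forall>\<xi>\<in>ell2. (\<forall>j. (\<lambda>i. a j i * \<xi> i) summable_on UNIV) \<and>
        mat_app a \<xi> \<in> ell2 \<and> ell2_norm (mat_app a \<xi>) \<le> B * ell2_norm \<xi>)"

definition op_norm :: "('j \<Rightarrow> 'i \<Rightarrow> complex) \<Rightarrow> real" where
  "op_norm a = Sup {ell2_norm (mat_app a \<xi>) | \<xi>. \<xi> \<in> ell2 \<and> ell2_norm \<xi> \<le> 1}"

definition compact_mat :: "('j \<Rightarrow> 'i \<Rightarrow> complex) \<Rightarrow> bool" where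
  "compact_mat a \<longleftrightarrow> bounded_mat a \<and>
     (\<forall>\<xi> :: nat \<Rightarrow> 'i \<Rightarrow> complex. (\<forall>n. \<xi> n \<in> ell2 \<and> ell2_norm (\<xi> n) \<le> 1) \<longrightarrow>
        (\<exists>r :: nat \<Rightarrow> nat. \<exists>\<eta>\<in>ell2. strict_mono r \<and>
           (\<lambda>n. ell2_norm (\<lambda>j. mat_app a (\<xi> (r n)) j - \<eta> j)) \<longlonglongrightarrow> 0))"

text \<open>
  All vector spaces below are complex linear spaces of functions \<open>'a \<Rightarrow> complex\<close> with the
  pointwise operations.  An element of \<open>M\<^sub>n(X)\<close> is a function \<open>x :: nat \<Rightarrow> nat \<Rightarrow> 'a \<Rightarrow> complex\<close>
  of which only the entries \<open>x k l\<close> with \<open>k, l < n\<close> matter.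
\<close>

record 'a opspace =
  vecs :: "('a \<Rightarrow> complex) set"
  mnorm :: "nat \<Rightarrow> (nat \<Rightarrow> nat \<Rightarrow> 'a \<Rightarrow> complex) \<Rightarrow> real"

text \<open>
  A concrete operator space: a linear space together with a linear embedding \<open>rep\<close> into the
  bounded operators from l2(I) to l2(J).
\<close>

record ('a, 'j, 'i) concrete =
  cvecs :: "('a \<Rightarrow> complex) set"
  rep :: "('a \<Rightarrow> complex) \<Rightarrow> 'j \<Rightarrow> 'i \<Rightarrow> complex"

definition mats :: "nat \<Rightarrow> nat \<Rightarrow> ('a \<Rightarrow> complex) set \<Rightarrow> (nat \<Rightarrow> nat \<Rightarrow> 'a \<Rightarrow> complex) set" where
  "mats m n V = {x. \<forall>k<m. \<forall>l<n. x k l \<in> V}"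

text \<open>
  The block matrix \<open>[u(x\<^sub>k\<^sub>l)]\<close> of size n, as an operator between (subspaces of) the l2-spaces of
  \<open>nat \<times> 'i\<close> and \<open>nat \<times> 'j\<close>; the padding by zeros does not affect its norm.
\<close>

definition amp :: "nat \<Rightarrow> (('a \<Rightarrow> complex) \<Rightarrow> 'j \<Rightarrow> 'i \<Rightarrow> complex) \<Rightarrow>
    (nat \<Rightarrow> nat \<Rightarrow> 'a \<Rightarrow> complex) \<Rightarrow> nat \<times> 'j \<Rightarrow> nat \<times> 'i \<Rightarrow> complex" where
  "amp n u x = (\<lambda>(k, j) (l, i). if k < n \<and> l < n then u (x k l) j i else 0)"

definition cnorm :: "('a, 'j, 'i) concrete \<Rightarrow> ('a \<Rightarrow> complex) \<Rightarrow> real" where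
  "cnorm E x = op_norm (rep E x)"

definition opspace_of :: "('a, 'j, 'i) concrete \<Rightarrow> 'a opspace" where
  "opspace_of E = \<lparr>vecs = cvecs E, mnorm = (\<lambda>n x. op_norm (amp n (rep E) x))\<rparr>"

text \<open>The norm of \<open>M\<^sub>m\<^sub>,\<^sub>n(X)\<close>, a corner of \<open>M\<^sub>N(X)\<close> with \<open>N = max m n\<close>.\<close>

definition rect_norm :: "'a opspace \<Rightarrow> nat \<Rightarrow> nat \<Rightarrow> (nat \<Rightarrow> nat \<Rightarrow> 'a \<Rightarrow> complex) \<Rightarrow> real" where
  "rect_norm X m n x =
     mnorm X (max m n) (\<lambda>k l. if k < m \<and> l < n then x k l else (\<lambda>_. 0))"

definition clinear_on :: "('a \<Rightarrow> complex) set \<Rightarrow> (('a \<Rightarrow> complex) \<Rightarrow> complex) \<Rightarrow> bool" where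
  "clinear_on V f \<longleftrightarrow>
     (\<forall>x\<in>V. \<forall>y\<in>V. \<forall>c. f (\<lambda>a. c * x a + y a) = c * f x + f y)"

text \<open>
  Maps into \<open>M\<^sub>p\<close> are functions \<open>u :: ('a \<Rightarrow> complex) \<Rightarrow> nat \<Rightarrow> nat \<Rightarrow> complex\<close> of which only the
  entries with indices below \<open>p\<close> matter; \<open>corner p u\<close> puts the others to zero.
\<close>

definition corner :: "nat \<Rightarrow> (('a \<Rightarrow> complex) \<Rightarrow> nat \<Rightarrow> nat \<Rightarrow> complex) \<Rightarrow>
    ('a \<Rightarrow> complex) \<Rightarrow> nat \<Rightarrow> nat \<Rightarrow> complex" where
  "corner p u = (\<lambda>x i j. if i < p \<and> j < p then u x i j else 0)"

definition cb_norm :: "'a opspace \<Rightarrow> nat \<Rightarrow> (('a \<Rightarrow> complex) \<Rightarrow> nat \<Rightarrow> nat \<Rightarrow> complex) \<Rightarrow> real" where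
  "cb_norm X p u =
     Sup {op_norm (amp m (corner p u) x) | m x. x \<in> mats m m (vecs X) \<and> mnorm X m x \<le> 1}"

definition complete_contractions ::
    "'a opspace \<Rightarrow> nat \<Rightarrow> (('a \<Rightarrow> complex) \<Rightarrow> nat \<Rightarrow> nat \<Rightarrow> complex) set" where
  "complete_contractions X p =
     {u. (\<forall>i<p. \<forall>j<p. clinear_on (vecs X) (\<lambda>x. u x i j)) \<and>
         (\<forall>m. \<forall>x\<in>mats m m (vecs X). op_norm (amp m (corner p u) x) \<le> mnorm X m x)}"

text \<open>
  The operator space dual.  A functional is represented by the function extending it by zero
  outside the space.
\<close>

definition os_dual :: "'a opspace \<Rightarrow> ('a \<Rightarrow> complex) opspace" where
  "os_dual X =
     \<lparr>vecs = {\<phi>. clinear_on (vecs X) \<phi> \<and> (\<forall>x. x \<notin> vecs X \<longrightarrow> \<phi> x = 0) \<and>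
                 (\<exists>B. \<forall>x\<in>vecs X. cmod (\<phi> x) \<le> B * mnorm X 1 (\<lambda>_ _. x))},
      mnorm = (\<lambda>n \<Phi>. cb_norm X n (\<lambda>x i j. \<Phi> i j x))\<rparr>"

text \<open>
  The canonical embedding of an abstract operator space into the bounded operators on a Hilbert
  space: \<open>x\<close> is sent to the block diagonal operator with blocks \<open>u x\<close>, one for each \<open>p\<close> and each
  complete contraction \<open>u\<close> into \<open>M\<^sub>p\<close>.  By Ruan's theorem it is completely isometric.
\<close>

definition realize :: "'a opspace \<Rightarrow>
    ('a, nat \<times> (('a \<Rightarrow> complex) \<Rightarrow> nat \<Rightarrow> nat \<Rightarrow> complex) \<times> nat,
         nat \<times> (('a \<Rightarrow> complex) \<Rightarrow> nat \<Rightarrow> nat \<Rightarrow> complex) \<times> nat) concrete" where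
  "realize X =
     \<lparr>cvecs = vecs X,
      rep = (\<lambda>x (p, u, j) (q, v, i).
        if p = q \<and> u = v \<and> u \<in> complete_contractions X p \<and> j < p \<and> i < p then u x j i else 0)\<rparr>"

text \<open>
  For linear spaces V and W of functions on A and B, the algebraic tensor product is the linear
  span of the functions \<open>(a, b) \<mapsto> x a * y b\<close> on A x B, with x in V and y in W.
\<close>

definition tensor_sum :: "nat \<Rightarrow> (nat \<Rightarrow> 'a \<Rightarrow> complex) \<Rightarrow> (nat \<Rightarrow> 'b \<Rightarrow> complex) \<Rightarrow>
    'a \<times> 'b \<Rightarrow> complex" where
  "tensor_sum r x y = (\<lambda>(a, b). \<Sum>k<r. x k a * y k b)"

definition alg_tensor ::
    "('a \<Rightarrow> complex) set \<Rightarrow> ('b \<Rightarrow> complex) set \<Rightarrow> ('a \<times> 'b \<Rightarrow> complex) set" where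
  "alg_tensor V W = {tensor_sum r x y | r x y. \<forall>k<r. x k \<in> V \<and> y k \<in> W}"

text \<open>
  The minimal tensor product of concrete operator spaces, realized on the tensor products of the
  Hilbert spaces: \<open>\<Sum>\<^sub>k x\<^sub>k \<otimes> y\<^sub>k\<close> acts as \<open>\<Sum>\<^sub>k rep E x\<^sub>k \<otimes> rep F y\<^sub>k\<close>, which does not depend on the
  decomposition since \<open>rep E\<close> and \<open>rep F\<close> are linear.
\<close>

definition min_tensor :: "('a, 'j, 'i) concrete \<Rightarrow> ('b, 'l, 'k) concrete \<Rightarrow>
    ('a \<times> 'b, 'j \<times> 'l, 'i \<times> 'k) concrete" where
  "min_tensor E F =
     \<lparr>cvecs = alg_tensor (cvecs E) (cvecs F),
      rep = (\<lambda>w. THE T. \<exists>r x y. (\<forall>k<r. x k \<in> cvecs E \<and> y k \<in> cvecs F) \<and>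
        w = tensor_sum r x y \<and>
        T = (\<lambda>(j, j') (i, i'). \<Sum>k<r. rep E (x k) j i * rep F (y k) j' i'))\<rparr>"

definition haagerup_norm :: "'a opspace \<Rightarrow> 'b opspace \<Rightarrow> nat \<Rightarrow>
    (nat \<Rightarrow> nat \<Rightarrow> 'a \<times> 'b \<Rightarrow> complex) \<Rightarrow> real" where
  "haagerup_norm X Y n w =
     Inf {rect_norm X n r u * rect_norm Y r n v | r u v.
       u \<in> mats n r (vecs X) \<and> v \<in> mats r n (vecs Y) \<and>
       (\<forall>i<n. \<forall>j<n. w i j = tensor_sum r (\<lambda>k. u i k) (\<lambda>k. v k j))}"

text \<open>Only the tensor factors are exchanged, the matrix indices stay in place.\<close>

definition flip :: "(nat \<Rightarrow> nat \<Rightarrow> 'a \<times> 'b \<Rightarrow> complex) \<Rightarrow> nat \<Rightarrow> nat \<Rightarrow> 'b \<times> 'a \<Rightarrow> complex" where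
  "flip w = (\<lambda>i j (b, a). w i j (a, b))"

text \<open>
  The matrix norms of the symmetrized Haagerup tensor product.  For matrices of size at least 2
  these expressions need not satisfy \<open>\<parallel>x \<oplus> y\<parallel> = max \<parallel>x\<parallel> \<parallel>y\<parallel>\<close> exactly, but only up to a factor 2.
  A linear map into \<open>M\<^sub>p\<close> is completely contractive for them iff it is so for both Haagerup norms.
  Hence \<open>realize (mu_tensor X Y)\<close> is the corresponding quotient of the l1-direct sum of the two
  Haagerup tensor products; its matrix norms coincide with those below for matrices of size 1 and
  are within a factor 2 of them in general.
\<close>

definition mu_tensor :: "'a opspace \<Rightarrow> 'b opspace \<Rightarrow> ('a \<times> 'b) opspace" where
  "mu_tensor X Y =
     \<lparr>vecs = alg_tensor (vecs X) (vecs Y),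
      mnorm = (\<lambda>n w. Inf {haagerup_norm X Y n w1 + haagerup_norm Y X n (flip w2) | w1 w2.
        w1 \<in> mats n n (alg_tensor (vecs X) (vecs Y)) \<and>
        w2 \<in> mats n n (alg_tensor (vecs X) (vecs Y)) \<and>
        (\<forall>i<n. \<forall>j<n. w i j = (\<lambda>p. w1 i j p + w2 i j p))})\<rparr>"

definition compacts :: "(nat \<times> nat, nat, nat) concrete" where
  "compacts = \<lparr>cvecs = {a. compact_mat (curry a)}, rep = curry\<rparr>"

text \<open>Operators from the one-dimensional space l2(unit) to l2(nat).\<close>

definition column_space :: "(nat, nat, unit) concrete" where
  "column_space = \<lparr>cvecs = ell2, rep = (\<lambda>\<xi> j _. \<xi> j)\<rparr>"

definition compacts_dual :: "(nat \<times> nat \<Rightarrow> complex) opspace" where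
  "compacts_dual = os_dual (opspace_of compacts)"

definition equivalent_norms_on :: "'v set \<Rightarrow> ('v \<Rightarrow> real) \<Rightarrow> ('v \<Rightarrow> real) \<Rightarrow> bool" where
  "equivalent_norms_on V N1 N2 \<longleftrightarrow>
     (\<exists>c>0. \<exists>C>0. \<forall>w\<in>V. c * N1 w \<le> N2 w \<and> N2 w \<le> C * N1 w)"

end

theory Submission
  imports Defs "HOL-Number_Theory.Cong"
begin

text \<open>
  Let \<open>p\<close> be an odd prime, \<open>\<omega> = exp(2\<pi>\<i>/p)\<close>, \<open>\<epsilon>(i,j) = \<omega>^(i\<^sup>2j)\<close>, and let \<open>\<delta>\<^sub>i\<close> be the functional
  \<open>a \<mapsto> a(i,i)\<close> on the compact operators.  The two norms are compared on the tensor
  \<open>w = \<Sum>i,j. cnj \<epsilon>(i,j) e\<^sub>i\<^sub>+\<^sub>j \<otimes> \<delta>\<^sub>i \<otimes> \<delta>\<^sub>j\<close>, with \<open>i + j\<close> taken modulo \<open>p\<close>.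

  The square of the minimal norm is at most the supremum of
  \<open>\<Sum>l. \<parallel>\<Sum>i. cnj \<epsilon>(i,l-i) (a\<^sub>i \<otimes> b\<^sub>l\<^sub>-\<^sub>i)\<xi>\<parallel>\<^sup>2\<close> over contractions \<open>a\<^sub>i\<close>, \<open>b\<^sub>j\<close> and unit vectors \<open>\<xi>\<close>.
  Since the \<open>a\<^sub>i\<close> commute with the \<open>b\<^sub>j\<close> and with their adjoints, expanding the square gives
  \<open>\<Sum>d i j. cnj \<epsilon>(i,j) \<epsilon>(i+d,j-d) \<langle>a\<^sub>i\<^sub>+\<^sub>d\<^sup>* a\<^sub>i \<xi>, b\<^sub>j\<^sup>* b\<^sub>j\<^sub>-\<^sub>d \<xi>\<rangle>\<close>.  For \<open>d \<noteq> 0\<close> the coefficients form, up to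
  unimodular diagonal factors, the character matrix \<open>\<omega>^(2dij)\<close>, of norm \<open>\<surd>p\<close>; so these terms are at most
  \<open>p\<surd>p\<close> each, the term \<open>d = 0\<close> is at most \<open>p\<^sup>2\<close>, and the squared norm is \<open>O(p\<^sup>2\<surd>p)\<close>.

  For the symmetrized Haagerup norm it is enough that the operators commute, not that they commute with the adjoints.
  There are contractions \<open>a\<^sub>i\<close> and \<open>b\<^sub>j\<close> such that \<open>a\<^sub>i b\<^sub>j = b\<^sub>j a\<^sub>i\<close> sends a vacuum vector to \<open>\<epsilon>(i,j) f\<^sub>i\<^sub>+\<^sub>j\<close>
  for an orthonormal system \<open>f\<close>, which shows that the squared norm of \<open>w\<close> is at least \<open>p\<^sup>3\<close>.
\<close>

section \<open>Finite matrices\<close>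

abbreviation vnorm :: "'i set \<Rightarrow> ('i \<Rightarrow> complex) \<Rightarrow> real" where
  "vnorm F x \<equiv> L2_set (\<lambda>i. cmod (x i)) F"

text \<open>A bound predicate instead of a norm: \<open>op_norm\<close> is a \<open>Sup\<close> of
  reals and says something only once boundedness is known, while bounds on finite corners can be
  added, multiplied and transported without that side condition.\<close>

definition fin_bd :: "'j set \<Rightarrow> 'i set \<Rightarrow> real \<Rightarrow> ('j \<Rightarrow> 'i \<Rightarrow> complex) \<Rightarrow> bool" where
  "fin_bd F G K a \<longleftrightarrow> (\<forall>\<xi>. vnorm F (\<lambda>j. \<Sum>i\<in>G. a j i * \<xi> i) \<le> K * vnorm G \<xi>)"

lemma vnorm_square: "(vnorm F x)\<^sup>2 = (\<Sum>i\<in>F. (cmod (x i))\<^sup>2)"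
  unfolding L2_set_def by (simp add: sum_nonneg)

lemma vnorm_triangle: "vnorm F (\<lambda>i. x i + y i) \<le> vnorm F x + vnorm F y"
proof -
  have "vnorm F (\<lambda>i. x i + y i) \<le> L2_set (\<lambda>i. cmod (x i) + cmod (y i)) F"
    by (rule L2_set_mono) (auto simp: norm_triangle_ineq)
  also have "\<dots> \<le> vnorm F x + vnorm F y" by (rule L2_set_triangle_ineq)
  finally show ?thesis .
qed

lemma vnorm_scale: "vnorm F (\<lambda>i. c * x i) = cmod c * vnorm F x"
  by (simp add: norm_mult L2_set_right_distrib)

lemma cmod_inner_le: "cmod (\<Sum>i\<in>F. x i * cnj (y i)) \<le> vnorm F x * vnorm F y"
proof -
  have "cmod (\<Sum>i\<in>F. x i * cnj (y i)) \<le> (\<Sum>i\<in>F. \<bar>cmod (x i)\<bar> * \<bar>cmod (y i)\<bar>)"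
    by (rule sum_norm_le) (simp add: norm_mult)
  also have "\<dots> \<le> vnorm F x * vnorm F y" by (rule L2_set_mult_ineq)
  finally show ?thesis .
qed

lemma vnorm_square_inner: "complex_of_real ((vnorm F x)\<^sup>2) = (\<Sum>i\<in>F. x i * cnj (x i))"
  by (simp only: vnorm_square of_real_sum complex_norm_square)

lemma fin_bdI: "(\<And>\<xi>. vnorm F (\<lambda>j. \<Sum>i\<in>G. a j i * \<xi> i) \<le> K * vnorm G \<xi>) \<Longrightarrow> fin_bd F G K a"
  by (simp add: fin_bd_def)

lemma fin_bdD: "fin_bd F G K a \<Longrightarrow> vnorm F (\<lambda>j. \<Sum>i\<in>G. a j i * \<xi> i) \<le> K * vnorm G \<xi>"
  by (simp add: fin_bd_def)

lemma fin_bd_cong: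
  assumes "\<And>j i. j \<in> F \<Longrightarrow> i \<in> G \<Longrightarrow> a j i = b j i"
  shows "fin_bd F G K a \<longleftrightarrow> fin_bd F G K b"
proof -
  have "vnorm F (\<lambda>j. \<Sum>i\<in>G. a j i * \<xi> i) = vnorm F (\<lambda>j. \<Sum>i\<in>G. b j i * \<xi> i)" for \<xi>
    by (rule L2_set_cong) (auto simp: assms intro!: arg_cong[where f=cmod] sum.cong)
  then show ?thesis by (simp add: fin_bd_def)
qed

lemma fin_bd_mono: "fin_bd F G K a \<Longrightarrow> K \<le> L \<Longrightarrow> fin_bd F G L a"
  unfolding fin_bd_def by (meson L2_set_nonneg mult_right_mono order_trans)

lemma fin_bd_add:
  assumes "fin_bd F G K a" "fin_bd F G L b"
  shows "fin_bd F G (K + L) (\<lambda>j i. a j i + b j i)"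
proof (rule fin_bdI)
  fix \<xi>
  have "vnorm F (\<lambda>j. \<Sum>i\<in>G. (a j i + b j i) * \<xi> i)
      = vnorm F (\<lambda>j. (\<Sum>i\<in>G. a j i * \<xi> i) + (\<Sum>i\<in>G. b j i * \<xi> i))"
    by (simp add: distrib_right sum.distrib)
  also have "\<dots> \<le> K * vnorm G \<xi> + L * vnorm G \<xi>"
    by (rule order_trans[OF vnorm_triangle]) (intro add_mono fin_bdD assms)
  finally show "vnorm F (\<lambda>j. \<Sum>i\<in>G. (a j i + b j i) * \<xi> i) \<le> (K + L) * vnorm G \<xi>"
    by (simp add: distrib_right)
qed

lemma fin_bd_zero: "fin_bd F G 0 (\<lambda>_ _. 0)"
  by (simp add: fin_bd_def L2_set_def)

lemma fin_bd_sum: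
  assumes "finite H" "\<And>h. h \<in> H \<Longrightarrow> fin_bd F G (K h) (a h)"
  shows "fin_bd F G (\<Sum>h\<in>H. K h) (\<lambda>j i. \<Sum>h\<in>H. a h j i)"
  using assms
proof (induction H rule: finite_induct)
  case empty
  then show ?case by (simp add: fin_bd_zero)
next
  case (insert h H)
  then show ?case using fin_bd_add[of F G "K h" "a h"] by simp
qed

lemma fin_bd_mult:
  assumes "fin_bd F H K a" "fin_bd H G L b" "0 \<le> K"
  shows "fin_bd F G (K * L) (\<lambda>j i. \<Sum>h\<in>H. a j h * b h i)"
proof (rule fin_bdI)
  fix \<xi>
  have eq: "(\<Sum>i\<in>G. (\<Sum>h\<in>H. a j h * b h i) * \<xi> i) = (\<Sum>h\<in>H. a j h * (\<Sum>i\<in>G. b h i * \<xi> i))" for j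
    unfolding sum_distrib_left sum_distrib_right by (subst sum.swap) (simp add: mult.assoc)
  have "vnorm F (\<lambda>j. \<Sum>i\<in>G. (\<Sum>h\<in>H. a j h * b h i) * \<xi> i)
      \<le> K * vnorm H (\<lambda>h. \<Sum>i\<in>G. b h i * \<xi> i)"
    unfolding eq by (rule fin_bdD[OF assms(1)])
  also have "\<dots> \<le> K * (L * vnorm G \<xi>)"
    by (intro mult_left_mono fin_bdD[OF assms(2)] assms(3))
  finally show "vnorm F (\<lambda>j. \<Sum>i\<in>G. (\<Sum>h\<in>H. a j h * b h i) * \<xi> i) \<le> (K * L) * vnorm G \<xi>"
    by (simp add: mult.assoc)
qed

lemma fin_bd_reindex:
  assumes "inj_on f F'" "inj_on g G'"
  shows "fin_bd (f ` F') (g ` G') K a \<longleftrightarrow> fin_bd F' G' K (\<lambda>j i. a (f j) (g i))"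
proof -
  have L: "vnorm (g ` G') \<xi> = vnorm G' (\<lambda>i. \<xi> (g i))" for \<xi>
    unfolding L2_set_def by (simp add: sum.reindex[OF assms(2)] o_def)
  have L': "vnorm (f ` F') \<xi> = vnorm F' (\<lambda>i. \<xi> (f i))" for \<xi>
    unfolding L2_set_def by (simp add: sum.reindex[OF assms(1)] o_def)
  have S: "(\<Sum>i\<in>g ` G'. a j i * \<xi> i) = (\<Sum>i\<in>G'. a j (g i) * \<xi> (g i))" for j \<xi>
    by (simp add: sum.reindex[OF assms(2)] o_def)
  show ?thesis
  proof
    assume h: "fin_bd (f ` F') (g ` G') K a"
    show "fin_bd F' G' K (\<lambda>j i. a (f j) (g i))"
    proof (rule fin_bdI)
      fix \<xi> :: "_ \<Rightarrow> complex"
      \<comment> \<open>The test vector is transported to the image of \<open>g\<close> along the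
        inverse of \<open>g\<close>.\<close>
      have e: "(\<xi> \<circ> inv_into G' g) (g i) = \<xi> i" if "i \<in> G'" for i
        using assms(2) that by simp
      have "vnorm F' (\<lambda>j. \<Sum>i\<in>G'. a (f j) (g i) * (\<xi> \<circ> inv_into G' g) (g i))
          \<le> K * vnorm G' (\<lambda>i. (\<xi> \<circ> inv_into G' g) (g i))"
        using fin_bdD[OF h, of "\<xi> \<circ> inv_into G' g"] unfolding L L' S .
      then show "vnorm F' (\<lambda>j. \<Sum>i\<in>G'. a (f j) (g i) * \<xi> i) \<le> K * vnorm G' \<xi>"
        using e by (simp cong: sum.cong L2_set_cong_simp)
    qed
  next
    assume h: "fin_bd F' G' K (\<lambda>j i. a (f j) (g i))"
    show "fin_bd (f ` F') (g ` G') K a"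
      unfolding fin_bd_def L L' S by (intro allI fin_bdD[OF h])
  qed
qed

text \<open>For y the adjoint applied to \<eta>, the squared norm of y is the inner product of a y
  with \<eta>, hence at most K |y| |\<eta>|; one factor |y| then cancels.\<close>

lemma fin_bd_adjoint:
  assumes "fin_bd F G K a" "0 \<le> K"
  shows "fin_bd G F K (\<lambda>i j. cnj (a j i))"
proof (rule fin_bdI)
  fix \<eta>
  define y where "y i = (\<Sum>j\<in>F. cnj (a j i) * \<eta> j)" for i
  have "complex_of_real ((vnorm G y)\<^sup>2) = (\<Sum>i\<in>G. y i * cnj (y i))"
    by (rule vnorm_square_inner)
  also have "\<dots> = (\<Sum>i\<in>G. \<Sum>j\<in>F. y i * a j i * cnj (\<eta> j))"
    unfolding y_def by (simp add: sum_distrib_left mult.assoc)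
  also have "\<dots> = (\<Sum>j\<in>F. (\<Sum>i\<in>G. a j i * y i) * cnj (\<eta> j))"
    by (subst sum.swap) (simp add: sum_distrib_left mult_ac)
  finally have "complex_of_real ((vnorm G y)\<^sup>2) = (\<Sum>j\<in>F. (\<Sum>i\<in>G. a j i * y i) * cnj (\<eta> j))" .
  then have "(vnorm G y)\<^sup>2 = cmod (\<Sum>j\<in>F. (\<Sum>i\<in>G. a j i * y i) * cnj (\<eta> j))"
    by (metis abs_of_nonneg norm_of_real zero_le_power2)
  also have "\<dots> \<le> vnorm F (\<lambda>j. \<Sum>i\<in>G. a j i * y i) * vnorm F \<eta>"
    by (rule cmod_inner_le)
  also have "\<dots> \<le> K * vnorm G y * vnorm F \<eta>"
    by (intro mult_right_mono fin_bdD[OF assms(1)]) auto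
  finally have *: "vnorm G y * vnorm G y \<le> vnorm G y * (K * vnorm F \<eta>)"
    by (simp add: power2_eq_square mult_ac)
  show "vnorm G (\<lambda>i. \<Sum>j\<in>F. cnj (a j i) * \<eta> j) \<le> K * vnorm F \<eta>"
  proof (cases "vnorm G y = 0")
    case True
    then show ?thesis using assms(2) by (simp add: y_def[symmetric])
  next
    case False
    then have "vnorm G y > 0" using L2_set_nonneg[of "\<lambda>i. cmod (y i)" G] by linarith
    then show ?thesis using * by (simp add: y_def[symmetric])
  qed
qed

text \<open>The form is tested at \<eta> = a \<xi>, where it equals the squared norm of a \<xi>;
  cancelling one factor gives the bound.\<close>

lemma fin_bd_formI:
  assumes "\<And>\<eta> \<xi>. cmod (\<Sum>j\<in>F. \<Sum>i\<in>G. cnj (\<eta> j) * \<xi> i * a j i) \<le> K * vnorm F \<eta> * vnorm G \<xi>"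
    and "0 \<le> K"
  shows "fin_bd F G K a"
proof (rule fin_bdI)
  fix \<xi>
  define y where "y j = (\<Sum>i\<in>G. a j i * \<xi> i)" for j
  have "complex_of_real ((vnorm F y)\<^sup>2) = (\<Sum>j\<in>F. y j * cnj (y j))"
    by (rule vnorm_square_inner)
  also have "\<dots> = (\<Sum>j\<in>F. \<Sum>i\<in>G. cnj (y j) * \<xi> i * a j i)"
    by (subst y_def) (simp add: sum_distrib_right sum_distrib_left mult_ac)
  finally have "(vnorm F y)\<^sup>2 = cmod (\<Sum>j\<in>F. \<Sum>i\<in>G. cnj (y j) * \<xi> i * a j i)"
    by (metis abs_of_nonneg norm_of_real zero_le_power2)
  also have "\<dots> \<le> K * vnorm F y * vnorm G \<xi>" by (rule assms(1))
  finally have *: "vnorm F y * vnorm F y \<le> vnorm F y * (K * vnorm G \<xi>)"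
    by (simp add: power2_eq_square mult_ac)
  show "vnorm F (\<lambda>j. \<Sum>i\<in>G. a j i * \<xi> i) \<le> K * vnorm G \<xi>"
  proof (cases "vnorm F y = 0")
    case True
    then show ?thesis using assms(2) by (simp add: y_def[symmetric])
  next
    case False
    then have "vnorm F y > 0" using L2_set_nonneg[of "\<lambda>i. cmod (y i)" F] by linarith
    then show ?thesis using * by (simp add: y_def[symmetric])
  qed
qed

section \<open>Operators on square summable functions\<close>

text \<open>The value is crude. What matters is that every finite matrix has some bound, so that the
  \<open>Sup\<close> in \<open>op_norm\<close> is taken over a bounded set.\<close>

lemma fin_bd_exists:
  assumes "finite F" "finite G"
  shows "fin_bd F G (\<Sum>j\<in>F. \<Sum>i\<in>G. cmod (a j i)) a"
proof (rule fin_bd_formI)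
  fix \<eta> :: "'a \<Rightarrow> complex" and \<xi> :: "'b \<Rightarrow> complex"
  have "cmod (\<Sum>j\<in>F. \<Sum>i\<in>G. cnj (\<eta> j) * \<xi> i * a j i)
      \<le> (\<Sum>j\<in>F. \<Sum>i\<in>G. cmod (a j i) * vnorm F \<eta> * vnorm G \<xi>)"
  proof (intro sum_norm_le)
    fix j i assume "j \<in> F" "i \<in> G"
    then have "cmod (\<eta> j) \<le> vnorm F \<eta>" "cmod (\<xi> i) \<le> vnorm G \<xi>"
      using member_le_L2_set assms by fastforce+
    then have "cmod (\<eta> j) * cmod (\<xi> i) \<le> vnorm F \<eta> * vnorm G \<xi>"
      by (intro mult_mono) auto
    then have "cmod (a j i) * (cmod (\<eta> j) * cmod (\<xi> i)) \<le> cmod (a j i) * (vnorm F \<eta> * vnorm G \<xi>)"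
      by (rule mult_left_mono) simp
    then show "cmod (cnj (\<eta> j) * \<xi> i * a j i) \<le> cmod (a j i) * vnorm F \<eta> * vnorm G \<xi>"
      by (simp add: norm_mult mult_ac)
  qed
  then show "cmod (\<Sum>j\<in>F. \<Sum>i\<in>G. cnj (\<eta> j) * \<xi> i * a j i)
      \<le> (\<Sum>j\<in>F. \<Sum>i\<in>G. cmod (a j i)) * vnorm F \<eta> * vnorm G \<xi>"
    by (simp add: sum_distrib_right)
qed (simp add: sum_nonneg)

text \<open>Bounded partial sums of nonnegative terms give summability and the bound for the limit
  at once, so that later estimates treat finite index sets only.\<close>

lemma ell2_boundI:
  assumes "\<And>H. finite H \<Longrightarrow> vnorm H \<xi> \<le> B"
  shows "\<xi> \<in> ell2" "ell2_norm \<xi> \<le> B"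
proof -
  have B0: "0 \<le> B" using assms[of "{}"] by simp
  have le: "(\<Sum>i\<in>H. (cmod (\<xi> i))\<^sup>2) \<le> B\<^sup>2" if "finite H" for H
    using power_mono[OF assms[OF that] L2_set_nonneg, of 2] by (simp add: vnorm_square)
  have s: "(\<lambda>i. (cmod (\<xi> i))\<^sup>2) summable_on UNIV"
    by (rule nonneg_bdd_above_summable_on) (auto intro!: bdd_aboveI2 le)
  then show "\<xi> \<in> ell2" by (simp add: ell2_def)
  have "(\<Sum>\<^sub>\<infinity>i. (cmod (\<xi> i))\<^sup>2) \<le> B\<^sup>2"
    by (rule infsum_le_finite_sums[OF s]) (rule le)
  then show "ell2_norm \<xi> \<le> B"
    unfolding ell2_norm_def by (rule real_le_lsqrt[OF B0])
qed

lemma vnorm_le_ell2_norm: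
  assumes "\<xi> \<in> ell2"
  shows "vnorm H \<xi> \<le> ell2_norm \<xi>"
proof (cases "finite H")
  case True
  then show ?thesis unfolding ell2_norm_def L2_set_def
    using assms by (intro real_sqrt_le_mono finite_sum_le_infsum) (auto simp: ell2_def)
next
  \<comment> \<open>For infinite \<open>H\<close> the sum in \<open>L2_set\<close> is 0 by
    convention.\<close>
  case False
  then show ?thesis by (simp add: ell2_norm_def infsum_nonneg)
qed

lemma ell2_norm_nonneg [simp]: "0 \<le> ell2_norm \<xi>"
  by (simp add: ell2_norm_def infsum_nonneg)

lemma ell2_add:
  assumes "\<xi> \<in> ell2" "\<eta> \<in> ell2"
  shows "(\<lambda>i. \<xi> i + \<eta> i) \<in> ell2" "ell2_norm (\<lambda>i. \<xi> i + \<eta> i) \<le> ell2_norm \<xi> + ell2_norm \<eta>"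
proof -
  have "vnorm H (\<lambda>i. \<xi> i + \<eta> i) \<le> ell2_norm \<xi> + ell2_norm \<eta>" for H
    by (rule order_trans[OF vnorm_triangle]) (intro add_mono vnorm_le_ell2_norm assms)
  then show "(\<lambda>i. \<xi> i + \<eta> i) \<in> ell2" "ell2_norm (\<lambda>i. \<xi> i + \<eta> i) \<le> ell2_norm \<xi> + ell2_norm \<eta>"
    by (auto intro: ell2_boundI)
qed

lemma ell2_scale:
  assumes "\<xi> \<in> ell2"
  shows "(\<lambda>i. c * \<xi> i) \<in> ell2" "ell2_norm (\<lambda>i. c * \<xi> i) = cmod c * ell2_norm \<xi>"
proof -
  show "(\<lambda>i. c * \<xi> i) \<in> ell2"
    by (rule ell2_boundI(1)[of _ "cmod c * ell2_norm \<xi>"])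
       (simp add: vnorm_scale mult_left_mono vnorm_le_ell2_norm assms)
  show "ell2_norm (\<lambda>i. c * \<xi> i) = cmod c * ell2_norm \<xi>"
    unfolding ell2_norm_def norm_mult power_mult_distrib infsum_cmult_right' real_sqrt_mult by simp
qed

lemma ell2_finite_support:
  assumes "finite F" "\<And>i. i \<notin> F \<Longrightarrow> \<xi> i = 0"
  shows "\<xi> \<in> ell2" "ell2_norm \<xi> = vnorm F \<xi>"
proof -
  have "vnorm H \<xi> \<le> vnorm F \<xi>" if "finite H" for H
  proof -
    have "(\<Sum>i\<in>H. (cmod (\<xi> i))\<^sup>2) = (\<Sum>i\<in>H \<inter> F. (cmod (\<xi> i))\<^sup>2)"
      by (rule sum.mono_neutral_right) (use that assms in auto)
    also have "\<dots> \<le> (\<Sum>i\<in>F. (cmod (\<xi> i))\<^sup>2)"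
      by (rule sum_mono2) (use assms in auto)
    finally show ?thesis unfolding L2_set_def by (rule real_sqrt_le_mono)
  qed
  then show "\<xi> \<in> ell2" and "ell2_norm \<xi> = vnorm F \<xi>"
    using ell2_boundI[of \<xi> "vnorm F \<xi>"] vnorm_le_ell2_norm[of \<xi> F] by (auto intro: antisym)
qed

text \<open>The operator bound without the row summability demanded by \<open>bounded_mat\<close>:
  \<open>op_norm\<close> sees \<open>a\<close> only through \<open>mat_app\<close>, whose entries
  have the default value 0 where a row sum does not converge.\<close>

definition bd_by :: "real \<Rightarrow> ('j \<Rightarrow> 'i \<Rightarrow> complex) \<Rightarrow> bool" where
  "bd_by K a \<longleftrightarrow> (\<forall>\<xi>\<in>ell2. mat_app a \<xi> \<in> ell2 \<and> ell2_norm (mat_app a \<xi>) \<le> K * ell2_norm \<xi>)"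

lemma mat_app_scale: "mat_app a (\<lambda>i. c * \<xi> i) = (\<lambda>j. c * mat_app a \<xi> j)"
proof
  fix j
  have "(\<lambda>i. a j i * (c * \<xi> i)) = (\<lambda>i. c * (a j i * \<xi> i))" by (simp add: mult_ac)
  then show "mat_app a (\<lambda>i. c * \<xi> i) j = c * mat_app a \<xi> j"
    unfolding mat_app_def by (simp add: infsum_cmult_right')
qed

lemma zero_in_ell2 [simp]: "(\<lambda>_. 0) \<in> ell2" "ell2_norm (\<lambda>_. 0) = 0"
  by (auto simp: ell2_def ell2_norm_def)

lemma op_norm_le:
  assumes "bd_by K a" "0 \<le> K"
  shows "op_norm a \<le> K"
  unfolding op_norm_def
proof (rule cSup_least)
  show "{ell2_norm (mat_app a \<xi>) |\<xi>. \<xi> \<in> ell2 \<and> ell2_norm \<xi> \<le> 1} \<noteq> {}"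
    using zero_in_ell2 by (auto intro!: exI[of _ "\<lambda>_. 0"])
  fix x assume "x \<in> {ell2_norm (mat_app a \<xi>) |\<xi>. \<xi> \<in> ell2 \<and> ell2_norm \<xi> \<le> 1}"
  then obtain \<xi> where x: "x = ell2_norm (mat_app a \<xi>)" "\<xi> \<in> ell2" "ell2_norm \<xi> \<le> 1" by blast
  then have "x \<le> K * ell2_norm \<xi>" using assms by (auto simp: bd_by_def)
  also have "\<dots> \<le> K" using x(3) assms(2) by (simp add: mult_left_le)
  finally show "x \<le> K" .
qed

lemma op_norm_upper:
  assumes "bd_by K a" "\<xi> \<in> ell2" "ell2_norm \<xi> \<le> 1"
  shows "ell2_norm (mat_app a \<xi>) \<le> op_norm a"
  unfolding op_norm_def
proof (rule cSup_upper)
  show "bdd_above {ell2_norm (mat_app a \<xi>) |\<xi>. \<xi> \<in> ell2 \<and> ell2_norm \<xi> \<le> 1}"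
  proof (rule bdd_aboveI)
    fix x assume "x \<in> {ell2_norm (mat_app a \<xi>) |\<xi>. \<xi> \<in> ell2 \<and> ell2_norm \<xi> \<le> 1}"
    then obtain \<xi> where x: "x = ell2_norm (mat_app a \<xi>)" "\<xi> \<in> ell2" "ell2_norm \<xi> \<le> 1" by blast
    then have "x \<le> K * ell2_norm \<xi>" using assms by (auto simp: bd_by_def)
    also have "\<dots> \<le> \<bar>K\<bar> * 1" using x(3) by (intro mult_mono) auto
    finally show "x \<le> \<bar>K\<bar>" by simp
  qed
qed (use assms in blast)

lemma op_norm_nonneg: "bd_by K a \<Longrightarrow> 0 \<le> op_norm a"
  using op_norm_upper[of K a "\<lambda>_. 0"] by (auto intro: order_trans[OF ell2_norm_nonneg])

lemma bd_by_op_norm: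
  assumes "bd_by K a"
  shows "bd_by (op_norm a) a"
  unfolding bd_by_def
proof (intro ballI conjI)
  fix \<xi> :: "'b \<Rightarrow> complex" assume xi: "\<xi> \<in> ell2"
  show "mat_app a \<xi> \<in> ell2" using assms xi by (auto simp: bd_by_def)
  have b: "ell2_norm (mat_app a \<xi>) \<le> K * ell2_norm \<xi>" using assms xi by (auto simp: bd_by_def)
  show "ell2_norm (mat_app a \<xi>) \<le> op_norm a * ell2_norm \<xi>"
  proof (cases "ell2_norm \<xi> = 0")
    \<comment> \<open>A vector of norm 0 cannot be normalized; here the given bound \<open>K\<close>
      already makes the image vanish.\<close>
    case True
    then show ?thesis using b by simp
  next
    case False
    define c where "c = complex_of_real (1 / ell2_norm \<xi>)"
    have c: "cmod c = 1 / ell2_norm \<xi>" unfolding c_def norm_of_real by simp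
    have "ell2_norm (mat_app a (\<lambda>i. c * \<xi> i)) \<le> op_norm a"
      by (rule op_norm_upper[OF assms]) (use ell2_scale[OF xi, of c] c False in auto)
    moreover have "ell2_norm (mat_app a (\<lambda>i. c * \<xi> i)) = cmod c * ell2_norm (mat_app a \<xi>)"
      unfolding mat_app_scale using ell2_scale \<open>mat_app a \<xi> \<in> ell2\<close> by blast
    ultimately show ?thesis using False ell2_norm_nonneg[of \<xi>] c by (simp add: field_simps)
  qed
qed

lemma mat_app_finite:
  assumes "finite G" "\<And>i. i \<notin> G \<Longrightarrow> a j i = 0"
  shows "mat_app a \<xi> j = (\<Sum>i\<in>G. a j i * \<xi> i)"
proof -
  have "mat_app a \<xi> j = (\<Sum>\<^sub>\<infinity>i\<in>G. a j i * \<xi> i)"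
    unfolding mat_app_def by (rule infsum_cong_neutral) (use assms in auto)
  then show ?thesis using assms by simp
qed

text \<open>Block diagonal operators: \<open>f\<close> and \<open>g\<close> read the block off an
  index, so distinct blocks are disjoint and the squared norms add up by Pythagoras. The form is
  made for \<open>realize\<close>, an infinite direct sum of finite blocks.\<close>

lemma bd_by_blocks:
  fixes a :: "'j \<Rightarrow> 'i \<Rightarrow> complex" and F :: "'b \<Rightarrow> 'j set" and G :: "'b \<Rightarrow> 'i set"
  assumes fin: "\<And>b. finite (F b)" "\<And>b. finite (G b)"
    and F: "\<And>b j. j \<in> F b \<Longrightarrow> f j = b" and G: "\<And>b i. i \<in> G b \<Longrightarrow> g i = b"
    and supp: "\<And>j i. a j i \<noteq> 0 \<Longrightarrow> \<exists>b. j \<in> F b \<and> i \<in> G b"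
    and K: "\<And>b. fin_bd (F b) (G b) K a" "0 \<le> K"
  shows "bd_by K a"
proof -
  have "vnorm H (mat_app a \<xi>) \<le> K * ell2_norm \<xi>" if xi: "\<xi> \<in> ell2" and H: "finite H" for H \<xi>
  proof -
    have ap: "mat_app a \<xi> j = (\<Sum>i\<in>G (f j). a j i * \<xi> i)" for j
      by (rule mat_app_finite[OF fin(2)]) (use supp F in blast)
    \<comment> \<open>\<open>f j\<close> is defined for every row, but a row outside its own block
      lies in no block and is zero.\<close>
    have z: "mat_app a \<xi> j = 0" if "j \<notin> F (f j)" for j
    proof -
      have "a j i = 0" for i
        using supp[of j i] F that by blast
      then show ?thesis unfolding ap by simp
    qed
    have dF: "F b \<inter> F b' = {}" and dG: "G b \<inter> G b' = {}" if "b \<noteq> b'" for b b'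
      using that by (auto dest: F G)
    let ?B = "f ` H"
    have fB: "finite ?B" using H by simp
    have "(vnorm H (mat_app a \<xi>))\<^sup>2 \<le> (\<Sum>j\<in>(\<Union>b\<in>?B. F b). (cmod (mat_app a \<xi> j))\<^sup>2)"
    proof -
      have "(vnorm H (mat_app a \<xi>))\<^sup>2 = (\<Sum>j\<in>H \<inter> (\<Union>b\<in>?B. F b). (cmod (mat_app a \<xi> j))\<^sup>2)"
        unfolding vnorm_square by (rule sum.mono_neutral_right) (use H z in auto)
      also have "\<dots> \<le> (\<Sum>j\<in>(\<Union>b\<in>?B. F b). (cmod (mat_app a \<xi> j))\<^sup>2)"
        by (rule sum_mono2) (use H fin in auto)
      finally show ?thesis .
    qed
    also have "\<dots> = (\<Sum>b\<in>?B. \<Sum>j\<in>F b. (cmod (mat_app a \<xi> j))\<^sup>2)"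
      by (rule sum.UNION_disjoint) (use fB fin dF in auto)
    also have "\<dots> \<le> (\<Sum>b\<in>?B. K\<^sup>2 * (vnorm (G b) \<xi>)\<^sup>2)"
    proof (rule sum_mono)
      fix b assume "b \<in> ?B"
      have "vnorm (F b) (mat_app a \<xi>) = vnorm (F b) (\<lambda>j. \<Sum>i\<in>G b. a j i * \<xi> i)"
        by (rule L2_set_cong) (auto simp: ap dest: F)
      also have "\<dots> \<le> K * vnorm (G b) \<xi>" by (rule fin_bdD[OF K(1)])
      finally have "(vnorm (F b) (mat_app a \<xi>))\<^sup>2 \<le> (K * vnorm (G b) \<xi>)\<^sup>2"
        by (rule power_mono) simp
      then show "(\<Sum>j\<in>F b. (cmod (mat_app a \<xi> j))\<^sup>2) \<le> K\<^sup>2 * (vnorm (G b) \<xi>)\<^sup>2"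
        by (simp add: vnorm_square power_mult_distrib)
    qed
    also have "\<dots> = K\<^sup>2 * (vnorm (\<Union>b\<in>?B. G b) \<xi>)\<^sup>2"
      unfolding vnorm_square sum_distrib_left[symmetric]
      by (subst sum.UNION_disjoint) (use fB fin dG in auto)
    also have "\<dots> \<le> K\<^sup>2 * (ell2_norm \<xi>)\<^sup>2"
      by (intro mult_left_mono power_mono vnorm_le_ell2_norm xi) auto
    finally have "(vnorm H (mat_app a \<xi>))\<^sup>2 \<le> (K * ell2_norm \<xi>)\<^sup>2"
      by (simp add: power_mult_distrib)
    then show ?thesis by (rule power2_le_imp_le) (simp add: K(2))
  qed
  then show ?thesis unfolding bd_by_def by (auto intro: ell2_boundI)
qed

lemma bd_by_finite:
  assumes "finite F" "finite G" "\<And>j i. a j i \<noteq> 0 \<Longrightarrow> j \<in> F \<and> i \<in> G" "fin_bd F G K a" "0 \<le> K"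
  shows "bd_by K a"
  by (rule bd_by_blocks[where F="\<lambda>_::unit. F" and G="\<lambda>_. G"]) (use assms in auto)

lemma op_norm_finite_le:
  assumes "finite F" "finite G" "\<And>j i. a j i \<noteq> 0 \<Longrightarrow> j \<in> F \<and> i \<in> G" "fin_bd F G K a" "0 \<le> K"
  shows "op_norm a \<le> K"
  by (rule op_norm_le[OF bd_by_finite]) (use assms in auto)

lemma fin_bd_of_bd_by:
  fixes a :: "'j \<Rightarrow> 'i \<Rightarrow> complex"
  assumes "finite G" "bd_by K a"
  shows "fin_bd F G K a"
proof (rule fin_bdI)
  fix \<xi> :: "'i \<Rightarrow> complex"
  define \<zeta> where "\<zeta> i = (if i \<in> G then \<xi> i else 0)" for i
  have z: "\<zeta> \<in> ell2" "ell2_norm \<zeta> = vnorm G \<xi>"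
    using ell2_finite_support[OF assms(1), of \<zeta>] by (auto simp: \<zeta>_def cong: L2_set_cong_simp)
  have "mat_app a \<zeta> j = (\<Sum>i\<in>G. a j i * \<xi> i)" for j
  proof -
    have "mat_app a \<zeta> j = (\<Sum>\<^sub>\<infinity>i\<in>G. a j i * \<xi> i)"
      unfolding mat_app_def by (rule infsum_cong_neutral) (auto simp: \<zeta>_def)
    then show ?thesis using assms(1) by simp
  qed
  then have "vnorm F (\<lambda>j. \<Sum>i\<in>G. a j i * \<xi> i) = vnorm F (mat_app a \<zeta>)" by simp
  also have "\<dots> \<le> ell2_norm (mat_app a \<zeta>)"
    by (rule vnorm_le_ell2_norm) (use assms z in \<open>auto simp: bd_by_def\<close>)
  also have "\<dots> \<le> K * vnorm G \<xi>" using assms z by (auto simp: bd_by_def)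
  finally show "vnorm F (\<lambda>j. \<Sum>i\<in>G. a j i * \<xi> i) \<le> K * vnorm G \<xi>" .
qed

lemma bd_by_finite_exists:
  assumes "finite F" "finite G" "\<And>j i. a j i \<noteq> 0 \<Longrightarrow> j \<in> F \<and> i \<in> G"
  shows "bd_by (op_norm a) a"
  by (rule bd_by_op_norm, rule bd_by_finite[OF assms fin_bd_exists[OF assms(1,2)]])
     (simp_all add: sum_nonneg)

section \<open>Matrices of elements of minimal tensor products\<close>

definition csubspace :: "('a \<Rightarrow> complex) set \<Rightarrow> bool" where
  "csubspace V \<longleftrightarrow> (\<lambda>_. 0) \<in> V \<and> (\<forall>x\<in>V. \<forall>y\<in>V. \<forall>c. (\<lambda>a. c * x a + y a) \<in> V)"

lemma csubspace_zero: "csubspace V \<Longrightarrow> (\<lambda>_. 0) \<in> V"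
  by (simp add: csubspace_def)

lemma csubspace_comb: "csubspace V \<Longrightarrow> x \<in> V \<Longrightarrow> y \<in> V \<Longrightarrow> (\<lambda>a. c * x a + y a) \<in> V"
  by (simp add: csubspace_def)

lemma csubspace_scale: "csubspace V \<Longrightarrow> x \<in> V \<Longrightarrow> (\<lambda>a. c * x a) \<in> V"
  using csubspace_comb[of V x "\<lambda>_. 0" c] csubspace_zero[of V] by simp

lemma csubspace_sum:
  assumes "csubspace V" "finite A" "\<And>k. k \<in> A \<Longrightarrow> x k \<in> V"
  shows "(\<lambda>a. \<Sum>k\<in>A. c k * x k a) \<in> V"
  using assms(2,3) by (induction rule: finite_induct) (auto intro: csubspace_zero csubspace_comb assms(1))

lemma clinear_onD:
  "clinear_on V \<phi> \<Longrightarrow> x \<in> V \<Longrightarrow> y \<in> V \<Longrightarrow> \<phi> (\<lambda>a. c * x a + y a) = c * \<phi> x + \<phi> y"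
  by (simp add: clinear_on_def)

lemma clinear_on_zero:
  assumes "csubspace V" "clinear_on V \<phi>"
  shows "\<phi> (\<lambda>_. 0) = 0"
  using clinear_onD[OF assms(2) csubspace_zero[OF assms(1)] csubspace_zero[OF assms(1)], of "-1"] by simp

lemma clinear_on_sum:
  assumes "csubspace V" "clinear_on V \<phi>" "finite A" "\<And>k. k \<in> A \<Longrightarrow> x k \<in> V"
  shows "\<phi> (\<lambda>a. \<Sum>k\<in>A. c k * x k a) = (\<Sum>k\<in>A. c k * \<phi> (x k))"
  using assms(3,4)
proof (induction rule: finite_induct)
  case empty
  then show ?case using clinear_on_zero[OF assms(1,2)] by simp
next
  case (insert k A)
  have "(\<lambda>a. \<Sum>k\<in>A. c k * x k a) \<in> V" by (rule csubspace_sum) (use assms insert in auto)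
  then have "\<phi> (\<lambda>a. c k * x k a + (\<Sum>k\<in>A. c k * x k a)) = c k * \<phi> (x k) + \<phi> (\<lambda>a. \<Sum>k\<in>A. c k * x k a)"
    by (intro clinear_onD[OF assms(2)]) (use insert in auto)
  then show ?case using insert by simp
qed

lemma csubspace_ell2: "csubspace ell2"
  unfolding csubspace_def by (auto intro: ell2_add ell2_scale)

text \<open>This makes the product functional well defined on tensors. With b fixed, the two sums
  are the same function of a, so applying \<phi> gives equal functions of b; these are then fed to
  \<psi>.\<close>

lemma tensor_form_unique:
  assumes V: "csubspace V" "clinear_on V \<phi>" and W: "csubspace W" "clinear_on W \<psi>"
    and mem: "\<And>k. k < r \<Longrightarrow> x k \<in> V \<and> y k \<in> W" "\<And>k. k < r' \<Longrightarrow> x' k \<in> V \<and> y' k \<in> W"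
    and eq: "tensor_sum r x y = tensor_sum r' x' y'"
  shows "(\<Sum>k<r. \<phi> (x k) * \<psi> (y k)) = (\<Sum>k<r'. \<phi> (x' k) * \<psi> (y' k))"
proof -
  have e: "(\<Sum>k<r. x k a * y k b) = (\<Sum>k<r'. x' k a * y' k b)" for a b
    using fun_cong[OF eq, of "(a, b)"] by (simp add: tensor_sum_def)
  have "(\<Sum>k<r. y k b * \<phi> (x k)) = (\<Sum>k<r'. y' k b * \<phi> (x' k))" for b
  proof -
    have "(\<Sum>k<r. y k b * \<phi> (x k)) = \<phi> (\<lambda>a. \<Sum>k<r. y k b * x k a)"
      by (rule clinear_on_sum[OF V, symmetric]) (use mem in auto)
    also have "(\<lambda>a. \<Sum>k<r. y k b * x k a) = (\<lambda>a. \<Sum>k<r'. y' k b * x' k a)"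
      using e by (simp add: mult.commute)
    also have "\<phi> \<dots> = (\<Sum>k<r'. y' k b * \<phi> (x' k))"
      by (rule clinear_on_sum[OF V]) (use mem in auto)
    finally show ?thesis .
  qed
  then have e2: "(\<lambda>b. \<Sum>k<r. \<phi> (x k) * y k b) = (\<lambda>b. \<Sum>k<r'. \<phi> (x' k) * y' k b)"
    by (simp add: mult.commute)
  have "(\<Sum>k<r. \<phi> (x k) * \<psi> (y k)) = \<psi> (\<lambda>b. \<Sum>k<r. \<phi> (x k) * y k b)"
    by (rule clinear_on_sum[OF W, symmetric]) (use mem in auto)
  also have "\<dots> = (\<Sum>k<r'. \<phi> (x' k) * \<psi> (y' k))"
    unfolding e2 by (rule clinear_on_sum[OF W]) (use mem in auto)
  finally show ?thesis .
qed

section \<open>Algebraic tensor products and the representation of minimal tensor products\<close>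

lemma sum_lessThan_append:
  fixes g :: "nat \<Rightarrow> 'a :: comm_monoid_add"
  shows "(\<Sum>k<r + r'. g k) = (\<Sum>k<r. g k) + (\<Sum>k<r'. g (r + k))"
  by (induction r') (simp_all add: add.assoc)

lemma csubspace_alg_tensor:
  assumes "csubspace V" "csubspace W"
  shows "csubspace (alg_tensor V W)"
  unfolding csubspace_def
proof (intro conjI ballI allI)
  show "(\<lambda>_. 0) \<in> alg_tensor V W"
    unfolding alg_tensor_def
    by (rule CollectI, rule exI[of _ 0]) (auto simp: tensor_sum_def)
next
  fix w w' c assume "w \<in> alg_tensor V W" "w' \<in> alg_tensor V W"
  then obtain r x y r' x' y' where
    w: "w = tensor_sum r x y" "\<And>k. k < r \<Longrightarrow> x k \<in> V \<and> y k \<in> W" and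
    w': "w' = tensor_sum r' x' y'" "\<And>k. k < r' \<Longrightarrow> x' k \<in> V \<and> y' k \<in> W"
    unfolding alg_tensor_def by blast
  \<comment> \<open>Two decompositions are concatenated, the scalar being absorbed into the left
    factors of the first.\<close>
  define X where "X k = (if k < r then (\<lambda>a. c * x k a) else x' (k - r))" for k
  define Y where "Y k = (if k < r then y k else y' (k - r))" for k
  have "(\<lambda>p. c * w p + w' p) = tensor_sum (r + r') X Y"
    unfolding w w' tensor_sum_def sum_lessThan_append
    by (auto simp: fun_eq_iff X_def Y_def sum_distrib_left mult.assoc)
  moreover have "X k \<in> V \<and> Y k \<in> W" if "k < r + r'" for k
    using that w w' csubspace_scale[OF assms(1)] by (auto simp: X_def Y_def)
  ultimately show "(\<lambda>p. c * w p + w' p) \<in> alg_tensor V W"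
    unfolding alg_tensor_def by blast
qed

lemma tensor_sum_reindex:
  assumes "finite A"
  obtains h where "bij_betw h {..<card A} A"
    "(\<lambda>(a, b). \<Sum>k\<in>A. x k a * y k b) = tensor_sum (card A) (x \<circ> h) (y \<circ> h)"
proof -
  obtain h where h: "bij_betw h {..<card A} A"
    using ex_bij_betw_nat_finite[OF assms] by (auto simp: lessThan_atLeast0)
  have "(\<lambda>(a, b). \<Sum>k\<in>A. x k a * y k b) = tensor_sum (card A) (x \<circ> h) (y \<circ> h)"
    unfolding tensor_sum_def o_def by (simp add: sum.reindex_bij_betw[OF h, symmetric])
  then show ?thesis using that h by blast
qed

lemma alg_tensor_sumI:
  assumes "finite A" "\<And>k. k \<in> A \<Longrightarrow> x k \<in> V \<and> y k \<in> W"
  shows "(\<lambda>(a, b). \<Sum>k\<in>A. x k a * y k b) \<in> alg_tensor V W"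
proof -
  obtain h where h: "bij_betw h {..<card A} A"
    "(\<lambda>(a, b). \<Sum>k\<in>A. x k a * y k b) = tensor_sum (card A) (x \<circ> h) (y \<circ> h)"
    using tensor_sum_reindex[OF assms(1)] .
  have "(x \<circ> h) k \<in> V \<and> (y \<circ> h) k \<in> W" if "k < card A" for k
    using bij_betwE[OF h(1)] assms(2) that by auto
  then show ?thesis unfolding h(2) alg_tensor_def by blast
qed

definition lin_rep :: "('a, 'j, 'i) concrete \<Rightarrow> bool" where
  "lin_rep E \<longleftrightarrow> csubspace (cvecs E) \<and> (\<forall>j i. clinear_on (cvecs E) (\<lambda>x. rep E x j i))"

text \<open>Discharges the \<open>THE\<close> in \<open>min_tensor\<close>: every matrix entry of
  \<open>rep\<close> is a linear functional, so \<open>tensor_form_unique\<close> shows entry by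
  entry that all decompositions give the same operator.\<close>

lemma rep_min_tensor_sum:
  assumes E: "lin_rep E" and F: "lin_rep F"
    and mem: "\<And>k. k < r \<Longrightarrow> x k \<in> cvecs E \<and> y k \<in> cvecs F"
  shows "rep (min_tensor E F) (tensor_sum r x y) =
    (\<lambda>(j, j') (i, i'). \<Sum>k<r. rep E (x k) j i * rep F (y k) j' i')"
  unfolding min_tensor_def concrete.simps
proof (rule the_equality)
  show "\<exists>r' x' y'. (\<forall>k<r'. x' k \<in> cvecs E \<and> y' k \<in> cvecs F) \<and>
      tensor_sum r x y = tensor_sum r' x' y' \<and>
      (\<lambda>(j, j') (i, i'). \<Sum>k<r. rep E (x k) j i * rep F (y k) j' i') =
      (\<lambda>(j, j') (i, i'). \<Sum>k<r'. rep E (x' k) j i * rep F (y' k) j' i')"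
    using mem by blast
next
  fix T assume "\<exists>r' x' y'. (\<forall>k<r'. x' k \<in> cvecs E \<and> y' k \<in> cvecs F) \<and>
      tensor_sum r x y = tensor_sum r' x' y' \<and>
      T = (\<lambda>(j, j') (i, i'). \<Sum>k<r'. rep E (x' k) j i * rep F (y' k) j' i')"
  then obtain r' x' y' where *: "\<And>k. k < r' \<Longrightarrow> x' k \<in> cvecs E \<and> y' k \<in> cvecs F"
      "tensor_sum r x y = tensor_sum r' x' y'"
      "T = (\<lambda>(j, j') (i, i'). \<Sum>k<r'. rep E (x' k) j i * rep F (y' k) j' i')"
    by blast
  have "(\<Sum>k<r'. rep E (x' k) j i * rep F (y' k) j' i') =
      (\<Sum>k<r. rep E (x k) j i * rep F (y k) j' i')" for j i j' i'
    by (rule tensor_form_unique[where V="cvecs E" and W="cvecs F"])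
       (use E F mem * in \<open>auto simp: lin_rep_def\<close>)
  then show "T = (\<lambda>(j, j') (i, i'). \<Sum>k<r. rep E (x k) j i * rep F (y k) j' i')"
    unfolding *(3) by simp
qed

lemma rep_min_tensor:
  assumes E: "lin_rep E" and F: "lin_rep F" and A: "finite A"
    and mem: "\<And>k. k \<in> A \<Longrightarrow> x k \<in> cvecs E \<and> y k \<in> cvecs F"
  shows "rep (min_tensor E F) (\<lambda>(a, b). \<Sum>k\<in>A. x k a * y k b) (j, j') (i, i') =
    (\<Sum>k\<in>A. rep E (x k) j i * rep F (y k) j' i')"
proof -
  obtain h where h: "bij_betw h {..<card A} A"
    "(\<lambda>(a, b). \<Sum>k\<in>A. x k a * y k b) = tensor_sum (card A) (x \<circ> h) (y \<circ> h)"
    using tensor_sum_reindex[OF A] .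
  have m: "(x \<circ> h) k \<in> cvecs E \<and> (y \<circ> h) k \<in> cvecs F" if "k < card A" for k
    using bij_betwE[OF h(1)] mem that by auto
  have "rep (min_tensor E F) (tensor_sum (card A) (x \<circ> h) (y \<circ> h)) =
      (\<lambda>(j, j') (i, i'). \<Sum>k<card A. rep E ((x \<circ> h) k) j i * rep F ((y \<circ> h) k) j' i')"
    by (rule rep_min_tensor_sum[OF E F]) (use m in blast)
  then show ?thesis
    unfolding h(2) o_def by (simp add: sum.reindex_bij_betw[OF h(1), symmetric])
qed

text \<open>Linearity has to be inherited because the construction is iterated: the right factor of
  the column space is itself a minimal tensor product. A combination is represented through
  concatenated decompositions, which is legitimate since the result does not depend on the
  decomposition.\<close>

lemma lin_rep_min_tensor:
  assumes E: "lin_rep E" and F: "lin_rep F"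
  shows "lin_rep (min_tensor E F)"
proof -
  have V: "csubspace (cvecs E)" "csubspace (cvecs F)" using E F by (auto simp: lin_rep_def)
  have cv: "cvecs (min_tensor E F) = alg_tensor (cvecs E) (cvecs F)" by (simp add: min_tensor_def)
  have "clinear_on (alg_tensor (cvecs E) (cvecs F)) (\<lambda>x. rep (min_tensor E F) x (j, j') (i, i'))"
    for j j' i i'
    unfolding clinear_on_def
  proof (intro ballI allI)
    fix w w' c assume "w \<in> alg_tensor (cvecs E) (cvecs F)" "w' \<in> alg_tensor (cvecs E) (cvecs F)"
    then obtain r x y r' x' y' where
      w: "w = tensor_sum r x y" "\<And>k. k < r \<Longrightarrow> x k \<in> cvecs E \<and> y k \<in> cvecs F" and
      w': "w' = tensor_sum r' x' y'" "\<And>k. k < r' \<Longrightarrow> x' k \<in> cvecs E \<and> y' k \<in> cvecs F"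
      unfolding alg_tensor_def by blast
    define X where "X k = (if k < r then (\<lambda>a. c * x k a) else x' (k - r))" for k
    define Y where "Y k = (if k < r then y k else y' (k - r))" for k
    have eq: "(\<lambda>p. c * w p + w' p) = tensor_sum (r + r') X Y"
      unfolding w w' tensor_sum_def sum_lessThan_append
      by (auto simp: fun_eq_iff X_def Y_def sum_distrib_left mult.assoc)
    have mem: "X k \<in> cvecs E \<and> Y k \<in> cvecs F" if "k < r + r'" for k
      using that w w' csubspace_scale[OF V(1)] by (auto simp: X_def Y_def)
    have sc: "rep E (\<lambda>a. c * z a) j i = c * rep E z j i" if "z \<in> cvecs E" for z
      using clinear_on_sum[OF V(1), of "\<lambda>x. rep E x j i" "{()}" "\<lambda>_. z" "\<lambda>_. c"] E that
      by (simp add: lin_rep_def)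
    have "rep (min_tensor E F) w = (\<lambda>(j, j') (i, i'). \<Sum>k<r. rep E (x k) j i * rep F (y k) j' i')"
      unfolding w(1) by (rule rep_min_tensor_sum[OF E F]) (use w in blast)
    moreover have "rep (min_tensor E F) w' =
        (\<lambda>(j, j') (i, i'). \<Sum>k<r'. rep E (x' k) j i * rep F (y' k) j' i')"
      unfolding w'(1) by (rule rep_min_tensor_sum[OF E F]) (use w' in blast)
    moreover have "rep (min_tensor E F) (\<lambda>a. c * w a + w' a) =
        (\<lambda>(j, j') (i, i'). \<Sum>k<r + r'. rep E (X k) j i * rep F (Y k) j' i')"
      unfolding eq by (rule rep_min_tensor_sum[OF E F]) (use mem in blast)
    ultimately show "rep (min_tensor E F) (\<lambda>a. c * w a + w' a) (j, j') (i, i') =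
        c * rep (min_tensor E F) w (j, j') (i, i') + rep (min_tensor E F) w' (j, j') (i, i')"
      by (simp add: sum_lessThan_append X_def Y_def sc w(2) sum_distrib_left mult.assoc)
  qed
  then show ?thesis unfolding lin_rep_def cv using csubspace_alg_tensor[OF V] by auto
qed

lemma lin_rep_realize:
  assumes "csubspace (vecs X)"
  shows "lin_rep (realize X)"
proof -
  have "clinear_on (vecs X) (\<lambda>x. rep (realize X) x (p, u, j) (q, v, i))" for p u j q v i
  proof -
    let ?P = "p = q \<and> u = v \<and> u \<in> complete_contractions X p \<and> j < p \<and> i < p"
    have eq: "rep (realize X) x (p, u, j) (q, v, i) = (if ?P then u x j i else 0)" for x
      by (simp add: realize_def)
    have lin: "clinear_on (vecs X) (\<lambda>x. u x j i)" if ?P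
      using that unfolding complete_contractions_def by blast
    show ?thesis
    proof (cases ?P)
      case True
      show ?thesis unfolding eq if_P[OF True] by (rule lin[OF True])
    next
      case False
      show ?thesis unfolding eq if_not_P[OF False] by (simp add: clinear_on_def)
    qed
  qed
  moreover have "cvecs (realize X) = vecs X" by (simp add: realize_def)
  ultimately show ?thesis using assms by (simp add: lin_rep_def split_paired_all)
qed

lemma lin_rep_column: "lin_rep column_space"
  using csubspace_ell2 by (simp add: lin_rep_def column_space_def clinear_on_def)

section \<open>A twisted convolution bound\<close>

text \<open>The additive character of the integers modulo p, kept on all integers so that exponents
  may be negative or unreduced.\<close>

definition chi :: "int \<Rightarrow> int \<Rightarrow> complex" where
  "chi p k = cis (2 * pi * of_int k / of_int p)"

lemma chi_add: "chi p (k + l) = chi p k * chi p l"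
  by (simp add: chi_def cis_mult add_divide_distrib distrib_left)

lemma chi_zero [simp]: "chi p 0 = 1"
  by (simp add: chi_def)

lemma cnj_chi: "cnj (chi p k) = chi p (- k)"
  by (simp add: chi_def cis_cnj)

lemma norm_chi [simp]: "cmod (chi p k) = 1"
  by (simp add: chi_def)

lemma chi_mult_self: "p > 0 \<Longrightarrow> chi p (p * k) = 1"
  using cis_multiple_2pi[of "of_int k"] by (simp add: chi_def mult.assoc)

lemma chi_cong:
  assumes "p > 0" "k mod p = l mod p"
  shows "chi p k = chi p l"
proof -
  have "k = l + p * (k div p - l div p)"
    using assms(2) by (metis add_diff_cancel_left' add_diff_eq diff_add_eq minus_mod_eq_mult_div right_diff_distrib)
  then show ?thesis using chi_mult_self[OF assms(1)] by (metis chi_add mult.right_neutral)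
qed

lemma chi_eq_1_imp:
  assumes "p > 0" "chi p k = 1"
  shows "p dvd k"
proof -
  have "cos (2 * pi * of_int k / of_int p) = 1"
    using assms(2) by (simp add: chi_def complex_eq_iff)
  then obtain m :: int where "2 * pi * of_int k / of_int p = of_int m * 2 * pi"
    using cos_one_2pi_int by auto
  then have "real_of_int k = of_int (p * m)" using assms(1) by (simp add: field_simps)
  then show ?thesis by (metis dvd_triv_left of_int_eq_iff)
qed

lemma sum_shift_mod:
  fixes f :: "int \<Rightarrow> 'a :: comm_monoid_add"
  assumes "p > 0"
  shows "(\<Sum>j\<in>{0..<p}. f ((j + d) mod p)) = (\<Sum>j\<in>{0..<p}. f j)"
  by (rule sum.reindex_bij_witness[where i="\<lambda>j. (j - d) mod p" and j="\<lambda>j. (j + d) mod p"])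
     (use assms in \<open>auto simp: mod_simps\<close>)

text \<open>Multiplication by \<open>chi p k\<close> permutes the summands cyclically, so the sum is
  fixed by a factor different from 1.\<close>

lemma sum_chi:
  assumes "p > 0" "\<not> p dvd k"
  shows "(\<Sum>j\<in>{0..<p}. chi p (k * j)) = 0"
proof -
  have "chi p k * (\<Sum>j\<in>{0..<p}. chi p (k * j)) = (\<Sum>j\<in>{0..<p}. chi p (k * ((j + 1) mod p)))"
    unfolding sum_distrib_left chi_add[symmetric]
    by (intro sum.cong refl chi_cong[OF assms(1)]) (simp add: mod_simps algebra_simps)
  also have "\<dots> = (\<Sum>j\<in>{0..<p}. chi p (k * j))" by (rule sum_shift_mod[OF assms(1)])
  finally have "(chi p k - 1) * (\<Sum>j\<in>{0..<p}. chi p (k * j)) = 0" by (simp add: algebra_simps)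
  then show ?thesis using chi_eq_1_imp[OF assms(1)] assms(2) by auto
qed

text \<open>Since p is prime and divides neither c nor i - i' for distinct residues, the columns of
  the character matrix are orthogonal: the matrix is sqrt p times a unitary.\<close>

lemma parseval_mod:
  assumes p: "prime p" and c: "\<not> p dvd c"
  shows "(\<Sum>j\<in>{0..<p}. (cmod (\<Sum>i\<in>{0..<p}. chi p (c * i * j) * x i))\<^sup>2)
    = of_int p * (\<Sum>i\<in>{0..<p}. (cmod (x i))\<^sup>2)"
proof -
  have p0: "p > 0" using p by (simp add: prime_gt_0_int)
  have orth: "(\<Sum>j\<in>{0..<p}. chi p (c * (i - i') * j)) = (if i' = i then of_int p else 0)"
    if "i \<in> {0..<p}" "i' \<in> {0..<p}" for i i'
  proof (cases "i' = i")
    case True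
    then show ?thesis using p0 by simp
  next
    case False
    have "\<not> p dvd i - i'"
    proof
      assume "p dvd i - i'"
      then have "i mod p = i' mod p" by (simp add: mod_eq_dvd_iff)
      then show False using that False by simp
    qed
    then have "\<not> p dvd c * (i - i')" using p c by (simp add: prime_dvd_mult_iff)
    then show ?thesis using sum_chi[OF p0] False by simp
  qed
  have "complex_of_real (\<Sum>j\<in>{0..<p}. (cmod (\<Sum>i\<in>{0..<p}. chi p (c * i * j) * x i))\<^sup>2)
     = (\<Sum>j\<in>{0..<p}. (\<Sum>i\<in>{0..<p}. chi p (c * i * j) * x i) * cnj (\<Sum>i\<in>{0..<p}. chi p (c * i * j) * x i))"
    by (simp only: of_real_sum complex_norm_square)
  also have "\<dots> = (\<Sum>j\<in>{0..<p}. \<Sum>i\<in>{0..<p}. \<Sum>i'\<in>{0..<p}. chi p (c * (i - i') * j) * (x i * cnj (x i')))"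
    by (auto simp: sum_product cnj_chi chi_add[symmetric] algebra_simps intro!: sum.cong)
  also have "\<dots> = (\<Sum>i\<in>{0..<p}. \<Sum>i'\<in>{0..<p}. \<Sum>j\<in>{0..<p}. chi p (c * (i - i') * j) * (x i * cnj (x i')))"
    by (subst sum.swap, rule sum.cong[OF refl], rule sum.swap)
  also have "\<dots> = (\<Sum>i\<in>{0..<p}. \<Sum>i'\<in>{0..<p}. if i' = i then of_int p * (x i * cnj (x i')) else 0)"
    by (intro sum.cong refl) (auto simp: sum_distrib_right[symmetric] orth)
  also have "\<dots> = (\<Sum>i\<in>{0..<p}. of_int p * (x i * cnj (x i)))"
    by (simp add: sum.delta)
  also have "\<dots> = complex_of_real (of_int p * (\<Sum>i\<in>{0..<p}. (cmod (x i))\<^sup>2))"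
    by (simp only: of_real_mult of_real_sum complex_norm_square sum_distrib_left of_real_of_int_eq)
  finally show ?thesis by (simp only: of_real_eq_iff)
qed

text \<open>Parseval in each coordinate z gives norm at most p N for the transformed family, the
  other family has norm at most sqrt p N, and Cauchy-Schwarz multiplies the two. The trivial bound
  p^2 N^2 is improved by a factor sqrt p.\<close>

lemma chi_form_bound:
  fixes \<alpha> \<beta> :: "int \<Rightarrow> 'z \<Rightarrow> complex"
  assumes p: "prime p" and c: "\<not> p dvd c" and Q: "finite Q" and N: "0 \<le> N"
    and a: "\<And>i. vnorm Q (\<alpha> i) \<le> N" and b: "\<And>j. vnorm Q (\<beta> j) \<le> N"
  shows "cmod (\<Sum>j\<in>{0..<p}. \<Sum>z\<in>Q. (\<Sum>i\<in>{0..<p}. chi p (c * i * j) * \<alpha> i z) * cnj (\<beta> j z))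
    \<le> of_int p * sqrt (of_int p) * N\<^sup>2"
proof -
  have p0: "p > 0" using p by (simp add: prime_gt_0_int)
  let ?P = "{0..<p} \<times> Q"
  define \<gamma> where "\<gamma> = (\<lambda>(j, z). \<Sum>i\<in>{0..<p}. chi p (c * i * j) * \<alpha> i z)"
  define \<delta> where "\<delta> = (\<lambda>(j, z). \<beta> j z)"
  have bound: "(\<Sum>i\<in>{0..<p}. \<Sum>z\<in>Q. (cmod (\<theta> i z))\<^sup>2) \<le> of_int p * N\<^sup>2"
    if "\<And>i. vnorm Q (\<theta> i) \<le> N" for \<theta> :: "int \<Rightarrow> 'z \<Rightarrow> complex"
  proof -
    have "(\<Sum>i\<in>{0..<p}. \<Sum>z\<in>Q. (cmod (\<theta> i z))\<^sup>2) \<le> (\<Sum>i\<in>{0..<p}. N\<^sup>2)"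
      unfolding vnorm_square[symmetric] by (intro sum_mono power_mono that) simp
    then show ?thesis using p0 by simp
  qed
  have "(vnorm ?P \<gamma>)\<^sup>2 = (\<Sum>z\<in>Q. \<Sum>j\<in>{0..<p}. (cmod (\<gamma> (j, z)))\<^sup>2)"
    unfolding vnorm_square sum.cartesian_product' by (rule sum.swap)
  also have "\<dots> = (\<Sum>z\<in>Q. of_int p * (\<Sum>i\<in>{0..<p}. (cmod (\<alpha> i z))\<^sup>2))"
    unfolding \<gamma>_def by (simp add: parseval_mod[OF p c])
  also have "\<dots> = of_int p * (\<Sum>i\<in>{0..<p}. \<Sum>z\<in>Q. (cmod (\<alpha> i z))\<^sup>2)"
    unfolding sum_distrib_left[symmetric] by (subst sum.swap) simp
  also have "\<dots> \<le> of_int p * (of_int p * N\<^sup>2)"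
    by (rule mult_left_mono[OF bound[OF a]]) (use p0 in simp)
  finally have "(vnorm ?P \<gamma>)\<^sup>2 \<le> (of_int p * N)\<^sup>2" by (simp add: power2_eq_square mult_ac)
  then have 1: "vnorm ?P \<gamma> \<le> of_int p * N" by (rule power2_le_imp_le) (use N p0 in simp)
  have "(vnorm ?P \<delta>)\<^sup>2 \<le> of_int p * N\<^sup>2"
    unfolding vnorm_square sum.cartesian_product' \<delta>_def using bound[OF b] by simp
  also have "\<dots> = (sqrt (of_int p) * N)\<^sup>2" using p0 by (simp add: power_mult_distrib)
  finally have 2: "vnorm ?P \<delta> \<le> sqrt (of_int p) * N" by (rule power2_le_imp_le) (use N p0 in simp)
  have "(\<Sum>j\<in>{0..<p}. \<Sum>z\<in>Q. (\<Sum>i\<in>{0..<p}. chi p (c * i * j) * \<alpha> i z) * cnj (\<beta> j z))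
      = (\<Sum>q\<in>?P. \<gamma> q * cnj (\<delta> q))"
    unfolding sum.cartesian_product' \<gamma>_def \<delta>_def by simp
  also have "cmod \<dots> \<le> vnorm ?P \<gamma> * vnorm ?P \<delta>" by (rule cmod_inner_le)
  also have "\<dots> \<le> (of_int p * N) * (sqrt (of_int p) * N)"
    by (intro mult_mono 1 2) (use N p0 in auto)
  finally show ?thesis by (simp add: power2_eq_square mult_ac)
qed

section \<open>Operators acting on one tensor factor\<close>

lemma vnorm_tensor_left:
  assumes "fin_bd S S 1 c"
  shows "vnorm (S \<times> T) (\<lambda>(s, t). \<Sum>s1\<in>S. c s s1 * \<xi> (s1, t)) \<le> vnorm (S \<times> T) \<xi>"
proof -
  have "(vnorm (S \<times> T) (\<lambda>(s, t). \<Sum>s1\<in>S. c s s1 * \<xi> (s1, t)))\<^sup>2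
      = (\<Sum>t\<in>T. (vnorm S (\<lambda>s. \<Sum>s1\<in>S. c s s1 * \<xi> (s1, t)))\<^sup>2)"
    unfolding vnorm_square sum.cartesian_product' by (subst sum.swap) simp
  also have "\<dots> \<le> (\<Sum>t\<in>T. (vnorm S (\<lambda>s. \<xi> (s, t)))\<^sup>2)"
    using fin_bdD[OF assms] by (intro sum_mono power_mono) auto
  also have "\<dots> = (vnorm (S \<times> T) \<xi>)\<^sup>2"
    unfolding vnorm_square sum.cartesian_product' by (subst sum.swap) simp
  finally show ?thesis by (rule power2_le_imp_le) simp
qed

lemma vnorm_tensor_right:
  assumes "fin_bd T T 1 c"
  shows "vnorm (S \<times> T) (\<lambda>(s, t). \<Sum>t1\<in>T. c t t1 * \<xi> (s, t1)) \<le> vnorm (S \<times> T) \<xi>"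
proof -
  have "(vnorm (S \<times> T) (\<lambda>(s, t). \<Sum>t1\<in>T. c t t1 * \<xi> (s, t1)))\<^sup>2
      = (\<Sum>s\<in>S. (vnorm T (\<lambda>t. \<Sum>t1\<in>T. c t t1 * \<xi> (s, t1)))\<^sup>2)"
    unfolding vnorm_square sum.cartesian_product' by simp
  also have "\<dots> \<le> (\<Sum>s\<in>S. (vnorm T (\<lambda>t. \<xi> (s, t)))\<^sup>2)"
    using fin_bdD[OF assms] by (intro sum_mono power_mono) auto
  also have "\<dots> = (vnorm (S \<times> T) \<xi>)\<^sup>2"
    unfolding vnorm_square sum.cartesian_product' by simp
  finally show ?thesis by (rule power2_le_imp_le) simp
qed

text \<open>\<open>\<langle>(a\<otimes>b)\<xi>, (a'\<otimes>b')\<xi>\<rangle> = \<langle>(a'\<^sup>*a\<otimes>1)\<xi>, (1\<otimes>b\<^sup>*b')\<xi>\<rangle>\<close>.\<close>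

lemma inner_tensor_swap:
  fixes a a' :: "'s \<Rightarrow> 's \<Rightarrow> complex" and b b' :: "'t \<Rightarrow> 't \<Rightarrow> complex"
  shows "(\<Sum>s\<in>S. \<Sum>t\<in>T. (\<Sum>s1\<in>S. \<Sum>t1\<in>T. a s s1 * b t t1 * \<xi> (s1, t1)) *
        cnj (\<Sum>s2\<in>S. \<Sum>t2\<in>T. a' s s2 * b' t t2 * \<xi> (s2, t2)))
    = (\<Sum>s2\<in>S. \<Sum>t1\<in>T. (\<Sum>s1\<in>S. (\<Sum>s\<in>S. cnj (a' s s2) * a s s1) * \<xi> (s1, t1)) *
        cnj (\<Sum>t2\<in>T. (\<Sum>t\<in>T. cnj (b t t1) * b' t t2) * \<xi> (s2, t2)))"
proof -
  let ?g = "\<lambda>s t s1 t1 s2 t2. a s s1 * b t t1 * \<xi> (s1, t1) * cnj (a' s s2 * b' t t2 * \<xi> (s2, t2))"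
  have "(\<Sum>s\<in>S. \<Sum>t\<in>T. (\<Sum>s1\<in>S. \<Sum>t1\<in>T. a s s1 * b t t1 * \<xi> (s1, t1)) *
        cnj (\<Sum>s2\<in>S. \<Sum>t2\<in>T. a' s s2 * b' t t2 * \<xi> (s2, t2)))
    = (\<Sum>(s, t, s2, t2, s1, t1)\<in>S \<times> T \<times> S \<times> T \<times> S \<times> T. ?g s t s1 t1 s2 t2)"
    unfolding sum.cartesian_product' by (simp add: sum_distrib_left sum_distrib_right mult_ac)
  \<comment> \<open>The operators a, a' involve only s, s1, s2 and b, b' only t, t1, t2. Taking s2
    and t1 as outer indices sums s and t inside and so forms the two products of an adjoint with an
    operator.\<close>
  also have "\<dots> = (\<Sum>(s2, t1, t2, s1, t, s)\<in>S \<times> T \<times> T \<times> S \<times> T \<times> S. ?g s t s1 t1 s2 t2)"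
    by (rule sum.reindex_bij_witness[where
          i="\<lambda>(s2, t1, t2, s1, t, s). (s, t, s2, t2, s1, t1)" and
          j="\<lambda>(s, t, s2, t2, s1, t1). (s2, t1, t2, s1, t, s)"]) auto
  also have "\<dots> = (\<Sum>s2\<in>S. \<Sum>t1\<in>T. (\<Sum>s1\<in>S. (\<Sum>s\<in>S. cnj (a' s s2) * a s s1) * \<xi> (s1, t1)) *
        cnj (\<Sum>t2\<in>T. (\<Sum>t\<in>T. cnj (b t t1) * b' t t2) * \<xi> (s2, t2)))"
    unfolding sum.cartesian_product'
    by (simp add: sum_distrib_left sum_distrib_right mult_ac)
  finally show ?thesis .
qed

text \<open>Distributes a phase over the two sides of an inner product; \<open>c3\<close> moves to
  the second side and is conjugated there.\<close>

lemma sum_inner_scale: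
  fixes c1 c2 c3 :: complex
  shows "(c1 * c2 * c3) * (\<Sum>s\<in>S. \<Sum>t\<in>T. x s t * cnj (y s t)) =
    (\<Sum>s\<in>S. \<Sum>t\<in>T. c1 * (c2 * x s t) * cnj (cnj c3 * y s t))"
  by (simp add: sum_distrib_left mult_ac)

text \<open>A cubic exponent is chosen because its difference along the shift (i, j) to (i + d, j -
  d) is quadratic and keeps a mixed term in i and j. For a quadratic exponent the difference would
  have none, and no cancellation would result.\<close>

definition cubic_phase :: "int \<Rightarrow> int \<Rightarrow> int \<Rightarrow> complex" where
  "cubic_phase p i j = chi p (i * i * j)"

lemma norm_eps [simp]: "cmod (cubic_phase p i j) = 1"
  by (simp add: cubic_phase_def)

text \<open>Here (i+d)^2 (j-d) - i^2 j = 2dij - d(i+d)^2 + d^2 j: only the first term couples i and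
  j, the others are phases attached to i alone and to j alone once d is fixed.\<close>

lemma cubic_phase_shift:
  assumes "p > 0"
  shows "cnj (cubic_phase p i j) * cubic_phase p ((i + d) mod p) ((j - d) mod p)
    = chi p (2 * d * i * j) * chi p (- (d * (i + d) * (i + d))) * chi p (d * d * j)"
proof -
  have "cubic_phase p ((i + d) mod p) ((j - d) mod p) = chi p ((i + d) * (i + d) * (j - d))"
    unfolding cubic_phase_def by (intro chi_cong[OF assms] mod_mult_cong) simp_all
  then show ?thesis
    unfolding cubic_phase_def cnj_chi by (simp add: chi_add[symmetric] algebra_simps)
qed

lemma vnorm_unimodular: "cmod c = 1 \<Longrightarrow> vnorm F (\<lambda>z. c * x z) = vnorm F x"
  by (simp add: vnorm_scale)

text \<open>The pairs of summands in the expanded square are sorted by their distance d.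
  \<open>D d\<close> collects distance d; it is a bilinear form with a character matrix as
  kernel.\<close>

lemma twisted_convolution_bound:
  fixes a :: "int \<Rightarrow> 's \<Rightarrow> 's \<Rightarrow> complex" and b :: "int \<Rightarrow> 't \<Rightarrow> 't \<Rightarrow> complex"
    and \<xi> :: "'s \<times> 't \<Rightarrow> complex"
  assumes p: "prime p" "p \<noteq> 2" and fin: "finite S" "finite T"
    and a: "\<And>i. fin_bd S S 1 (a i)" and b: "\<And>j. fin_bd T T 1 (b j)"
  defines "v \<equiv> \<lambda>i j s t. \<Sum>s1\<in>S. \<Sum>t1\<in>T. a i s s1 * b j t t1 * \<xi> (s1, t1)"
  shows "(\<Sum>l\<in>{0..<p}. \<Sum>s\<in>S. \<Sum>t\<in>T. (cmod (\<Sum>i\<in>{0..<p}.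
      cnj (cubic_phase p i ((l - i) mod p)) * v i ((l - i) mod p) s t))\<^sup>2)
    \<le> 2 * (of_int p)\<^sup>2 * sqrt (of_int p) * (vnorm (S \<times> T) \<xi>)\<^sup>2"
proof -
  have p0: "p > 0" using p by (simp add: prime_gt_0_int)
  let ?Z = "{0..<p}" and ?Q = "S \<times> T"
  define N where "N = vnorm ?Q \<xi>"
  have N0: "0 \<le> N" by (simp add: N_def)
  define A where "A l i s t = cnj (cubic_phase p i ((l - i) mod p)) * v i ((l - i) mod p) s t" for l i s t
  \<comment> \<open>The two sides of the swapped inner product, with a product of two a's on the
    first leg and of two b's on the second. For fixed d each side takes the phase that depends on
    its own index only.\<close>
  define \<alpha> where "\<alpha> d i = (\<lambda>(s2, t1). chi p (- (d * (i + d) * (i + d))) *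
      (\<Sum>s1\<in>S. (\<Sum>s\<in>S. cnj (a ((i + d) mod p) s s2) * a i s s1) * \<xi> (s1, t1)))" for d i
  define \<beta> where "\<beta> d j = (\<lambda>(s2, t1). cnj (chi p (d * d * j)) *
      (\<Sum>t2\<in>T. (\<Sum>t\<in>T. cnj (b j t t1) * b ((j - d) mod p) t t2) * \<xi> (s2, t2)))" for d j
  define D where "D d = (\<Sum>j\<in>?Z. \<Sum>z\<in>?Q. (\<Sum>i\<in>?Z. chi p (2 * d * i * j) * \<alpha> d i z) * cnj (\<beta> d j z))" for d
  have na: "vnorm ?Q (\<alpha> d i) \<le> N" for d i
  proof -
    have "fin_bd S S (1 * 1) (\<lambda>s2 s1. \<Sum>s\<in>S. cnj (a ((i + d) mod p) s s2) * a i s s1)"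
      by (rule fin_bd_mult[OF fin_bd_adjoint[OF a] a]) auto
    then have "vnorm ?Q (\<lambda>(s2, t1). \<Sum>s1\<in>S. (\<Sum>s\<in>S. cnj (a ((i + d) mod p) s s2) * a i s s1) * \<xi> (s1, t1)) \<le> N"
      unfolding N_def by (intro vnorm_tensor_left) simp
    moreover have "\<alpha> d i = (\<lambda>z. chi p (- (d * (i + d) * (i + d))) *
        (case z of (s2, t1) \<Rightarrow> \<Sum>s1\<in>S. (\<Sum>s\<in>S. cnj (a ((i + d) mod p) s s2) * a i s s1) * \<xi> (s1, t1)))"
      by (auto simp: \<alpha>_def)
    ultimately show ?thesis by (simp only: vnorm_unimodular[OF norm_chi])
  qed
  have nb: "vnorm ?Q (\<beta> d j) \<le> N" for d j
  proof -
    have "fin_bd T T (1 * 1) (\<lambda>t1 t2. \<Sum>t\<in>T. cnj (b j t t1) * b ((j - d) mod p) t t2)"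
      by (rule fin_bd_mult[OF fin_bd_adjoint[OF b] b]) auto
    then have "vnorm ?Q (\<lambda>(s2, t1). \<Sum>t2\<in>T. (\<Sum>t\<in>T. cnj (b j t t1) * b ((j - d) mod p) t t2) * \<xi> (s2, t2)) \<le> N"
      unfolding N_def by (intro vnorm_tensor_right) simp
    moreover have "\<beta> d j = (\<lambda>z. cnj (chi p (d * d * j)) *
        (case z of (s2, t1) \<Rightarrow> \<Sum>t2\<in>T. (\<Sum>t\<in>T. cnj (b j t t1) * b ((j - d) mod p) t t2) * \<xi> (s2, t2)))"
      by (auto simp: \<beta>_def)
    ultimately show ?thesis by (simp only: vnorm_unimodular complex_mod_cnj norm_chi)
  qed
  have Dd: "cmod (D d) \<le> of_int p * sqrt (of_int p) * N\<^sup>2" if "d \<in> ?Z - {0}" for d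
  proof -
    \<comment> \<open>Oddness of p enters here: the frequency 2d of the character matrix has to be
      invertible modulo p.\<close>
    have "\<not> p dvd 2 * d"
    proof
      assume "p dvd 2 * d"
      then have "p dvd 2 \<or> p dvd d" using p by (simp add: prime_dvd_mult_iff)
      moreover have "\<not> p dvd d" using that by (auto dest: zdvd_imp_le)
      moreover have "\<not> p dvd 2" using p prime_gt_1_int[of p] by (auto dest: zdvd_imp_le)
      ultimately show False by blast
    qed
    then show ?thesis unfolding D_def
      by (intro chi_form_bound[OF p(1)]) (use fin N0 na nb in auto)
  qed
  have D0: "cmod (D 0) \<le> (of_int p)\<^sup>2 * N\<^sup>2"
  proof -
    \<comment> \<open>For d = 0 all phases are 1 and nothing cancels, so each of the p^2 inner
      products is estimated by Cauchy-Schwarz.\<close>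
    have "D 0 = (\<Sum>j\<in>?Z. \<Sum>i\<in>?Z. \<Sum>z\<in>?Q. \<alpha> 0 i z * cnj (\<beta> 0 j z))"
      unfolding D_def by (rule sum.cong[OF refl]) (simp add: sum_distrib_right, rule sum.swap)
    also have "cmod \<dots> \<le> (\<Sum>j\<in>?Z. \<Sum>i\<in>?Z. N * N)"
      by (intro sum_norm_le order_trans[OF cmod_inner_le] mult_mono na nb N0) simp
    also have "\<dots> = (of_int p)\<^sup>2 * N\<^sup>2" using p0 by (simp add: power2_eq_square)
    finally show ?thesis .
  qed
  have summand: "(\<Sum>s\<in>S. \<Sum>t\<in>T. A ((j + i) mod p) i s t * cnj (A ((j + i) mod p) ((d + i) mod p) s t))
      = (\<Sum>z\<in>?Q. chi p (2 * d * i * j) * \<alpha> d i z * cnj (\<beta> d j z))"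
    if "i \<in> ?Z" "j \<in> ?Z" for d i j
  proof -
    let ?i = "(i + d) mod p" and ?j = "(j - d) mod p"
    have m: "((j + i) mod p - i) mod p = j" "((j + i) mod p - (d + i) mod p) mod p = ?j"
      "(d + i) mod p = ?i"
      using that by (simp_all add: mod_simps add.commute)
    have "(\<Sum>s\<in>S. \<Sum>t\<in>T. A ((j + i) mod p) i s t * cnj (A ((j + i) mod p) ((d + i) mod p) s t))
      = (cnj (cubic_phase p i j) * cubic_phase p ?i ?j) * (\<Sum>s\<in>S. \<Sum>t\<in>T. v i j s t * cnj (v ?i ?j s t))"
      unfolding A_def m(1,2) unfolding m(3) by (simp add: sum_distrib_left mult_ac)
    also have "(\<Sum>s\<in>S. \<Sum>t\<in>T. v i j s t * cnj (v ?i ?j s t)) =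
        (\<Sum>s2\<in>S. \<Sum>t1\<in>T. (\<Sum>s1\<in>S. (\<Sum>s\<in>S. cnj (a ?i s s2) * a i s s1) * \<xi> (s1, t1)) *
          cnj (\<Sum>t2\<in>T. (\<Sum>t\<in>T. cnj (b j t t1) * b ?j t t2) * \<xi> (s2, t2)))"
      unfolding v_def by (rule inner_tensor_swap)
    also have "(cnj (cubic_phase p i j) * cubic_phase p ?i ?j) * \<dots> =
        (\<Sum>s2\<in>S. \<Sum>t1\<in>T. chi p (2 * d * i * j) * \<alpha> d i (s2, t1) * cnj (\<beta> d j (s2, t1)))"
      unfolding cubic_phase_shift[OF p0] \<alpha>_def \<beta>_def prod.case by (rule sum_inner_scale)
    also have "\<dots> = (\<Sum>z\<in>?Q. chi p (2 * d * i * j) * \<alpha> d i z * cnj (\<beta> d j z))"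
      unfolding sum.cartesian_product' by simp
    finally show ?thesis .
  qed
  have "complex_of_real (\<Sum>l\<in>?Z. \<Sum>s\<in>S. \<Sum>t\<in>T. (cmod (\<Sum>i\<in>?Z. A l i s t))\<^sup>2)
      = (\<Sum>l\<in>?Z. \<Sum>s\<in>S. \<Sum>t\<in>T. (\<Sum>i\<in>?Z. A l i s t) * cnj (\<Sum>i'\<in>?Z. A l i' s t))"
    by (simp only: of_real_sum complex_norm_square)
  also have "\<dots> = (\<Sum>l\<in>?Z. \<Sum>s\<in>S. \<Sum>t\<in>T. \<Sum>i\<in>?Z. \<Sum>i'\<in>?Z. A l i s t * cnj (A l i' s t))"
    by (simp only: cnj_sum sum_product)
  \<comment> \<open>The second index becomes i + d, so that d measures the distance from the
    diagonal.\<close>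
  also have "\<dots> = (\<Sum>l\<in>?Z. \<Sum>s\<in>S. \<Sum>t\<in>T. \<Sum>i\<in>?Z. \<Sum>d\<in>?Z. A l i s t * cnj (A l ((d + i) mod p) s t))"
    by (intro sum.cong refl sum_shift_mod[OF p0, symmetric, of "\<lambda>i'. _ * cnj (A _ i' _ _)"])
  also have "\<dots> = (\<Sum>(l, s, t, i, d)\<in>?Z \<times> S \<times> T \<times> ?Z \<times> ?Z. A l i s t * cnj (A l ((d + i) mod p) s t))"
    unfolding sum.cartesian_product' by simp
  also have "\<dots> = (\<Sum>(d, i, l, s, t)\<in>?Z \<times> ?Z \<times> ?Z \<times> S \<times> T. A l i s t * cnj (A l ((d + i) mod p) s t))"
    by (rule sum.reindex_bij_witness[where
          i="\<lambda>(d, i, l, s, t). (l, s, t, i, d)" and j="\<lambda>(l, s, t, i, d). (d, i, l, s, t)"]) auto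
  also have "\<dots> = (\<Sum>d\<in>?Z. \<Sum>i\<in>?Z. \<Sum>l\<in>?Z. \<Sum>s\<in>S. \<Sum>t\<in>T. A l i s t * cnj (A l ((d + i) mod p) s t))"
    unfolding sum.cartesian_product' by simp
  \<comment> \<open>The output index l becomes i + j, which turns the arguments of the two phases
    into (i, j) and (i + d, j - d).\<close>
  also have "\<dots> = (\<Sum>d\<in>?Z. \<Sum>i\<in>?Z. \<Sum>j\<in>?Z. \<Sum>s\<in>S. \<Sum>t\<in>T.
      A ((j + i) mod p) i s t * cnj (A ((j + i) mod p) ((d + i) mod p) s t))"
    by (intro sum.cong refl sum_shift_mod[OF p0, symmetric])
  also have "\<dots> = (\<Sum>d\<in>?Z. \<Sum>i\<in>?Z. \<Sum>j\<in>?Z. \<Sum>z\<in>?Q. chi p (2 * d * i * j) * \<alpha> d i z * cnj (\<beta> d j z))"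
    by (intro sum.cong refl summand)
  also have "\<dots> = (\<Sum>d\<in>?Z. D d)"
  proof (rule sum.cong[OF refl])
    fix d
    have "(\<Sum>i\<in>?Z. \<Sum>j\<in>?Z. \<Sum>z\<in>?Q. chi p (2 * d * i * j) * \<alpha> d i z * cnj (\<beta> d j z)) =
        (\<Sum>j\<in>?Z. \<Sum>z\<in>?Q. \<Sum>i\<in>?Z. chi p (2 * d * i * j) * \<alpha> d i z * cnj (\<beta> d j z))"
      by (subst sum.swap, rule sum.cong[OF refl], rule sum.swap)
    then show "(\<Sum>i\<in>?Z. \<Sum>j\<in>?Z. \<Sum>z\<in>?Q. chi p (2 * d * i * j) * \<alpha> d i z * cnj (\<beta> d j z)) = D d"
      unfolding D_def by (simp only: sum_distrib_right)
  qed
  finally have eq: "complex_of_real (\<Sum>l\<in>?Z. \<Sum>s\<in>S. \<Sum>t\<in>T. (cmod (\<Sum>i\<in>?Z. A l i s t))\<^sup>2) = (\<Sum>d\<in>?Z. D d)" .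
  have "(\<Sum>l\<in>?Z. \<Sum>s\<in>S. \<Sum>t\<in>T. (cmod (\<Sum>i\<in>?Z. A l i s t))\<^sup>2) = cmod (\<Sum>d\<in>?Z. D d)"
    unfolding eq[symmetric] norm_of_real by (simp add: sum_nonneg)
  also have "\<dots> \<le> (\<Sum>d\<in>?Z. cmod (D d))" by (rule norm_sum)
  also have "\<dots> = cmod (D 0) + (\<Sum>d\<in>?Z - {0}. cmod (D d))"
    by (rule sum.remove) (use p0 in auto)
  also have "\<dots> \<le> (of_int p)\<^sup>2 * N\<^sup>2 + (\<Sum>d\<in>?Z - {0}. of_int p * sqrt (of_int p) * N\<^sup>2)"
    by (intro add_mono D0 sum_mono Dd)
  \<comment> \<open>Both parts are enlarged to the same size: the diagonal because sqrt p is at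
    least 1, the remaining p - 1 terms by counting p of them.\<close>
  also have "\<dots> \<le> (of_int p)\<^sup>2 * sqrt (of_int p) * N\<^sup>2 + (of_int p)\<^sup>2 * sqrt (of_int p) * N\<^sup>2"
  proof (rule add_mono)
    have "(of_int p)\<^sup>2 * N\<^sup>2 * 1 \<le> (of_int p)\<^sup>2 * N\<^sup>2 * sqrt (of_int p)"
      by (rule mult_left_mono) (use p0 in auto)
    then show "(of_int p)\<^sup>2 * N\<^sup>2 \<le> (of_int p)\<^sup>2 * sqrt (of_int p) * N\<^sup>2" by (simp add: mult_ac)
    have "(\<Sum>d\<in>?Z - {0}. of_int p * sqrt (of_int p) * N\<^sup>2) \<le> (\<Sum>d\<in>?Z. of_int p * sqrt (of_int p) * N\<^sup>2)"
      by (rule sum_mono2) (use p0 in auto)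
    then show "(\<Sum>d\<in>?Z - {0}. of_int p * sqrt (of_int p) * N\<^sup>2) \<le> (of_int p)\<^sup>2 * sqrt (of_int p) * N\<^sup>2"
      using p0 by (simp add: power2_eq_square mult_ac)
  qed
  finally show ?thesis unfolding A_def N_def by (simp add: mult_ac)
qed

section \<open>Compact operators\<close>

lemma bounded_matD:
  assumes "bounded_mat a"
  shows "\<exists>K. bd_by K a" "\<xi> \<in> ell2 \<Longrightarrow> (\<lambda>i. a j i * \<xi> i) summable_on UNIV"
  using assms unfolding bounded_mat_def bd_by_def by blast+

lemma mat_app_comb:
  assumes "bounded_mat a" "bounded_mat b" "\<xi> \<in> ell2"
  shows "mat_app (\<lambda>j i. c * a j i + b j i) \<xi> = (\<lambda>j. c * mat_app a \<xi> j + mat_app b \<xi> j)"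
    and "(\<lambda>i. (c * a j i + b j i) * \<xi> i) summable_on UNIV"
proof -
  have s: "(\<lambda>i. c * (a j i * \<xi> i)) summable_on UNIV" "(\<lambda>i. b j i * \<xi> i) summable_on UNIV" for j
    using bounded_matD(2)[OF assms(1,3)] bounded_matD(2)[OF assms(2,3)] summable_on_cmult_right by blast+
  have e: "(\<lambda>i. (c * a j i + b j i) * \<xi> i) = (\<lambda>i. c * (a j i * \<xi> i) + b j i * \<xi> i)" for j
    by (simp add: algebra_simps)
  show "(\<lambda>i. (c * a j i + b j i) * \<xi> i) summable_on UNIV"
    unfolding e by (rule summable_on_add[OF s])
  show "mat_app (\<lambda>j i. c * a j i + b j i) \<xi> = (\<lambda>j. c * mat_app a \<xi> j + mat_app b \<xi> j)"
    unfolding mat_app_def e by (simp add: infsum_add[OF s] infsum_cmult_right')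
qed

lemma bounded_mat_comb:
  assumes a: "bounded_mat a" and b: "bounded_mat b"
  shows "bounded_mat (\<lambda>j i. c * a j i + b j i)"
proof -
  obtain K L where K: "bd_by K a" and L: "bd_by L b" using bounded_matD(1) a b by blast
  have "(\<forall>j. (\<lambda>i. (c * a j i + b j i) * \<xi> i) summable_on UNIV) \<and>
      mat_app (\<lambda>j i. c * a j i + b j i) \<xi> \<in> ell2 \<and>
      ell2_norm (mat_app (\<lambda>j i. c * a j i + b j i) \<xi>) \<le> (cmod c * K + L) * ell2_norm \<xi>"
    if xi: "\<xi> \<in> ell2" for \<xi>
  proof -
    have A: "mat_app a \<xi> \<in> ell2" "ell2_norm (mat_app a \<xi>) \<le> K * ell2_norm \<xi>"
      and B: "mat_app b \<xi> \<in> ell2" "ell2_norm (mat_app b \<xi>) \<le> L * ell2_norm \<xi>"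
      using K L xi by (auto simp: bd_by_def)
    have "ell2_norm (\<lambda>j. c * mat_app a \<xi> j + mat_app b \<xi> j)
        \<le> cmod c * ell2_norm (mat_app a \<xi>) + ell2_norm (mat_app b \<xi>)"
      using ell2_add(2)[OF ell2_scale(1)[OF A(1)] B(1)] ell2_scale(2)[OF A(1)] by metis
    also have "\<dots> \<le> cmod c * (K * ell2_norm \<xi>) + L * ell2_norm \<xi>"
      by (intro add_mono mult_left_mono A B) simp
    finally have "ell2_norm (\<lambda>j. c * mat_app a \<xi> j + mat_app b \<xi> j) \<le> (cmod c * K + L) * ell2_norm \<xi>"
      by (simp add: algebra_simps)
    then show ?thesis
      unfolding mat_app_comb(1)[OF a b xi]
      using mat_app_comb(2)[OF a b xi] ell2_add(1)[OF ell2_scale(1)[OF A(1)] B(1)] by blast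
  qed
  then show ?thesis unfolding bounded_mat_def by blast
qed

text \<open>A subsequence that works for \<open>a\<close> is thinned out once more to work for
  \<open>b\<close>; convergence for \<open>a\<close> survives the thinning.\<close>

lemma compact_mat_comb:
  assumes a: "compact_mat a" and b: "compact_mat b"
  shows "compact_mat (\<lambda>j i. c * a j i + b j i)"
  unfolding compact_mat_def
proof (intro conjI allI impI)
  have ba: "bounded_mat a" and bb: "bounded_mat b" using a b by (auto simp: compact_mat_def)
  show "bounded_mat (\<lambda>j i. c * a j i + b j i)" by (rule bounded_mat_comb[OF ba bb])
  fix \<xi> :: "nat \<Rightarrow> 'b \<Rightarrow> complex" assume xi: "\<forall>n. \<xi> n \<in> ell2 \<and> ell2_norm (\<xi> n) \<le> 1"
  obtain r \<eta> where r: "strict_mono r" "\<eta> \<in> ell2"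
    "(\<lambda>n. ell2_norm (\<lambda>j. mat_app a (\<xi> (r n)) j - \<eta> j)) \<longlonglongrightarrow> 0"
    using a xi unfolding compact_mat_def by blast
  have "\<forall>n. \<xi> (r n) \<in> ell2 \<and> ell2_norm (\<xi> (r n)) \<le> 1" using xi by simp
  then obtain r' \<eta>' where r': "strict_mono r'" "\<eta>' \<in> ell2"
    "(\<lambda>n. ell2_norm (\<lambda>j. mat_app b (\<xi> (r (r' n))) j - \<eta>' j)) \<longlonglongrightarrow> 0"
    using b unfolding compact_mat_def by (elim conjE allE[of _ "\<lambda>n. \<xi> (r n)"]) blast
  define R where "R = r \<circ> r'"
  have R: "strict_mono R" unfolding R_def using r(1) r'(1) by (rule strict_mono_o)
  define \<theta> where "\<theta> j = c * \<eta> j + \<eta>' j" for j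
  have th: "\<theta> \<in> ell2" unfolding \<theta>_def by (intro ell2_add ell2_scale r r')
  have A: "mat_app a (\<xi> n) \<in> ell2" "mat_app b (\<xi> n) \<in> ell2" for n
    using bounded_matD(1)[OF ba] bounded_matD(1)[OF bb] xi by (auto simp: bd_by_def)
  have le: "ell2_norm (\<lambda>j. mat_app (\<lambda>j i. c * a j i + b j i) (\<xi> (R n)) j - \<theta> j) \<le>
      cmod c * ell2_norm (\<lambda>j. mat_app a (\<xi> (R n)) j - \<eta> j) + ell2_norm (\<lambda>j. mat_app b (\<xi> (R n)) j - \<eta>' j)" for n
  proof -
    have x: "\<xi> (R n) \<in> ell2" using xi by simp
    have d: "(\<lambda>j. mat_app a (\<xi> (R n)) j - \<eta> j) \<in> ell2" "(\<lambda>j. mat_app b (\<xi> (R n)) j - \<eta>' j) \<in> ell2"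
      using ell2_add(1)[OF A(1) ell2_scale(1)[OF r(2), of "-1"]]
        ell2_add(1)[OF A(2) ell2_scale(1)[OF r'(2), of "-1"]] by simp_all
    have "(\<lambda>j. mat_app (\<lambda>j i. c * a j i + b j i) (\<xi> (R n)) j - \<theta> j) =
      (\<lambda>j. c * (mat_app a (\<xi> (R n)) j - \<eta> j) + (mat_app b (\<xi> (R n)) j - \<eta>' j))"
      unfolding mat_app_comb(1)[OF ba bb x] \<theta>_def by (simp add: algebra_simps)
    then show ?thesis
      using ell2_add(2)[OF ell2_scale(1)[OF d(1), of c] d(2)] ell2_scale(2)[OF d(1), of c] by simp
  qed
  have t1: "(\<lambda>n. ell2_norm (\<lambda>j. mat_app a (\<xi> (R n)) j - \<eta> j)) \<longlonglongrightarrow> 0"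
    using LIMSEQ_subseq_LIMSEQ[OF r(3) r'(1)] by (simp add: R_def o_def)
  have t2: "(\<lambda>n. ell2_norm (\<lambda>j. mat_app b (\<xi> (R n)) j - \<eta>' j)) \<longlonglongrightarrow> 0"
    using r'(3) by (simp add: R_def)
  have t3: "(\<lambda>n. cmod c * ell2_norm (\<lambda>j. mat_app a (\<xi> (R n)) j - \<eta> j) +
      ell2_norm (\<lambda>j. mat_app b (\<xi> (R n)) j - \<eta>' j)) \<longlonglongrightarrow> 0"
    using tendsto_add[OF tendsto_mult_left[OF t1, of "cmod c"] t2] by simp
  have "(\<lambda>n. ell2_norm (\<lambda>j. mat_app (\<lambda>j i. c * a j i + b j i) (\<xi> (R n)) j - \<theta> j)) \<longlonglongrightarrow> 0"
    by (rule tendsto_sandwich[OF _ _ tendsto_const t3]) (use le in auto)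
  then show "\<exists>r. \<exists>\<eta>\<in>ell2. strict_mono r \<and>
      (\<lambda>n. ell2_norm (\<lambda>j. mat_app (\<lambda>j i. c * a j i + b j i) (\<xi> (r n)) j - \<eta> j)) \<longlonglongrightarrow> 0"
    using R th by blast
qed

section \<open>Diagonal matrix units and the space of compact operators\<close>

definition diag_unit :: "nat \<Rightarrow> nat \<times> nat \<Rightarrow> complex" where
  "diag_unit c = (\<lambda>(i, j). if i = c \<and> j = c then 1 else 0)"

lemma mat_app_diag_unit: "mat_app (curry (diag_unit c)) \<xi> = (\<lambda>j. if j = c then \<xi> c else 0)"
proof
  fix j
  have "mat_app (curry (diag_unit c)) \<xi> j = (\<Sum>i\<in>{c}. curry (diag_unit c) j i * \<xi> i)"
    by (rule mat_app_finite) (auto simp: diag_unit_def)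
  then show "mat_app (curry (diag_unit c)) \<xi> j = (if j = c then \<xi> c else 0)"
    by (simp add: diag_unit_def)
qed

text \<open>The operator has rank one and sees only coordinate c, so compactness is
  Bolzano-Weierstrass for a bounded sequence of scalars.\<close>

lemma compact_diag_unit: "compact_mat (curry (diag_unit c))"
  unfolding compact_mat_def
proof (intro conjI allI impI)
  have fs: "(\<lambda>j. if j = c then z else 0) \<in> ell2" "ell2_norm (\<lambda>j. if j = c then z else 0) = cmod z"
    for z :: complex
    using ell2_finite_support[of "{c}" "\<lambda>j. if j = c then z else 0"] by (auto simp: L2_set_def)
  have le: "cmod (\<xi> c) \<le> ell2_norm \<xi>" if "\<xi> \<in> ell2" for \<xi> :: "nat \<Rightarrow> complex"
    using vnorm_le_ell2_norm[OF that, of "{c}"] by (simp add: L2_set_def)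
  have sm: "(\<lambda>i. curry (diag_unit c) j i * \<xi> i) summable_on UNIV" for j and \<xi> :: "nat \<Rightarrow> complex"
  proof -
    have "(\<lambda>i. curry (diag_unit c) j i * \<xi> i) summable_on {c}" by simp
    then show ?thesis
      by (rule summable_on_cong_neutral[THEN iffD1, rotated -1]) (auto simp: diag_unit_def)
  qed
  show "bounded_mat (curry (diag_unit c))"
    unfolding bounded_mat_def mat_app_diag_unit using sm fs le by (intro exI[of _ 1]) simp
  fix \<xi> :: "nat \<Rightarrow> nat \<Rightarrow> complex" assume xi: "\<forall>n. \<xi> n \<in> ell2 \<and> ell2_norm (\<xi> n) \<le> 1"
  have "cmod (\<xi> n c) \<le> 1" for n using le xi order_trans by blast
  then have "bounded (range (\<lambda>n. \<xi> n c))" by (auto intro!: boundedI)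
  then obtain z r where r: "strict_mono r" "((\<lambda>n. \<xi> n c) \<circ> r) \<longlonglongrightarrow> z"
    using bounded_imp_convergent_subsequence by blast
  have eq: "(\<lambda>j. (if j = c then \<xi> (r n) c else 0) - (if j = c then z else 0)) =
      (\<lambda>j. if j = c then \<xi> (r n) c - z else 0)" for n by auto
  have "(\<lambda>n. cmod (\<xi> (r n) c - z)) \<longlonglongrightarrow> 0"
    using r(2) by (simp add: o_def tendsto_norm_zero_iff LIM_zero_iff)
  then show "\<exists>r. \<exists>\<eta>\<in>ell2. strict_mono r \<and>
      (\<lambda>n. ell2_norm (\<lambda>j. mat_app (curry (diag_unit c)) (\<xi> (r n)) j - \<eta> j)) \<longlonglongrightarrow> 0"
    using r(1) fs(1)[of z] unfolding mat_app_diag_unit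
    by (intro exI[of _ r] bexI[of _ "\<lambda>j. if j = c then z else 0"]) (simp_all add: eq fs(2))
qed

abbreviation cpt :: "(nat \<times> nat \<Rightarrow> complex) set" where
  "cpt \<equiv> {a. compact_mat (curry a)}"

lemma csubspace_compacts: "csubspace cpt"
proof -
  have *: "(\<lambda>a. c * x a + y a) \<in> cpt" if "x \<in> cpt" "y \<in> cpt" for x y c
    using compact_mat_comb[of "curry x" "curry y" c] that by (simp add: curry_def)
  \<comment> \<open>The zero operator is obtained as a compact operator minus itself.\<close>
  have "diag_unit 0 \<in> cpt" using compact_diag_unit by simp
  then have "(\<lambda>_. 0) \<in> cpt" using *[of "diag_unit 0" "diag_unit 0" "-1"] by simp
  then show ?thesis unfolding csubspace_def using * by blast
qed

lemma diag_unit_in_cpt: "diag_unit c \<in> cpt"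
  using compact_diag_unit by simp

section \<open>Block matrices of bounded operators\<close>

lemma ell2_sum:
  assumes "finite A" "\<And>k. k \<in> A \<Longrightarrow> x k \<in> ell2 \<and> ell2_norm (x k) \<le> B k"
  shows "(\<lambda>i. \<Sum>k\<in>A. x k i) \<in> ell2 \<and> ell2_norm (\<lambda>i. \<Sum>k\<in>A. x k i) \<le> (\<Sum>k\<in>A. B k)"
  using assms
proof (induction rule: finite_induct)
  case (insert k A)
  then have *: "x k \<in> ell2" "ell2_norm (x k) \<le> B k" "(\<lambda>i. \<Sum>k\<in>A. x k i) \<in> ell2"
    "ell2_norm (\<lambda>i. \<Sum>k\<in>A. x k i) \<le> (\<Sum>k\<in>A. B k)" by auto
  show ?case using ell2_add[OF *(1,3)] *(2,4) insert.hyps by auto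
qed simp

lemma vnorm_reindex: "inj_on f F \<Longrightarrow> vnorm (f ` F) x = vnorm F (\<lambda>i. x (f i))"
  unfolding L2_set_def by (simp add: sum.reindex o_def)

lemma ell2_section:
  fixes \<xi> :: "'k \<times> 'i \<Rightarrow> complex"
  assumes "\<xi> \<in> ell2"
  shows "(\<lambda>i. \<xi> (l, i)) \<in> ell2" "ell2_norm (\<lambda>i. \<xi> (l, i)) \<le> ell2_norm \<xi>"
proof -
  have "vnorm H (\<lambda>i. \<xi> (l, i)) \<le> ell2_norm \<xi>" for H
    using vnorm_le_ell2_norm[OF assms, of "Pair l ` H"]
    by (simp add: vnorm_reindex inj_on_def)
  then show "(\<lambda>i. \<xi> (l, i)) \<in> ell2" "ell2_norm (\<lambda>i. \<xi> (l, i)) \<le> ell2_norm \<xi>"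
    by (auto intro: ell2_boundI)
qed

lemma ell2_embed:
  fixes \<eta> :: "'j \<Rightarrow> complex"
  assumes "\<eta> \<in> ell2"
  shows "(\<lambda>(k', j). if k' = k then \<eta> j else 0) \<in> ell2"
    "ell2_norm (\<lambda>(k', j). if k' = k then \<eta> j else 0) \<le> ell2_norm \<eta>"
proof -
  have "vnorm H (\<lambda>(k', j). if k' = k then \<eta> j else 0) \<le> ell2_norm \<eta>" if "finite H" for H
  proof -
    let ?x = "\<lambda>(k', j). if k' = k then \<eta> j else 0"
    have e: "H \<inter> {k} \<times> UNIV = Pair k ` {j. (k, j) \<in> H}" by auto
    have "(vnorm H ?x)\<^sup>2 = (\<Sum>q\<in>H \<inter> {k} \<times> UNIV. (cmod (?x q))\<^sup>2)"
      unfolding vnorm_square by (rule sum.mono_neutral_right) (use that in \<open>auto split: if_splits\<close>)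
    also have "\<dots> = (vnorm {j. (k, j) \<in> H} \<eta>)\<^sup>2"
      unfolding e vnorm_square[symmetric] by (simp add: vnorm_reindex inj_on_def)
    also have "\<dots> \<le> (ell2_norm \<eta>)\<^sup>2"
      by (intro power_mono vnorm_le_ell2_norm assms) simp
    finally show ?thesis by (rule power2_le_imp_le) simp
  qed
  then show "(\<lambda>(k', j). if k' = k then \<eta> j else 0) \<in> ell2"
    "ell2_norm (\<lambda>(k', j). if k' = k then \<eta> j else 0) \<le> ell2_norm \<eta>"
    by (auto intro: ell2_boundI)
qed

text \<open>The infinite sum over pairs splits into M sums because the blocks with l \<ge> M are
  zero. The splitting needs each of these sums to converge, which is the summability clause of
  \<open>bounded_mat\<close>.\<close>

lemma mat_app_block:
  fixes x :: "nat \<Rightarrow> nat \<Rightarrow> 'j \<Rightarrow> 'i \<Rightarrow> complex" and \<xi> :: "nat \<times> 'i \<Rightarrow> complex"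
  assumes "\<And>k l. k < M \<Longrightarrow> l < M \<Longrightarrow> bounded_mat (x k l)" "\<xi> \<in> ell2"
  shows "mat_app (\<lambda>(k, j) (l, i). if k < M \<and> l < M then x k l j i else 0) \<xi> (k, j)
    = (if k < M then \<Sum>l<M. mat_app (x k l) (\<lambda>i. \<xi> (l, i)) j else 0)"
proof (cases "k < M")
  case True
  let ?f = "\<lambda>(l, i). (if k < M \<and> l < M then x k l j i else 0) * \<xi> (l, i)"
  have s: "(\<lambda>i. x k l j i * \<xi> (l, i)) summable_on UNIV" if "l < M" for l
    by (rule bounded_matD(2)[OF assms(1)[OF True that] ell2_section(1)[OF assms(2)]])
  have inj: "inj (Pair l)" for l :: nat by (simp add: inj_on_def)
  have "mat_app (\<lambda>(k, j) (l, i). if k < M \<and> l < M then x k l j i else 0) \<xi> (k, j) = (\<Sum>\<^sub>\<infinity>q. ?f q)"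
    unfolding mat_app_def by (rule infsum_cong) auto
  also have "\<dots> = (\<Sum>\<^sub>\<infinity>q\<in>(\<Union>l\<in>{..<M}. range (Pair l)). ?f q)"
    by (rule infsum_cong_neutral) (auto simp: image_iff)
  also have "\<dots> = (\<Sum>l<M. \<Sum>\<^sub>\<infinity>q\<in>range (Pair l). ?f q)"
  proof (rule sum_infsum[symmetric])
    show "?f summable_on range (Pair l)" if "l \<in> {..<M}" for l
      using that True s[of l] by (subst summable_on_reindex[OF inj]) (simp add: o_def)
  qed auto
  also have "\<dots> = (\<Sum>l<M. mat_app (x k l) (\<lambda>i. \<xi> (l, i)) j)"
    unfolding mat_app_def
    by (rule sum.cong[OF refl], subst infsum_reindex[OF inj]) (use True in \<open>simp add: o_def\<close>)
  finally show ?thesis using True by simp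
next
  case False
  then show ?thesis by (simp add: mat_app_def split_beta)
qed

text \<open>The bound is the sum of the bounds of all blocks. Only its finiteness is used, to know
  that \<open>op_norm\<close> of an amplification is an actual operator bound.\<close>

lemma bd_by_block:
  fixes x :: "nat \<Rightarrow> nat \<Rightarrow> 'j \<Rightarrow> 'i \<Rightarrow> complex"
  assumes b: "\<And>k l. k < M \<Longrightarrow> l < M \<Longrightarrow> bounded_mat (x k l)"
  shows "\<exists>K. bd_by K (\<lambda>(k, j) (l, i). if k < M \<and> l < M then x k l j i else 0)"
proof -
  let ?X = "\<lambda>(k, j) (l, i). if k < M \<and> l < M then x k l j i else 0"
  have "\<exists>K. \<forall>k<M. \<forall>l<M. bd_by (K k l) (x k l)"
    using bounded_matD(1)[OF b] by (metis (mono_tags))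
  then obtain K where K: "\<And>k l. k < M \<Longrightarrow> l < M \<Longrightarrow> bd_by (K k l) (x k l)" by blast
  have "mat_app ?X \<xi> \<in> ell2 \<and>
      ell2_norm (mat_app ?X \<xi>) \<le> (\<Sum>(k, l)\<in>{..<M} \<times> {..<M}. \<bar>K k l\<bar>) * ell2_norm \<xi>"
    if xi: "\<xi> \<in> ell2" for \<xi>
  proof -
    let ?y = "\<lambda>(k, l) (k', j). if k' = k then mat_app (x k l) (\<lambda>i. \<xi> (l, i)) j else 0"
    have "(\<lambda>q. \<Sum>kl\<in>{..<M} \<times> {..<M}. ?y kl q) \<in> ell2 \<and>
        ell2_norm (\<lambda>q. \<Sum>kl\<in>{..<M} \<times> {..<M}. ?y kl q) \<le>
          (\<Sum>(k, l)\<in>{..<M} \<times> {..<M}. \<bar>K k l\<bar> * ell2_norm \<xi>)"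
    proof (rule ell2_sum)
      fix kl assume "kl \<in> {..<M} \<times> {..<M}"
      then obtain k l where kl: "kl = (k, l)" "k < M" "l < M" by auto
      have 1: "mat_app (x k l) (\<lambda>i. \<xi> (l, i)) \<in> ell2"
          "ell2_norm (mat_app (x k l) (\<lambda>i. \<xi> (l, i))) \<le> K k l * ell2_norm (\<lambda>i. \<xi> (l, i))"
        using K[OF kl(2,3)] ell2_section(1)[OF xi, of l] by (auto simp: bd_by_def)
      have "K k l * ell2_norm (\<lambda>i. \<xi> (l, i)) \<le> \<bar>K k l\<bar> * ell2_norm \<xi>"
        by (intro mult_mono ell2_section xi) auto
      then show "?y kl \<in> ell2 \<and> ell2_norm (?y kl) \<le> (case kl of (k, l) \<Rightarrow> \<bar>K k l\<bar> * ell2_norm \<xi>)"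
        using ell2_embed[OF 1(1), of k] 1(2) unfolding kl by simp
    qed simp
    moreover have "mat_app ?X \<xi> = (\<lambda>q. \<Sum>kl\<in>{..<M} \<times> {..<M}. ?y kl q)"
    proof
      fix q :: "nat \<times> 'j"
      obtain k j where q: "q = (k, j)" by (cases q)
      have "(\<Sum>kl\<in>{..<M} \<times> {..<M}. ?y kl q) =
          (\<Sum>k'<M. if k = k' then \<Sum>l<M. mat_app (x k' l) (\<lambda>i. \<xi> (l, i)) j else 0)"
        unfolding sum.cartesian_product' q by (intro sum.cong refl) auto
      moreover have "mat_app ?X \<xi> (k, j) =
          (if k < M then \<Sum>l<M. mat_app (x k l) (\<lambda>i. \<xi> (l, i)) j else 0)"
        by (rule mat_app_block) (use b xi in auto)
      ultimately show "mat_app ?X \<xi> q = (\<Sum>kl\<in>{..<M} \<times> {..<M}. ?y kl q)"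
        unfolding q by simp
    qed
    ultimately show ?thesis by (simp add: sum_distrib_right split_beta)
  qed
  then show ?thesis unfolding bd_by_def by blast
qed

lemma infsum_sum_swap:
  fixes f :: "'k \<Rightarrow> 'i \<Rightarrow> complex"
  assumes "finite A" "\<And>k. k \<in> A \<Longrightarrow> f k summable_on I"
  shows "(\<Sum>\<^sub>\<infinity>i\<in>I. \<Sum>k\<in>A. f k i) = (\<Sum>k\<in>A. \<Sum>\<^sub>\<infinity>i\<in>I. f k i)"
proof -
  have "(\<lambda>i. \<Sum>k\<in>A. f k i) summable_on I \<and> (\<Sum>\<^sub>\<infinity>i\<in>I. \<Sum>k\<in>A. f k i) = (\<Sum>k\<in>A. \<Sum>\<^sub>\<infinity>i\<in>I. f k i)"
    using assms by (induction rule: finite_induct) (auto simp: infsum_add intro: summable_on_add)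
  then show ?thesis by blast
qed

lemma opspace_compacts:
  "vecs (opspace_of compacts) = cpt"
  "mnorm (opspace_of compacts) m x = op_norm (amp m curry x)"
  by (simp_all add: opspace_of_def compacts_def)

lemma amp_curry:
  "amp M curry x = (\<lambda>(k, j) (l, i). if k < M \<and> l < M then curry (x k l) j i else 0)"
  by (simp add: amp_def)

lemma matsD: "x \<in> mats m n V \<Longrightarrow> k < m \<Longrightarrow> l < n \<Longrightarrow> x k l \<in> V"
  by (simp add: mats_def)

lemma bounded_of_mats_compacts:
  "x \<in> mats M M cpt \<Longrightarrow> k < M \<Longrightarrow> l < M \<Longrightarrow> bounded_mat (curry (x k l))"
  using matsD[of x M M cpt k l] by (simp add: compact_mat_def)

lemma bd_by_amp_compacts:
  assumes "x \<in> mats M M cpt"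
  shows "bd_by (op_norm (amp M curry x)) (amp M curry x)"
proof -
  have "\<exists>K. bd_by K (amp M curry x)"
    unfolding amp_curry by (rule bd_by_block) (use bounded_of_mats_compacts[OF assms] in blast)
  then show ?thesis using bd_by_op_norm by blast
qed

lemma op_norm_amp_nonneg: "x \<in> mats M M cpt \<Longrightarrow> 0 \<le> op_norm (amp M curry x)"
  using op_norm_nonneg bd_by_amp_compacts by blast

lemma op_norm_combination_le:
  assumes x: "x \<in> mats M M cpt"
  shows "op_norm (amp 1 curry (\<lambda>_ _ a. \<Sum>(k, l)\<in>{..<M} \<times> {..<M}. (cnj (\<eta> k) * \<xi> l) * x k l a))
    \<le> vnorm {..<M} \<eta> * vnorm {..<M} \<xi> * op_norm (amp M curry x)"
proof (rule op_norm_le)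
  let ?z = "\<lambda>a. \<Sum>(k, l)\<in>{..<M} \<times> {..<M}. (cnj (\<eta> k) * \<xi> l) * x k l a"
  let ?K = "op_norm (amp M curry x)"
  have K0: "0 \<le> ?K" by (rule op_norm_amp_nonneg[OF x])
  have bx: "bounded_mat (curry (x k l))" if "k < M" "l < M" for k l
    using bounded_of_mats_compacts[OF x that] .
  have z: "?z \<in> cpt"
    unfolding split_beta by (rule csubspace_sum[OF csubspace_compacts]) (use matsD[OF x] in auto)
  have bz: "bounded_mat (curry ?z)" using z unfolding mem_Collect_eq compact_mat_def by (rule conjunct1)
  show "0 \<le> vnorm {..<M} \<eta> * vnorm {..<M} \<xi> * ?K" using K0 by simp
  have "vnorm H (mat_app (amp 1 curry (\<lambda>_ _. ?z)) \<zeta>) \<le> (vnorm {..<M} \<eta> * vnorm {..<M} \<xi> * ?K) * ell2_norm \<zeta>"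
    if ze: "\<zeta> \<in> ell2" and H: "finite H" for \<zeta> :: "nat \<times> nat \<Rightarrow> complex" and H :: "(nat \<times> nat) set"
  proof -
    let ?sec = "\<lambda>i. \<zeta> (0, i)"
    \<comment> \<open>The column \<xi> tensored with block 0 of \<zeta>, the only block that
      \<open>amp 1\<close> reads.\<close>
    define \<Xi> where "\<Xi> = (\<lambda>(l, i). if l < M then \<xi> l * ?sec i else 0)"
    have z0: "?sec \<in> ell2" "ell2_norm ?sec \<le> ell2_norm \<zeta>" using ell2_section[OF ze] by auto
    have Xi: "\<Xi> \<in> ell2" "ell2_norm \<Xi> \<le> vnorm {..<M} \<xi> * ell2_norm \<zeta>"
    proof -
      have "vnorm G \<Xi> \<le> vnorm {..<M} \<xi> * ell2_norm \<zeta>" if G: "finite G" for G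
      proof -
        have "(vnorm G \<Xi>)\<^sup>2 = (\<Sum>q\<in>G \<inter> {..<M} \<times> snd ` G. (cmod (\<Xi> q))\<^sup>2)"
          unfolding vnorm_square
          by (rule sum.mono_neutral_right) (use G in \<open>force simp: \<Xi>_def split: if_splits\<close>)+
        also have "\<dots> \<le> (\<Sum>q\<in>{..<M} \<times> snd ` G. (cmod (\<Xi> q))\<^sup>2)"
          by (rule sum_mono2) (use G in auto)
        also have "\<dots> = (vnorm {..<M} \<xi>)\<^sup>2 * (vnorm (snd ` G) ?sec)\<^sup>2"
          unfolding vnorm_square sum.cartesian_product' \<Xi>_def
          by (simp add: norm_mult power_mult_distrib sum_product)
        also have "\<dots> \<le> (vnorm {..<M} \<xi>)\<^sup>2 * (ell2_norm \<zeta>)\<^sup>2"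
          by (intro mult_left_mono power_mono order_trans[OF vnorm_le_ell2_norm[OF z0(1)] z0(2)]) auto
        finally have "(vnorm G \<Xi>)\<^sup>2 \<le> (vnorm {..<M} \<xi> * ell2_norm \<zeta>)\<^sup>2"
          by (simp add: power_mult_distrib)
        then show ?thesis by (rule power2_le_imp_le) simp
      qed
      then show "\<Xi> \<in> ell2" "ell2_norm \<Xi> \<le> vnorm {..<M} \<xi> * ell2_norm \<zeta>" by (auto intro: ell2_boundI)
    qed
    define V where "V = mat_app (amp M curry x) \<Xi>"
    have V: "V \<in> ell2" "ell2_norm V \<le> ?K * ell2_norm \<Xi>"
      using bd_by_amp_compacts[OF x] Xi(1) by (auto simp: V_def bd_by_def)
    have Vk: "V (k, j) = (\<Sum>l<M. \<xi> l * mat_app (curry (x k l)) ?sec j)" if "k < M" for k j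
    proof -
      have "V (k, j) = (\<Sum>l<M. mat_app (curry (x k l)) (\<lambda>i. \<Xi> (l, i)) j)"
        unfolding V_def amp_curry using that Xi(1) bx by (subst mat_app_block) auto
      also have "\<dots> = (\<Sum>l<M. \<xi> l * mat_app (curry (x k l)) ?sec j)"
        by (rule sum.cong[OF refl]) (simp add: \<Xi>_def mat_app_scale)
      finally show ?thesis .
    qed
    \<comment> \<open>Applying the combination to that block amounts to pairing the blocks of
      \<open>V\<close> with \<eta>.\<close>
    have mz: "mat_app (curry ?z) ?sec j = (\<Sum>k<M. V (k, j) * cnj (\<eta> k))" for j
    proof -
      have s: "(\<lambda>i. curry (x k l) j i * ?sec i) summable_on UNIV" if "k < M" "l < M" for k l
        by (rule bounded_matD(2)[OF bx[OF that] z0(1)])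
      have "mat_app (curry ?z) ?sec j = (\<Sum>\<^sub>\<infinity>i. \<Sum>kl\<in>{..<M} \<times> {..<M}.
          (cnj (\<eta> (fst kl)) * \<xi> (snd kl)) * (curry (x (fst kl) (snd kl)) j i * ?sec i))"
        unfolding mat_app_def by (simp add: split_beta sum_distrib_right mult.assoc)
      also have "\<dots> = (\<Sum>kl\<in>{..<M} \<times> {..<M}. \<Sum>\<^sub>\<infinity>i.
          (cnj (\<eta> (fst kl)) * \<xi> (snd kl)) * (curry (x (fst kl) (snd kl)) j i * ?sec i))"
        by (rule infsum_sum_swap) (use s in \<open>auto intro!: summable_on_cmult_right\<close>)
      also have "\<dots> = (\<Sum>kl\<in>{..<M} \<times> {..<M}.
          (cnj (\<eta> (fst kl)) * \<xi> (snd kl)) * mat_app (curry (x (fst kl) (snd kl))) ?sec j)"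
        unfolding mat_app_def by (simp only: infsum_cmult_right')
      also have "\<dots> = (\<Sum>k<M. V (k, j) * cnj (\<eta> k))"
        unfolding sum.cartesian_product'
        by (rule sum.cong[OF refl]) (simp add: Vk sum_distrib_left sum_distrib_right mult_ac)
      finally show ?thesis .
    qed
    define W where "W = mat_app (amp 1 curry (\<lambda>_ _. ?z)) \<zeta>"
    have out: "W (k, j) =
        (if k = 0 then (\<Sum>k<M. V (k, j) * cnj (\<eta> k)) else 0)" for k j
    proof -
      have "W (k, j) =
          (if k < 1 then \<Sum>l<(1::nat). mat_app (curry ?z) (\<lambda>i. \<zeta> (l, i)) j else 0)"
        unfolding W_def amp_curry by (rule mat_app_block[OF bz ze])
      then show ?thesis by (simp add: mz)
    qed
    let ?J = "snd ` H"
    have "(vnorm H (W))\<^sup>2 =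
        (\<Sum>q\<in>H \<inter> {0} \<times> ?J. (cmod (W q))\<^sup>2)"
      unfolding vnorm_square
    proof (rule sum.mono_neutral_right)
      show "\<forall>q\<in>H - H \<inter> {0} \<times> ?J. (cmod (W q))\<^sup>2 = 0"
      proof
        fix q assume q: "q \<in> H - H \<inter> {0} \<times> ?J"
        obtain k j where kj: "q = (k, j)" by (cases q)
        have "j \<in> ?J" using q unfolding kj by force
        then have "k \<noteq> 0" using q unfolding kj by auto
        then show "(cmod (W q))\<^sup>2 = 0" unfolding kj out by simp
      qed
    qed (use H in auto)
    also have "\<dots> \<le> (\<Sum>q\<in>{0} \<times> ?J. (cmod (W q))\<^sup>2)"
      by (rule sum_mono2) (use H in auto)
    also have "\<dots> = (\<Sum>j\<in>?J. (cmod (\<Sum>k<M. V (k, j) * cnj (\<eta> k)))\<^sup>2)"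
      by (rule sum.reindex_bij_witness[where i="Pair 0" and j=snd]) (force simp: out)+
    also have "\<dots> \<le> (\<Sum>j\<in>?J. (vnorm {..<M} (\<lambda>k. V (k, j)) * vnorm {..<M} \<eta>)\<^sup>2)"
      by (intro sum_mono power_mono cmod_inner_le) auto
    also have "\<dots> = (vnorm {..<M} \<eta>)\<^sup>2 * (vnorm ({..<M} \<times> ?J) V)\<^sup>2"
      unfolding power_mult_distrib sum_distrib_right[symmetric] vnorm_square sum.cartesian_product'
      by (subst sum.swap) simp
    also have "\<dots> \<le> (vnorm {..<M} \<eta>)\<^sup>2 * (?K * (vnorm {..<M} \<xi> * ell2_norm \<zeta>))\<^sup>2"
    proof (intro mult_left_mono power_mono)
      have "vnorm ({..<M} \<times> ?J) V \<le> ell2_norm V" by (rule vnorm_le_ell2_norm[OF V(1)])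
      also have "\<dots> \<le> ?K * ell2_norm \<Xi>" by (rule V(2))
      also have "\<dots> \<le> ?K * (vnorm {..<M} \<xi> * ell2_norm \<zeta>)" by (rule mult_left_mono[OF Xi(2) K0])
      finally show "vnorm ({..<M} \<times> ?J) V \<le> ?K * (vnorm {..<M} \<xi> * ell2_norm \<zeta>)" .
    qed auto
    finally have "(vnorm H (W))\<^sup>2
        \<le> ((vnorm {..<M} \<eta> * vnorm {..<M} \<xi> * ?K) * ell2_norm \<zeta>)\<^sup>2"
      by (simp add: power_mult_distrib mult_ac)
    then show ?thesis unfolding W_def by (rule power2_le_imp_le) (simp add: K0)
  qed
  then show "bd_by (vnorm {..<M} \<eta> * vnorm {..<M} \<xi> * ?K) (amp 1 curry (\<lambda>_ _. ?z))"
    unfolding bd_by_def by (auto intro: ell2_boundI)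
qed

text \<open>A bounded functional is completely bounded with the same constant: the form of the
  scalar matrix at \<eta> and \<xi> is \<phi> evaluated at the combination of
  \<open>op_norm_combination_le\<close>. Membership in \<open>os_dual\<close> grants only
  boundedness, whereas its norm is a \<open>Sup\<close> over all matrix sizes.\<close>

lemma functional_completely_bounded:
  assumes phi: "clinear_on cpt \<phi>" "\<And>x. x \<in> cpt \<Longrightarrow> cmod (\<phi> x) \<le> B * op_norm (amp 1 curry (\<lambda>_ _. x))"
    and B: "0 \<le> B" and x: "x \<in> mats M M cpt" and n: "op_norm (amp M curry x) \<le> 1"
  shows "fin_bd {..<M} {..<M} B (\<lambda>k l. \<phi> (x k l))"
proof (rule fin_bd_formI[OF _ B])
  fix \<eta> \<xi> :: "nat \<Rightarrow> complex"
  let ?z = "\<lambda>a. \<Sum>(k, l)\<in>{..<M} \<times> {..<M}. (cnj (\<eta> k) * \<xi> l) * x k l a"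
  have z: "?z \<in> cpt"
    unfolding split_beta by (rule csubspace_sum[OF csubspace_compacts]) (use matsD[OF x] in auto)
  have "(\<Sum>k<M. \<Sum>l<M. cnj (\<eta> k) * \<xi> l * \<phi> (x k l)) =
      (\<Sum>kl\<in>{..<M} \<times> {..<M}. (cnj (\<eta> (fst kl)) * \<xi> (snd kl)) * \<phi> (x (fst kl) (snd kl)))"
    unfolding sum.cartesian_product' by simp
  also have "\<dots> = \<phi> ?z"
    unfolding split_beta by (rule clinear_on_sum[OF csubspace_compacts phi(1), symmetric]) (use matsD[OF x] in auto)
  finally have "cmod (\<Sum>k<M. \<Sum>l<M. cnj (\<eta> k) * \<xi> l * \<phi> (x k l)) = cmod (\<phi> ?z)" by simp
  also have "\<dots> \<le> B * op_norm (amp 1 curry (\<lambda>_ _. ?z))" by (rule phi(2)[OF z])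
  also have "\<dots> \<le> B * (vnorm {..<M} \<eta> * vnorm {..<M} \<xi> * op_norm (amp M curry x))"
    by (rule mult_left_mono[OF op_norm_combination_le[OF x] B])
  also have "\<dots> \<le> B * (vnorm {..<M} \<eta> * vnorm {..<M} \<xi> * 1)"
    by (intro mult_left_mono n B) auto
  finally show "cmod (\<Sum>k<M. \<Sum>l<M. cnj (\<eta> k) * \<xi> l * \<phi> (x k l)) \<le> B * vnorm {..<M} \<eta> * vnorm {..<M} \<xi>"
    by (simp add: mult.assoc)
qed

section \<open>The dual of the compact operators\<close>

lemma compacts_dual_simps:
  "vecs compacts_dual = {\<phi>. clinear_on cpt \<phi> \<and> (\<forall>x. x \<notin> cpt \<longrightarrow> \<phi> x = 0) \<and>
      (\<exists>B. \<forall>x\<in>cpt. cmod (\<phi> x) \<le> B * op_norm (amp 1 curry (\<lambda>_ _. x)))}"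
  "mnorm compacts_dual n \<Phi> = cb_norm (opspace_of compacts) n (\<lambda>x i j. \<Phi> i j x)"
  by (simp_all add: compacts_dual_def os_dual_def opspace_compacts)

lemma csubspace_compacts_dual: "csubspace (vecs compacts_dual)"
  unfolding csubspace_def
proof (intro conjI ballI allI)
  show "(\<lambda>_. 0) \<in> vecs compacts_dual"
    unfolding compacts_dual_simps by (auto simp: clinear_on_def intro!: exI[of _ 0])
next
  fix \<phi> \<psi> c assume f: "\<phi> \<in> vecs compacts_dual" and g: "\<psi> \<in> vecs compacts_dual"
  let ?n = "\<lambda>x. op_norm (amp 1 curry (\<lambda>_ _. x))"
  obtain B B' where B: "\<And>x. x \<in> cpt \<Longrightarrow> cmod (\<phi> x) \<le> B * ?n x" "\<And>x. x \<in> cpt \<Longrightarrow> cmod (\<psi> x) \<le> B' * ?n x"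
    using f g unfolding compacts_dual_simps by blast
  have "cmod (c * \<phi> x + \<psi> x) \<le> (cmod c * B + B') * ?n x" if x: "x \<in> cpt" for x
  proof -
    have "cmod (c * \<phi> x + \<psi> x) \<le> cmod c * cmod (\<phi> x) + cmod (\<psi> x)"
      by (rule order_trans[OF norm_triangle_ineq]) (simp add: norm_mult)
    also have "\<dots> \<le> cmod c * (B * ?n x) + B' * ?n x"
      by (intro add_mono mult_left_mono B x) simp
    finally show ?thesis by (simp add: algebra_simps)
  qed
  moreover have "clinear_on cpt (\<lambda>x. c * \<phi> x + \<psi> x)"
    using f g unfolding compacts_dual_simps clinear_on_def by (simp add: algebra_simps)
  ultimately show "(\<lambda>x. c * \<phi> x + \<psi> x) \<in> vecs compacts_dual"
    using f g unfolding compacts_dual_simps by (intro CollectI conjI) auto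
qed

lemma amp_corner:
  "amp m (corner N u) x (k, i) (l, j) = (if k < m \<and> l < m \<and> i < N \<and> j < N then u (x k l) i j else 0)"
  by (simp add: amp_def corner_def)

lemma amp_corner_support:
  "amp m (corner N u) x q r \<noteq> 0 \<Longrightarrow> q \<in> {..<m} \<times> {..<N} \<and> r \<in> {..<m} \<times> {..<N}"
  by (cases q, cases r) (auto simp: amp_corner split: if_splits)

lemma bd_by_amp_corner: "bd_by (op_norm (amp m (corner N u) x)) (amp m (corner N u) x)"
  by (rule bd_by_finite_exists[where F="{..<m} \<times> {..<N}" and G="{..<m} \<times> {..<N}"])
     (use amp_corner_support in \<open>auto dest: amp_corner_support\<close>)

lemma fin_bd_amp_corner:
  "fin_bd ({..<m} \<times> {..<N}) ({..<m} \<times> {..<N}) (op_norm (amp m (corner N u) x)) (amp m (corner N u) x)"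
  by (rule fin_bd_of_bd_by[OF _ bd_by_amp_corner]) simp

lemma op_norm_amp_corner_le:
  assumes "fin_bd ({..<m} \<times> {..<N}) ({..<m} \<times> {..<N}) K (amp m (corner N u) x)" "0 \<le> K"
  shows "op_norm (amp m (corner N u) x) \<le> K"
  by (rule op_norm_finite_le[OF _ _ amp_corner_support assms]) auto

text \<open>The matrix is c tensored with the matrix unit at (i, j): it reads slice j, applies c and
  writes to slice i.\<close>

lemma fin_bd_entry:
  fixes c :: "'k \<Rightarrow> 'l \<Rightarrow> complex" and i :: 'i and j :: 'j
  assumes "fin_bd P Q K c" "0 \<le> K" "finite P" "finite Q" "finite I" "finite J" "i \<in> I" "j \<in> J"
  shows "fin_bd (P \<times> I) (Q \<times> J) K (\<lambda>(k, i') (l, j'). if i' = i \<and> j' = j then c k l else 0)"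
proof (rule fin_bdI)
  fix \<xi> :: "'l \<times> 'j \<Rightarrow> complex"
  have e: "(\<Sum>q\<in>Q \<times> J. (case (k, i') of (k, i') \<Rightarrow> \<lambda>(l, j'). if i' = i \<and> j' = j then c k l else 0) q * \<xi> q)
      = (if i' = i then \<Sum>l\<in>Q. c k l * \<xi> (l, j) else 0)" for k i'
  proof -
    have "(\<Sum>q\<in>Q \<times> J. (case (k, i') of (k, i') \<Rightarrow> \<lambda>(l, j'). if i' = i \<and> j' = j then c k l else 0) q * \<xi> q)
      = (\<Sum>l\<in>Q. \<Sum>j'\<in>J. if j' = j then (if i' = i then c k l * \<xi> (l, j) else 0) else 0)"
      unfolding sum.cartesian_product' by (intro sum.cong refl) auto
    also have "\<dots> = (\<Sum>l\<in>Q. if i' = i then c k l * \<xi> (l, j) else 0)"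
      using assms by (simp add: sum.delta)
    finally show ?thesis by simp
  qed
  let ?w = "\<lambda>(k, i'). if i' = i then \<Sum>l\<in>Q. c k l * \<xi> (l, j) else 0"
  have eq: "(\<lambda>r. \<Sum>q\<in>Q \<times> J. (case r of (k, i') \<Rightarrow> \<lambda>(l, j'). if i' = i \<and> j' = j then c k l else 0) q * \<xi> q) = ?w"
    using e by (auto simp: fun_eq_iff)
  have "(vnorm (P \<times> I) ?w)\<^sup>2 = (\<Sum>k\<in>P. \<Sum>i'\<in>I. if i' = i then (cmod (\<Sum>l\<in>Q. c k l * \<xi> (l, j)))\<^sup>2 else 0)"
    unfolding vnorm_square sum.cartesian_product' by (intro sum.cong refl) auto
  also have "\<dots> = (vnorm P (\<lambda>k. \<Sum>l\<in>Q. c k l * \<xi> (l, j)))\<^sup>2"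
    using assms by (simp add: sum.delta vnorm_square)
  finally have "vnorm (P \<times> I) ?w = vnorm P (\<lambda>k. \<Sum>l\<in>Q. c k l * \<xi> (l, j))"
    by (simp add: power2_eq_iff_nonneg)
  also have "\<dots> \<le> K * vnorm Q (\<lambda>l. \<xi> (l, j))" by (rule fin_bdD[OF assms(1)])
  also have "\<dots> \<le> K * vnorm (Q \<times> J) \<xi>"
  proof (rule mult_left_mono[OF _ assms(2)])
    have "(vnorm Q (\<lambda>l. \<xi> (l, j)))\<^sup>2 \<le> (vnorm (Q \<times> J) \<xi>)\<^sup>2"
      unfolding vnorm_square sum.cartesian_product'
      by (rule sum_mono) (use assms in \<open>auto intro: member_le_sum\<close>)
    then show "vnorm Q (\<lambda>l. \<xi> (l, j)) \<le> vnorm (Q \<times> J) \<xi>" by (rule power2_le_imp_le) simp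
  qed
  finally have "vnorm (P \<times> I) ?w \<le> K * vnorm (Q \<times> J) \<xi>" .
  then show "vnorm (P \<times> I) (\<lambda>r. \<Sum>q\<in>Q \<times> J.
      (case r of (k, i') \<Rightarrow> \<lambda>(l, j'). if i' = i \<and> j' = j then c k l else 0) q * \<xi> q) \<le> K * vnorm (Q \<times> J) \<xi>"
    by (rule ord_eq_le_trans[OF arg_cong[OF eq, where f="\<lambda>x. vnorm (P \<times> I) x"]])
qed

text \<open>The content is that the \<open>Sup\<close> is over a bounded set. The amplified map is
  the sum over (i, j) of its entries placed at position (i, j), and each entry is a completely
  bounded functional.\<close>

lemma cb_norm_compacts_upper:
  assumes Phi: "\<And>i j. i < N \<Longrightarrow> j < N \<Longrightarrow> \<Phi> i j \<in> vecs compacts_dual"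
    and x: "x \<in> mats m m cpt" "op_norm (amp m curry x) \<le> 1"
  shows "op_norm (amp m (corner N (\<lambda>x i j. \<Phi> i j x)) x) \<le> cb_norm (opspace_of compacts) N (\<lambda>x i j. \<Phi> i j x)"
  unfolding cb_norm_def opspace_compacts
proof (rule cSup_upper)
  let ?u = "\<lambda>x i j. \<Phi> i j x"
  show "op_norm (amp m (corner N ?u) x) \<in>
      {op_norm (amp m (corner N ?u) x) |m x. x \<in> mats m m cpt \<and> op_norm (amp m curry x) \<le> 1}"
    using x by blast
  let ?n = "\<lambda>x. op_norm (amp 1 curry (\<lambda>_ _. x))"
  have "\<exists>B\<ge>0. \<forall>x\<in>cpt. cmod (\<Phi> i j x) \<le> B * ?n x" if ij: "i < N" "j < N" for i j
  proof -
    obtain B where B: "\<forall>x\<in>cpt. cmod (\<Phi> i j x) \<le> B * ?n x"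
      using Phi[OF ij] unfolding compacts_dual_simps by blast
    have "cmod (\<Phi> i j x) \<le> \<bar>B\<bar> * ?n x" if "x \<in> cpt" for x
    proof -
      have "(\<lambda>_ _. x) \<in> mats 1 1 cpt" using that by (simp add: mats_def)
      then have "B * ?n x \<le> \<bar>B\<bar> * ?n x" by (intro mult_right_mono op_norm_amp_nonneg) auto
      then show ?thesis using B that by fastforce
    qed
    then show ?thesis by (intro exI[of _ "\<bar>B\<bar>"]) auto
  qed
  then obtain B where B: "\<And>i j. i < N \<Longrightarrow> j < N \<Longrightarrow> 0 \<le> B i j"
    "\<And>i j x. i < N \<Longrightarrow> j < N \<Longrightarrow> x \<in> cpt \<Longrightarrow> cmod (\<Phi> i j x) \<le> B i j * ?n x"
    by metis
  let ?K = "\<Sum>ij\<in>{..<N} \<times> {..<N}. B (fst ij) (snd ij)"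
  show "bdd_above {op_norm (amp m (corner N ?u) x) |m x. x \<in> mats m m cpt \<and> op_norm (amp m curry x) \<le> 1}"
  proof (rule bdd_aboveI)
    fix t assume "t \<in> {op_norm (amp m (corner N ?u) x) |m x. x \<in> mats m m cpt \<and> op_norm (amp m curry x) \<le> 1}"
    then obtain m x where t: "t = op_norm (amp m (corner N ?u) x)"
      and y: "x \<in> mats m m cpt" "op_norm (amp m curry x) \<le> 1" by blast
    let ?e = "\<lambda>ij (k, i') (l, j'). if i' = fst ij \<and> j' = snd ij then \<Phi> (fst ij) (snd ij) (x k l) else 0"
    let ?Q = "{..<m} \<times> {..<N}"
    have "fin_bd ?Q ?Q ?K (\<lambda>q r. \<Sum>ij\<in>{..<N} \<times> {..<N}. ?e ij q r)"
    proof (rule fin_bd_sum)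
      fix ij assume ij: "ij \<in> {..<N} \<times> {..<N}"
      then have "fin_bd {..<m} {..<m} (B (fst ij) (snd ij)) (\<lambda>k l. \<Phi> (fst ij) (snd ij) (x k l))"
        using Phi[of "fst ij" "snd ij"] B y unfolding compacts_dual_simps
        by (intro functional_completely_bounded) auto
      then show "fin_bd ?Q ?Q (B (fst ij) (snd ij)) (?e ij)"
        by (rule fin_bd_entry) (use ij B in auto)
    qed simp
    moreover have "(\<Sum>ij\<in>{..<N} \<times> {..<N}. ?e ij q r) = amp m (corner N ?u) x q r" if "q \<in> ?Q" "r \<in> ?Q" for q r
    proof -
      obtain k i where q: "q = (k, i)" by (cases q)
      obtain l j where r: "r = (l, j)" by (cases r)
      have "(\<Sum>ij\<in>{..<N} \<times> {..<N}. ?e ij q r) = (\<Sum>ij\<in>{..<N} \<times> {..<N}. if ij = (i, j) then \<Phi> i j (x k l) else 0)"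
        unfolding q r by (intro sum.cong refl) auto
      also have "\<dots> = amp m (corner N ?u) x q r"
        using that unfolding q r amp_corner by (simp add: sum.delta)
      finally show ?thesis .
    qed
    ultimately have "fin_bd ?Q ?Q ?K (amp m (corner N ?u) x)"
      by (subst (asm) fin_bd_cong) auto
    then show "t \<le> ?K" unfolding t
      by (rule op_norm_amp_corner_le) (use B(1) in \<open>auto intro!: sum_nonneg\<close>)
  qed
qed

text \<open>Set to 0 off the compact operators because \<open>os_dual\<close> represents functionals
  in that way.\<close>

definition diag_functional :: "nat \<Rightarrow> (nat \<times> nat \<Rightarrow> complex) \<Rightarrow> complex" where
  "diag_functional c x = (if x \<in> cpt then x (c, c) else 0)"

lemma diag_functional_diag_unit: "diag_functional c (diag_unit d) = (if c = d then 1 else 0)"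
  using diag_unit_in_cpt[of d] by (simp add: diag_functional_def) (simp add: diag_unit_def)

text \<open>The scalar matrix is the compression of the block matrix to the coordinates (k, c), so
  the functional is completely contractive.\<close>

lemma diag_functional_amp_bound:
  assumes "x \<in> mats m m cpt"
  shows "fin_bd {..<m} {..<m} (op_norm (amp m curry x)) (\<lambda>k l. diag_functional c (x k l))"
proof -
  let ?f = "\<lambda>k::nat. (k, c)"
  have "fin_bd (?f ` {..<m}) (?f ` {..<m}) (op_norm (amp m curry x)) (amp m curry x)"
    by (rule fin_bd_of_bd_by[OF _ bd_by_amp_compacts[OF assms]]) simp
  then have "fin_bd {..<m} {..<m} (op_norm (amp m curry x)) (\<lambda>k l. amp m curry x (k, c) (l, c))"
    by (subst (asm) fin_bd_reindex) (auto simp: inj_on_def)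
  then show ?thesis
    by (subst (asm) fin_bd_cong[where b="\<lambda>k l. diag_functional c (x k l)"])
       (use matsD[OF assms] in \<open>auto simp: amp_curry diag_functional_def\<close>)
qed

lemma diag_functional_in_dual: "diag_functional c \<in> vecs compacts_dual"
  unfolding compacts_dual_simps
proof (intro CollectI conjI)
  show "clinear_on cpt (diag_functional c)"
    unfolding clinear_on_def
  proof (intro ballI allI)
    fix x y :: "nat \<times> nat \<Rightarrow> complex" and d assume xy: "x \<in> cpt" "y \<in> cpt"
    have "(\<lambda>a. d * x a + y a) \<in> cpt" by (rule csubspace_comb[OF csubspace_compacts xy])
    then show "diag_functional c (\<lambda>a. d * x a + y a) = d * diag_functional c x + diag_functional c y"
      using xy unfolding diag_functional_def by (simp only: if_True)
  qed
  show "\<forall>x. x \<notin> cpt \<longrightarrow> diag_functional c x = 0" unfolding diag_functional_def by (intro allI impI) (rule if_not_P)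
  have "cmod (diag_functional c x) \<le> 1 * op_norm (amp 1 curry (\<lambda>_ _. x))" if "x \<in> cpt" for x
  proof -
    have "(\<lambda>_ _. x) \<in> mats 1 1 cpt" using that by (simp add: mats_def)
    from diag_functional_amp_bound[OF this, of c]
    have "fin_bd {..<1::nat} {..<1::nat} (op_norm (amp 1 curry (\<lambda>_ _. x))) (\<lambda>_ _. diag_functional c x)" .
    from fin_bdD[OF this, of "\<lambda>_. 1"] show ?thesis by (simp add: L2_set_def)
  qed
  then show "\<exists>B. \<forall>x\<in>cpt. cmod (diag_functional c x) \<le> B * op_norm (amp 1 curry (\<lambda>_ _. x))" by blast
qed

lemma mnorm_diag_functional: "mnorm compacts_dual 1 (\<lambda>_ _. diag_functional c) \<le> 1"
  unfolding compacts_dual_simps cb_norm_def opspace_compacts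
proof (rule cSup_least)
  let ?u = "\<lambda>x i j. diag_functional c x"
  \<comment> \<open>The empty matrix, m = 0, shows that the set in the \<open>Sup\<close> is
    nonempty.\<close>
  have "op_norm (amp 0 curry (\<lambda>_ _. diag_unit 0)) \<le> 1"
    by (rule op_norm_finite_le[of "{}" "{}"]) (auto simp: amp_curry fin_bd_def)
  then show "{op_norm (amp m (corner 1 ?u) x) |m x. x \<in> mats m m cpt \<and> op_norm (amp m curry x) \<le> 1} \<noteq> {}"
    by (auto simp: mats_def intro!: exI[of _ 0])
  fix t assume "t \<in> {op_norm (amp m (corner 1 ?u) x) |m x. x \<in> mats m m cpt \<and> op_norm (amp m curry x) \<le> 1}"
  then obtain m x where t: "t = op_norm (amp m (corner 1 ?u) x)"
    and x: "x \<in> mats m m cpt" "op_norm (amp m curry x) \<le> 1" by blast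
  let ?f = "\<lambda>k::nat. (k, 0::nat)"
  have e: "{..<m} \<times> {..<1} = ?f ` {..<m}" by auto
  have "fin_bd ({..<m} \<times> {..<1}) ({..<m} \<times> {..<1}) 1 (amp m (corner 1 ?u) x)"
    unfolding e
    by (subst fin_bd_reindex, simp add: inj_on_def, simp add: inj_on_def,
        subst fin_bd_cong[where b="\<lambda>k l. diag_functional c (x k l)"], simp add: amp_corner,
        rule fin_bd_mono[OF diag_functional_amp_bound[OF x(1)] x(2)])
  then show "t \<le> 1" unfolding t by (rule op_norm_amp_corner_le) simp
qed

section \<open>Haagerup norms\<close>

lemma diag_family_compact: "(\<lambda>y. \<Sum>c<p. z c * diag_unit c y) \<in> cpt"
  by (rule csubspace_sum[OF csubspace_compacts]) (auto simp: compact_diag_unit)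

text \<open>The element is the sum of the a c tensored with E_cc. Reordered by the coordinate of the
  underlying Hilbert space, it is block diagonal with the contractions a c as its blocks.\<close>

lemma op_norm_diag_family:
  fixes a :: "nat \<Rightarrow> nat \<Rightarrow> nat \<Rightarrow> complex"
  assumes "\<And>c. c < p \<Longrightarrow> fin_bd {..<q} {..<q} 1 (a c)"
  shows "op_norm (amp q curry (\<lambda>s t y. \<Sum>c<p. a c s t * diag_unit c y)) \<le> 1"
proof (rule op_norm_le)
  let ?A = "amp q curry (\<lambda>s t y. \<Sum>c<p. a c s t * diag_unit c y)"
  have A: "?A (s, i) (t, j) = (if s < q \<and> t < q \<and> i = j \<and> i < p then a i s t else 0)" for s t i j
  proof -
    have "(\<Sum>c<p. a c s t * diag_unit c (i, j)) = (\<Sum>c<p. if c = i then (if i = j then a i s t else 0) else 0)"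
      by (intro sum.cong refl) (auto simp: diag_unit_def)
    also have "\<dots> = (if i < p then if i = j then a i s t else 0 else 0)" by (simp add: sum.delta)
    finally have "(\<Sum>c<p. a c s t * diag_unit c (i, j)) = (if i < p then if i = j then a i s t else 0 else 0)" .
    moreover have "?A (s, i) (t, j) = (if s < q \<and> t < q then \<Sum>c<p. a c s t * diag_unit c (i, j) else 0)"
      by (simp add: amp_curry)
    ultimately show ?thesis by (simp only: if_cancel split: if_split) blast
  qed
  let ?f = "\<lambda>b s. (s, b)"
  show "bd_by 1 ?A"
  \<comment> \<open>The block label is the second component of an index; the blocks with label at
    least p are zero.\<close>
  proof (rule bd_by_blocks[where F="\<lambda>b. ?f b ` {..<q}" and G="\<lambda>b. ?f b ` {..<q}" and f=snd and g=snd])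
    fix b :: nat
    have "fin_bd {..<q} {..<q} 1 (\<lambda>s t. ?A (s, b) (t, b))"
    proof (cases "b < p")
      case True
      show ?thesis
        by (subst fin_bd_cong[where b="a b"]) (use True assms in \<open>auto simp: A\<close>)
    next
      case False
      show ?thesis
        by (subst fin_bd_cong[where b="\<lambda>_ _. 0"])
           (use False in \<open>auto simp: A intro!: fin_bd_mono[OF fin_bd_zero]\<close>)
    qed
    then show "fin_bd (?f b ` {..<q}) (?f b ` {..<q}) 1 ?A"
      by (subst fin_bd_reindex) (auto simp: inj_on_def)
  next
    fix q' r assume "?A q' r \<noteq> 0"
    then show "\<exists>b. q' \<in> ?f b ` {..<q} \<and> r \<in> ?f b ` {..<q}"
      by (cases q', cases r) (auto simp: A split: if_splits)
  qed auto
qed simp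

text \<open>The completely bounded norm of \<open>U\<close> is tested on the contraction of
  \<open>op_norm_diag_family\<close>; the resulting matrix is the one in the statement. This is how
  elements of the dual are bounded from below by contractions on a finite dimensional space.\<close>

lemma rect_norm_compacts_dual_bound:
  fixes a :: "nat \<Rightarrow> nat \<Rightarrow> nat \<Rightarrow> complex"
  assumes U: "U \<in> mats m r (vecs compacts_dual)"
    and a: "\<And>c. c < p \<Longrightarrow> fin_bd {..<q} {..<q} 1 (a c)"
  shows "fin_bd ({..<m} \<times> {..<q}) ({..<r} \<times> {..<q}) (rect_norm compacts_dual m r U)
      (\<lambda>(i, s) (k, t). \<Sum>c<p. a c s t * U i k (diag_unit c))"
    and "0 \<le> rect_norm compacts_dual m r U"
proof -
  let ?N = "max m r"
  let ?\<Phi> = "\<lambda>k l. if k < m \<and> l < r then U k l else (\<lambda>_. 0)"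
  let ?x = "\<lambda>s t y. \<Sum>c<p. a c s t * diag_unit c y"
  let ?u = "\<lambda>x i j. ?\<Phi> i j x"
  let ?B = "amp q (corner ?N ?u) ?x"
  have mem: "?\<Phi> i j \<in> vecs compacts_dual" for i j
    using matsD[OF U] csubspace_zero[OF csubspace_compacts_dual] by simp
  have x: "?x \<in> mats q q cpt" unfolding mats_def by (intro CollectI allI impI diag_family_compact)
  have K: "op_norm ?B \<le> rect_norm compacts_dual m r U"
    unfolding rect_norm_def compacts_dual_simps(2)
    by (rule cb_norm_compacts_upper[OF mem x op_norm_diag_family[OF a]])
  show "0 \<le> rect_norm compacts_dual m r U"
    using K op_norm_nonneg[OF bd_by_amp_corner] by (rule order_trans[rotated])
  \<comment> \<open>\<open>amp\<close> places the index of the test element first, while products of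
    such matrices are to be formed with the index of \<open>U\<close> first.\<close>
  have "fin_bd (prod.swap ` ({..<m} \<times> {..<q})) (prod.swap ` ({..<r} \<times> {..<q})) (op_norm ?B) ?B"
    by (rule fin_bd_of_bd_by[OF _ bd_by_amp_corner]) simp
  then have "fin_bd ({..<m} \<times> {..<q}) ({..<r} \<times> {..<q}) (op_norm ?B) (\<lambda>j i. ?B (prod.swap j) (prod.swap i))"
    by (subst (asm) fin_bd_reindex) auto
  then have "fin_bd ({..<m} \<times> {..<q}) ({..<r} \<times> {..<q}) (rect_norm compacts_dual m r U)
      (\<lambda>j i. ?B (prod.swap j) (prod.swap i))"
    using K by (rule fin_bd_mono)
  moreover have "?B (s, i) (t, k) = (\<Sum>c<p. a c s t * U i k (diag_unit c))"
    if "s < q" "t < q" "i < m" "k < r" for s t i k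
  proof -
    have "?B (s, i) (t, k) = U i k (?x s t)"
      unfolding amp_corner using that by (simp add: less_max_iff_disj)
    also have "\<dots> = (\<Sum>c<p. a c s t * U i k (diag_unit c))"
      by (rule clinear_on_sum[OF csubspace_compacts])
         (use matsD[OF U that(3,4)] diag_unit_in_cpt in \<open>auto simp: compacts_dual_simps\<close>)
    finally show ?thesis .
  qed
  ultimately show "fin_bd ({..<m} \<times> {..<q}) ({..<r} \<times> {..<q}) (rect_norm compacts_dual m r U)
      (\<lambda>(i, s) (k, t). \<Sum>c<p. a c s t * U i k (diag_unit c))"
    by (subst (asm) fin_bd_cong[where b="\<lambda>(i, s) (k, t). \<Sum>c<p. a c s t * U i k (diag_unit c)"]) auto
qed

text \<open>Guarantees that the \<open>Inf\<close> in \<open>haagerup_norm\<close> is over a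
  nonempty set. The inner index runs over all elementary tensors of all entries; a tensor of entry
  (i, j) is placed in row i of u and column j of v, so it contributes to that entry only.\<close>

lemma haagerup_factorization_exists:
  assumes V: "csubspace V" and W: "csubspace W" and w: "w \<in> mats n n (alg_tensor V W)"
  shows "\<exists>r u v. u \<in> mats n r V \<and> v \<in> mats r n W \<and>
    (\<forall>i<n. \<forall>j<n. w i j = tensor_sum r (\<lambda>k. u i k) (\<lambda>k. v k j))"
proof -
  have "\<forall>i j. \<exists>r x y. i < n \<and> j < n \<longrightarrow> (\<forall>k<r. x k \<in> V \<and> y k \<in> W) \<and> w i j = tensor_sum r x y"
    using w unfolding mats_def alg_tensor_def by blast
  then obtain R X Y where
    XY: "\<And>i j k. i < n \<Longrightarrow> j < n \<Longrightarrow> k < R i j \<Longrightarrow> X i j k \<in> V \<and> Y i j k \<in> W"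
    and wij: "\<And>i j. i < n \<Longrightarrow> j < n \<Longrightarrow> w i j = tensor_sum (R i j) (X i j) (Y i j)"
    by (metis (no_types))
  define A where "A = (SIGMA ij:{..<n} \<times> {..<n}. {..<R (fst ij) (snd ij)})"
  define u where "u i = (\<lambda>(ij, k). if fst ij = i then X (fst ij) (snd ij) k else (\<lambda>_. 0))" for i
  define v where "v j = (\<lambda>(ij, k). if snd ij = j then Y (fst ij) (snd ij) k else (\<lambda>_. 0))" for j
  have fA: "finite A" unfolding A_def by auto
  obtain h where h: "bij_betw h {..<card A} A"
    using ex_bij_betw_nat_finite[OF fA] by (auto simp: lessThan_atLeast0)
  have hA: "h k \<in> A" if "k < card A" for k using bij_betwE[OF h] that by simp
  have mem: "u i e \<in> V" "v i e \<in> W" if "e \<in> A" for i e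
    using that XY csubspace_zero[OF V] csubspace_zero[OF W] by (auto simp: A_def u_def v_def)
  have "w i j = tensor_sum (card A) (\<lambda>k. u i (h k)) (\<lambda>k. v j (h k))" if ij: "i < n" "j < n" for i j
  proof
    fix ab :: "'a \<times> 'b"
    obtain a b where ab: "ab = (a, b)" by (cases ab)
    have "tensor_sum (card A) (\<lambda>k. u i (h k)) (\<lambda>k. v j (h k)) ab = (\<Sum>e\<in>A. u i e a * v j e b)"
      unfolding tensor_sum_def ab using sum.reindex_bij_betw[OF h, of "\<lambda>e. u i e a * v j e b"] by simp
    also have "\<dots> = (\<Sum>ij'\<in>{..<n} \<times> {..<n}. \<Sum>k<R (fst ij') (snd ij'). u i (ij', k) a * v j (ij', k) b)"
      unfolding A_def by (subst sum.Sigma) auto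
    also have "\<dots> = (\<Sum>ij'\<in>{..<n} \<times> {..<n}. if ij' = (i, j) then \<Sum>k<R i j. X i j k a * Y i j k b else 0)"
    proof (rule sum.cong[OF refl])
      fix ij' :: "nat \<times> nat"
      show "(\<Sum>k<R (fst ij') (snd ij'). u i (ij', k) a * v j (ij', k) b) =
          (if ij' = (i, j) then \<Sum>k<R i j. X i j k a * Y i j k b else 0)"
        by (cases "fst ij' = i"; cases "snd ij' = j") (simp_all add: u_def v_def prod_eq_iff)
    qed
    also have "\<dots> = w i j ab"
      unfolding wij[OF ij] ab using ij by (simp add: sum.delta tensor_sum_def)
    finally show "w i j ab = tensor_sum (card A) (\<lambda>k. u i (h k)) (\<lambda>k. v j (h k)) ab" by simp
  qed
  moreover have "(\<lambda>i k. u i (h k)) \<in> mats n (card A) V" "(\<lambda>k j. v j (h k)) \<in> mats (card A) n W"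
    unfolding mats_def using mem hA by auto
  ultimately show ?thesis
    by (intro exI[of _ "card A"] exI[of _ "\<lambda>i k. u i (h k)"] exI[of _ "\<lambda>k j. v j (h k)"]) auto
qed

text \<open>
  The maps \<open>\<phi> \<mapsto> \<Sum>c. \<phi>(E\<^sub>c\<^sub>c) a c\<close> are completely contractive on the dual when the \<open>a c\<close> are contractions,
  and a product of two of them is completely contractive for the Haagerup norm.
\<close>

lemma haagerup_norm_bound:
  fixes a b :: "nat \<Rightarrow> nat \<Rightarrow> nat \<Rightarrow> complex"
  assumes w: "w \<in> mats n n (alg_tensor (vecs compacts_dual) (vecs compacts_dual))"
    and a: "\<And>c. c < p \<Longrightarrow> fin_bd {..<q} {..<q} 1 (a c)"
    and b: "\<And>c. c < p \<Longrightarrow> fin_bd {..<q} {..<q} 1 (b c)"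
  shows "fin_bd ({..<n} \<times> {..<q}) ({..<n} \<times> {..<q}) (haagerup_norm compacts_dual compacts_dual n w)
    (\<lambda>(i, s) (j, t). \<Sum>c<p. \<Sum>d<p. w i j (diag_unit c, diag_unit d) * (\<Sum>s'<q. a c s s' * b d s' t))"
    and "0 \<le> haagerup_norm compacts_dual compacts_dual n w"
proof -
  let ?X = "compacts_dual" and ?P = "{..<n} \<times> {..<q}"
  let ?M = "\<lambda>(i, s) (j, t). \<Sum>c<p. \<Sum>d<p. w i j (diag_unit c, diag_unit d) * (\<Sum>s'<q. a c s s' * b d s' t)"
  \<comment> \<open>The \<open>Inf\<close> need not be attained, so one number is compared with all
    factorizations: \<open>op_norm\<close> of this zero padded matrix is at most each product of
    norms, hence at most their infimum.\<close>
  define M where "M x y = (if x \<in> ?P \<and> y \<in> ?P then ?M x y else 0)" for x y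
  have supp: "M x y \<noteq> 0 \<Longrightarrow> x \<in> ?P \<and> y \<in> ?P" for x y by (simp add: M_def split: if_splits)
  have bM: "bd_by (op_norm M) M"
    by (rule bd_by_finite_exists[OF _ _ supp]) auto
  have le: "op_norm M \<le> haagerup_norm ?X ?X n w"
    unfolding haagerup_norm_def
  proof (rule cInf_greatest)
    show "{rect_norm ?X n r u * rect_norm ?X r n v |r u v. u \<in> mats n r (vecs ?X) \<and> v \<in> mats r n (vecs ?X) \<and>
        (\<forall>i<n. \<forall>j<n. w i j = tensor_sum r (\<lambda>k. u i k) (\<lambda>k. v k j))} \<noteq> {}"
      using haagerup_factorization_exists[OF csubspace_compacts_dual csubspace_compacts_dual w] by blast
    fix K assume "K \<in> {rect_norm ?X n r u * rect_norm ?X r n v |r u v. u \<in> mats n r (vecs ?X) \<and>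
        v \<in> mats r n (vecs ?X) \<and> (\<forall>i<n. \<forall>j<n. w i j = tensor_sum r (\<lambda>k. u i k) (\<lambda>k. v k j))}"
    then obtain r u v where K: "K = rect_norm ?X n r u * rect_norm ?X r n v"
      and u: "u \<in> mats n r (vecs ?X)" and v: "v \<in> mats r n (vecs ?X)"
      and wij: "\<And>i j. i < n \<Longrightarrow> j < n \<Longrightarrow> w i j = tensor_sum r (\<lambda>k. u i k) (\<lambda>k. v k j)"
      by blast
    let ?a = "\<lambda>(i, s) (k, t). \<Sum>c<p. a c s t * u i k (diag_unit c)"
    let ?b = "\<lambda>(k, s) (j, t). \<Sum>d<p. b d s t * v k j (diag_unit d)"
    \<comment> \<open>A factorization of w becomes a matrix product: the a's sit in the left factor
      and the b's in the right one, and the sum over the auxiliary index s' composes them in this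
      order.\<close>
    have "fin_bd ?P ?P K (\<lambda>x y. \<Sum>h\<in>{..<r} \<times> {..<q}. ?a x h * ?b h y)"
      unfolding K
      by (rule fin_bd_mult[OF rect_norm_compacts_dual_bound(1)[OF u a]
            rect_norm_compacts_dual_bound(1)[OF v b] rect_norm_compacts_dual_bound(2)[OF u a]])
    moreover have "(\<Sum>h\<in>{..<r} \<times> {..<q}. ?a x h * ?b h y) = M x y" if xy: "x \<in> ?P" "y \<in> ?P" for x y
    proof -
      obtain i s where x: "x = (i, s)" by (cases x)
      obtain j t where y: "y = (j, t)" by (cases y)
      have "(\<Sum>h\<in>{..<r} \<times> {..<q}. ?a x h * ?b h y) =
          (\<Sum>(k, s', c, d)\<in>{..<r} \<times> {..<q} \<times> {..<p} \<times> {..<p}.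
            (a c s s' * u i k (diag_unit c)) * (b d s' t * v k j (diag_unit d)))"
        unfolding sum.cartesian_product' x y by (simp add: sum_product)
      also have "\<dots> = (\<Sum>(c, d, s', k)\<in>{..<p} \<times> {..<p} \<times> {..<q} \<times> {..<r}.
            (a c s s' * u i k (diag_unit c)) * (b d s' t * v k j (diag_unit d)))"
        by (rule sum.reindex_bij_witness[where
              i="\<lambda>(c, d, s', k). (k, s', c, d)" and j="\<lambda>(k, s', c, d). (c, d, s', k)"]) auto
      also have "\<dots> = (\<Sum>c<p. \<Sum>d<p. \<Sum>s'<q. \<Sum>k<r. (u i k (diag_unit c) * v k j (diag_unit d)) * (a c s s' * b d s' t))"
        unfolding sum.cartesian_product' by (simp add: mult_ac)
      also have "\<dots> = M x y"
        using xy unfolding M_def x y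
        by (simp add: wij tensor_sum_def sum_distrib_right[symmetric] sum_distrib_left[symmetric])
      finally show ?thesis .
    qed
    ultimately have "fin_bd ?P ?P K M" by (subst (asm) fin_bd_cong) auto
    moreover have "0 \<le> K" unfolding K
      by (intro mult_nonneg_nonneg rect_norm_compacts_dual_bound(2)[OF u a] rect_norm_compacts_dual_bound(2)[OF v b])
    ultimately show "op_norm M \<le> K"
      by (intro op_norm_finite_le[OF _ _ supp]) auto
  qed
  then show "0 \<le> haagerup_norm ?X ?X n w" using op_norm_nonneg[OF bM] by simp
  have "fin_bd ?P ?P (op_norm M) M"
    by (rule fin_bd_of_bd_by[OF _ bM]) simp
  then have "fin_bd ?P ?P (haagerup_norm ?X ?X n w) M" using le by (rule fin_bd_mono)
  then show "fin_bd ?P ?P (haagerup_norm ?X ?X n w) ?M"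
    by (subst (asm) fin_bd_cong[where b="?M"]) (auto simp: M_def)
qed

lemma alg_tensor_flip:
  assumes "w \<in> mats n n (alg_tensor V W)"
  shows "flip w \<in> mats n n (alg_tensor W V)"
proof -
  have "(\<lambda>(b, a). z (a, b)) \<in> alg_tensor W V" if "z \<in> alg_tensor V W" for z
  proof -
    obtain r x y where z: "z = tensor_sum r x y" "\<forall>k<r. x k \<in> V \<and> y k \<in> W"
      using \<open>z \<in> alg_tensor V W\<close> unfolding alg_tensor_def by blast
    then have "(\<lambda>(b, a). z (a, b)) = tensor_sum r y x"
      by (auto simp: tensor_sum_def fun_eq_iff mult.commute)
    then show ?thesis using z(2) unfolding alg_tensor_def by blast
  qed
  then show ?thesis using assms by (simp add: mats_def flip_def)
qed

section \<open>The separating tensors\<close>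

text \<open>Injectivity sends distinct basis vectors to multiples of distinct basis vectors, so
  squared norms are summed termwise.\<close>

lemma fin_bd_partial_permutation:
  assumes "finite F" "finite G" "inj_on f G" "f ` G \<subseteq> F" "\<And>i. i \<in> G \<Longrightarrow> cmod (e i) \<le> 1"
  shows "fin_bd F G 1 (\<lambda>j i. if j = f i then e i else 0)"
proof (rule fin_bdI)
  fix \<xi> :: "'b \<Rightarrow> complex"
  let ?y = "\<lambda>j. \<Sum>i\<in>G. (if j = f i then e i else 0) * \<xi> i"
  have y: "?y (f i) = e i * \<xi> i" if "i \<in> G" for i
  proof -
    have "?y (f i) = (\<Sum>i'\<in>G. if i' = i then e i * \<xi> i else 0)"
      using that by (intro sum.cong refl) (simp add: inj_on_eq_iff[OF assms(3)] eq_commute)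
    then show ?thesis using that assms(2) by (simp add: sum.delta)
  qed
  have "(vnorm F ?y)\<^sup>2 = (\<Sum>j\<in>f ` G. (cmod (?y j))\<^sup>2)"
    unfolding vnorm_square
  proof (rule sum.mono_neutral_right)
    show "\<forall>j\<in>F - f ` G. (cmod (?y j))\<^sup>2 = 0"
    proof
      fix j assume "j \<in> F - f ` G"
      then have "?y j = 0" by (intro sum.neutral) auto
      then show "(cmod (?y j))\<^sup>2 = 0" by simp
    qed
  qed (use assms in auto)
  also have "\<dots> = (\<Sum>i\<in>G. (cmod (?y (f i)))\<^sup>2)"
    by (simp add: sum.reindex[OF assms(3)] o_def)
  also have "\<dots> = (\<Sum>i\<in>G. (cmod (e i) * cmod (\<xi> i))\<^sup>2)"
    by (intro sum.cong refl) (simp add: y norm_mult)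
  also have "\<dots> \<le> (\<Sum>i\<in>G. (cmod (\<xi> i))\<^sup>2)"
    by (intro sum_mono power_mono mult_left_le_one_le) (use assms in auto)
  also have "\<dots> = (vnorm G \<xi>)\<^sup>2" by (simp add: vnorm_square)
  finally have "vnorm F ?y \<le> vnorm G \<xi>" by (rule power2_le_imp_le) simp
  then show "vnorm F ?y \<le> 1 * vnorm G \<xi>" by simp
qed

lemma inj_on_add_mod: "inj_on (\<lambda>t. (c + t) mod P) {..<P :: nat}"
proof (rule inj_onI)
  fix t t' assume t: "t \<in> {..<P}" "t' \<in> {..<P}" and "(c + t) mod P = (c + t') mod P"
  then have "[t = t'] (mod P)" using cong_add_lcancel_nat by (simp add: cong_def[symmetric])
  then show "t = t'" using t by (simp add: cong_def)
qed

text \<open>The solution j = l - i is computed in the integers because subtraction of natural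
  numbers truncates at 0.\<close>

lemma add_mod_eq_iff:
  assumes "l < P" "j < (P :: nat)"
  shows "(i + j) mod P = l \<longleftrightarrow> j = nat ((int l - int i) mod int P)"
proof
  assume l: "(i + j) mod P = l"
  have "int l = (int i + int j) mod int P" unfolding l[symmetric] by (simp add: zmod_int)
  then have "(int l - int i) mod int P = ((int i + int j) mod int P - int i) mod int P" by (simp only:)
  also have "\<dots> = (int i + int j - int i) mod int P" by (rule mod_diff_left_eq)
  also have "\<dots> = int j" using assms by simp
  finally show "j = nat ((int l - int i) mod int P)" by simp
next
  assume "j = nat ((int l - int i) mod int P)"
  then have "int j = (int l - int i) mod int P" using assms by simp
  then have "(int i + int j) mod int P = (int i + (int l - int i) mod int P) mod int P" by (simp only:)
  also have "\<dots> = (int i + (int l - int i)) mod int P" by (rule mod_add_right_eq)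
  also have "\<dots> = int l" using assms by simp
  finally have "int ((i + j) mod P) = int l" by (simp add: zmod_int)
  then show "(i + j) mod P = l" by (simp only: of_nat_eq_iff)
qed

lemma sum_int_interval: "(\<Sum>i\<in>{0..<int P}. f i) = (\<Sum>i<P. f (int i))"
  by (rule sum.reindex_bij_witness[where i=int and j=nat]) auto

abbreviation phase :: "nat \<Rightarrow> nat \<Rightarrow> nat \<Rightarrow> complex" where
  "phase P i j \<equiv> cubic_phase (int P) (int i) (int j)"

text \<open>The condition i + j = l modulo P leaves exactly one j for each i and l, which reduces
  the double sum to the convolution over the integers.\<close>

lemma twisted_convolution_bound_nat:
  fixes a :: "nat \<Rightarrow> 's \<Rightarrow> 's \<Rightarrow> complex" and b :: "nat \<Rightarrow> 't \<Rightarrow> 't \<Rightarrow> complex"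
    and \<xi> :: "'s \<times> 't \<Rightarrow> complex"
  assumes P: "prime P" "P \<noteq> 2" and fin: "finite S" "finite T"
    and a: "\<And>i. fin_bd S S 1 (a i)" and b: "\<And>j. fin_bd T T 1 (b j)"
  defines "v \<equiv> \<lambda>i j s t. \<Sum>s1\<in>S. \<Sum>t1\<in>T. a i s s1 * b j t t1 * \<xi> (s1, t1)"
  shows "(\<Sum>l<P. \<Sum>s\<in>S. \<Sum>t\<in>T. (cmod (\<Sum>i<P. \<Sum>j<P.
      if (i + j) mod P = l then cnj (phase P i j) * v i j s t else 0))\<^sup>2)
    \<le> 2 * (real P)\<^sup>2 * sqrt P * (vnorm (S \<times> T) \<xi>)\<^sup>2"
proof -
  have p: "prime (int P)" "int P \<noteq> 2" using P by auto
  have P0: "P > 0" using P by (simp add: prime_gt_0_nat)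
  have "(\<Sum>l<P. \<Sum>s\<in>S. \<Sum>t\<in>T. (cmod (\<Sum>i<P. \<Sum>j<P.
      if (i + j) mod P = l then cnj (phase P i j) * v i j s t else 0))\<^sup>2) =
    (\<Sum>l<P. \<Sum>s\<in>S. \<Sum>t\<in>T. (cmod (\<Sum>i<P. cnj (cubic_phase (int P) (int i) ((int l - int i) mod int P)) *
       (\<Sum>s1\<in>S. \<Sum>t1\<in>T. a (nat (int i)) s s1 * b (nat ((int l - int i) mod int P)) t t1 * \<xi> (s1, t1))))\<^sup>2)"
  proof (intro sum.cong refl arg_cong[where f="\<lambda>z. (cmod z)\<^sup>2"])
    fix l s t i assume l: "l \<in> {..<P}"
    let ?j = "nat ((int l - int i) mod int P)"
    have j: "?j < P" "int ?j = (int l - int i) mod int P" using P0 by (simp_all add: nat_less_iff)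
    have "(\<Sum>j<P. if (i + j) mod P = l then cnj (phase P i j) * v i j s t else 0) =
        (\<Sum>j<P. if j = ?j then cnj (phase P i j) * v i j s t else 0)"
      using l by (intro sum.cong refl) (simp add: add_mod_eq_iff)
    also have "\<dots> = cnj (phase P i ?j) * v i ?j s t" using j(1) by (simp add: sum.delta)
    finally show "(\<Sum>j<P. if (i + j) mod P = l then cnj (phase P i j) * v i j s t else 0) =
        cnj (cubic_phase (int P) (int i) ((int l - int i) mod int P)) *
        (\<Sum>s1\<in>S. \<Sum>t1\<in>T. a (nat (int i)) s s1 * b ?j t t1 * \<xi> (s1, t1))"
      unfolding j(2) v_def by simp
  qed
  also have "\<dots> \<le> 2 * (real P)\<^sup>2 * sqrt P * (vnorm (S \<times> T) \<xi>)\<^sup>2"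
    using twisted_convolution_bound[OF p fin, of "\<lambda>i. a (nat i)" "\<lambda>j. b (nat j)" \<xi>] a b
    unfolding sum_int_interval by simp
  finally show ?thesis .
qed

section \<open>The finite blocks of the canonical realization\<close>

definition blk :: "nat \<Rightarrow> 'u \<Rightarrow> (nat \<times> 'u \<times> nat) set" where
  "blk p u = (\<lambda>s. (p, u, s)) ` {..<p}"

lemma finite_blk [simp]: "finite (blk p u)"
  by (simp add: blk_def)

lemma rep_realize:
  "rep (realize X) x (p, u, j) (q, v, i) =
    (if p = q \<and> u = v \<and> u \<in> complete_contractions X p \<and> j < p \<and> i < p then u x j i else 0)"
  by (simp add: realize_def)

lemma rep_realize_support:
  "rep (realize X) x J I \<noteq> 0 \<Longrightarrow> \<exists>p u. J \<in> blk p u \<and> I \<in> blk p u"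
  by (cases J, cases I) (auto simp: rep_realize blk_def split: if_splits)

text \<open>On the block of a complete contraction u the representation is u x, controlled by the
  case m = 1 of complete contractivity; on every other block it is zero.\<close>

lemma fin_bd_realize_block:
  assumes x: "x \<in> vecs X" and n: "mnorm X 1 (\<lambda>_ _. x) \<le> \<kappa>" and k: "0 \<le> \<kappa>"
  shows "fin_bd (blk p u) (blk p u) \<kappa> (rep (realize X) x)"
proof -
  have "fin_bd {..<p} {..<p} \<kappa> (\<lambda>s t. rep (realize X) x (p, u, s) (p, u, t))"
  proof (cases "u \<in> complete_contractions X p")
    case True
    have "(\<lambda>_ _. x) \<in> mats 1 1 (vecs X)" using x by (simp add: mats_def)
    then have "op_norm (amp 1 (corner p u) (\<lambda>_ _. x)) \<le> mnorm X 1 (\<lambda>_ _. x)"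
      using True unfolding complete_contractions_def by blast
    then have le: "op_norm (amp 1 (corner p u) (\<lambda>_ _. x)) \<le> \<kappa>" using n by simp
    let ?f = "\<lambda>s::nat. (0::nat, s)"
    have e: "{..<1} \<times> {..<p} = ?f ` {..<p}" by auto
    have "fin_bd (?f ` {..<p}) (?f ` {..<p}) \<kappa> (amp 1 (corner p u) (\<lambda>_ _. x))"
      using fin_bd_mono[OF fin_bd_amp_corner[of 1 p u "\<lambda>_ _. x"] le] unfolding e .
    then have "fin_bd {..<p} {..<p} \<kappa> (\<lambda>s t. amp 1 (corner p u) (\<lambda>_ _. x) (0, s) (0, t))"
      by (subst (asm) fin_bd_reindex) (auto simp: inj_on_def)
    then show ?thesis
      by (subst (asm) fin_bd_cong[where b="\<lambda>s t. rep (realize X) x (p, u, s) (p, u, t)"])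
         (auto simp: amp_corner rep_realize True)
  next
    case False
    show ?thesis
      by (subst fin_bd_cong[where b="\<lambda>_ _. 0"])
         (auto simp: rep_realize False intro!: fin_bd_mono[OF fin_bd_zero k])
  qed
  then show ?thesis unfolding blk_def by (subst fin_bd_reindex) (auto simp: inj_on_def)
qed

text \<open>The conjugate phase is what later meets the phase of \<open>mu_test\<close> and cancels
  against it.\<close>

definition witness_vec :: "nat \<Rightarrow> nat \<times> nat \<Rightarrow> nat \<Rightarrow> complex" where
  "witness_vec P = (\<lambda>(i, j) l. if (i + j) mod P = l then cnj (phase P i j) else 0)"

definition diag_pair :: "nat \<times> nat \<Rightarrow> (nat \<times> nat \<Rightarrow> complex) \<times> (nat \<times> nat \<Rightarrow> complex) \<Rightarrow> complex" where
  "diag_pair = (\<lambda>(i, j) (x, y). diag_functional i x * diag_functional j y)"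

text \<open>The tensor w of the opening comment, as a function on the index set of the column space
  times that of the inner tensor product.\<close>

definition witness :: "nat \<Rightarrow> nat \<times> (nat \<times> nat \<Rightarrow> complex) \<times> (nat \<times> nat \<Rightarrow> complex) \<Rightarrow> complex" where
  "witness P = (\<lambda>(l, xy). \<Sum>ij\<in>{..<P} \<times> {..<P}. witness_vec P ij l * diag_pair ij xy)"

lemma witness_vec_ell2: "witness_vec P ij \<in> ell2"
  by (rule ell2_finite_support(1)[of "{(fst ij + snd ij) mod P}"]) (auto simp: witness_vec_def split_beta)

lemma diag_pair_eq:
  "diag_pair ij = (\<lambda>(x, y). \<Sum>_\<in>{()}. diag_functional (fst ij) x * diag_functional (snd ij) y)"
  by (auto simp: diag_pair_def fun_eq_iff split_beta)

lemma diag_pair_mem: "diag_pair ij \<in> alg_tensor (vecs compacts_dual) (vecs compacts_dual)"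
  unfolding diag_pair_eq by (rule alg_tensor_sumI) (auto intro: diag_functional_in_dual)

lemma witness_mem:
  "witness P \<in> alg_tensor (cvecs column_space) (alg_tensor (vecs compacts_dual) (vecs compacts_dual))"
  unfolding witness_def
  by (rule alg_tensor_sumI) (auto simp: column_space_def witness_vec_ell2 diag_pair_mem)

lemma cvecs_realize [simp]: "cvecs (realize X) = vecs X"
  by (simp add: realize_def)

lemma cvecs_min_tensor [simp]: "cvecs (min_tensor E F) = alg_tensor (cvecs E) (cvecs F)"
  by (simp add: min_tensor_def)

lemma column_space_simps [simp]: "cvecs column_space = ell2" "rep column_space f l i = f l"
  by (simp_all add: column_space_def)

text \<open>On a pair of blocks of the two realizations the diagonal functionals become
  contractions, acting on separate tensor legs. The image of a vector is then the twisted
  convolution already estimated, with the column coordinate as output index l.\<close>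

lemma min_norm_witness:
  assumes P: "prime P" "P \<noteq> 2"
  shows "cnorm (min_tensor column_space (min_tensor (realize compacts_dual) (realize compacts_dual))) (witness P)
    \<le> sqrt (2 * (real P)\<^sup>2 * sqrt P)"
  unfolding cnorm_def
proof (rule op_norm_le)
  let ?R = "realize compacts_dual"
  let ?T = "rep (min_tensor column_space (min_tensor ?R ?R)) (witness P)"
  let ?K = "sqrt (2 * (real P)\<^sup>2 * sqrt P)"
  define \<rho> where "\<rho> i = rep ?R (diag_functional i)" for i
  have lin: "lin_rep ?R" by (rule lin_rep_realize[OF csubspace_compacts_dual])
  have inner: "rep (min_tensor ?R ?R) (diag_pair ij) (J, J') (I, I') = \<rho> (fst ij) J I * \<rho> (snd ij) J' I'" for ij J J' I I'
    unfolding diag_pair_eq \<rho>_def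
    by (subst rep_min_tensor[OF lin lin]) (auto intro: diag_functional_in_dual)
  have T: "?T (l, J, J') ((), I, I') =
      (\<Sum>i<P. \<Sum>j<P. if (i + j) mod P = l then cnj (phase P i j) * (\<rho> i J I * \<rho> j J' I') else 0)" for l J J' I I'
  proof -
    have "?T (l, (J, J')) ((), (I, I')) = (\<Sum>ij\<in>{..<P} \<times> {..<P}. rep column_space (witness_vec P ij) l () *
        rep (min_tensor ?R ?R) (diag_pair ij) (J, J') (I, I'))"
      unfolding witness_def
      by (rule rep_min_tensor[OF lin_rep_column lin_rep_min_tensor[OF lin lin]])
         (auto simp: witness_vec_ell2 diag_pair_mem)
    also have "\<dots> = (\<Sum>i<P. \<Sum>j<P. if (i + j) mod P = l then cnj (phase P i j) * (\<rho> i J I * \<rho> j J' I') else 0)"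
      unfolding sum.cartesian_product' by (intro sum.cong refl) (simp add: inner witness_vec_def)
    finally show ?thesis .
  qed
  have rho: "fin_bd (blk p u) (blk p u) 1 (\<rho> i)" for p u i
    unfolding \<rho>_def by (rule fin_bd_realize_block[OF diag_functional_in_dual mnorm_diag_functional]) simp
  let ?D = "\<lambda>b. blk (fst (fst b)) (snd (fst b)) \<times> blk (fst (snd b)) (snd (snd b))"
  \<comment> \<open>A block is a pair of blocks of the two realizations; all column coordinates l <
    P belong to each of them.\<close>
  show "bd_by ?K ?T"
  proof (rule bd_by_blocks[where F="\<lambda>b. {..<P} \<times> ?D b" and G="\<lambda>b. {()} \<times> ?D b" and
        f="\<lambda>(l, (p, u, s), (q, v, t)). ((p, u), (q, v))" and
        g="\<lambda>(l, (p, u, s), (q, v, t)). ((p, u), (q, v))"])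
    fix x y assume "?T x y \<noteq> 0"
    moreover obtain l J J' where x: "x = (l, J, J')" by (cases x)
    moreover obtain I I' where y: "y = ((), I, I')" by (cases y) auto
    ultimately have "(\<Sum>i<P. \<Sum>j<P. if (i + j) mod P = l then cnj (phase P i j) * (\<rho> i J I * \<rho> j J' I') else 0) \<noteq> 0"
      by (simp add: T)
    then obtain i where "(\<Sum>j<P. if (i + j) mod P = l then cnj (phase P i j) * (\<rho> i J I * \<rho> j J' I') else 0) \<noteq> 0"
      by (rule sum.not_neutral_contains_not_neutral)
    then obtain j where "j \<in> {..<P}" "(if (i + j) mod P = l then cnj (phase P i j) * (\<rho> i J I * \<rho> j J' I') else 0) \<noteq> 0"
      by (rule sum.not_neutral_contains_not_neutral)
    then have l: "l < P" and nz: "\<rho> i J I \<noteq> 0" "\<rho> j J' I' \<noteq> 0" by (auto split: if_splits)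
    obtain p u where 1: "J \<in> blk p u" "I \<in> blk p u"
      using rep_realize_support[OF nz(1)[unfolded \<rho>_def]] by blast
    obtain q v where 2: "J' \<in> blk q v" "I' \<in> blk q v"
      using rep_realize_support[OF nz(2)[unfolded \<rho>_def]] by blast
    from 1 2 show "\<exists>b. x \<in> {..<P} \<times> ?D b \<and> y \<in> {()} \<times> ?D b"
      using l unfolding x y by (intro exI[of _ "((p, u), (q, v))"]) auto
  next
    fix b :: "(nat \<times> (((nat \<times> nat \<Rightarrow> complex) \<Rightarrow> complex) \<Rightarrow> nat \<Rightarrow> nat \<Rightarrow> complex)) \<times>
      (nat \<times> (((nat \<times> nat \<Rightarrow> complex) \<Rightarrow> complex) \<Rightarrow> nat \<Rightarrow> nat \<Rightarrow> complex))"
    obtain p u q v where b: "b = ((p, u), (q, v))" by (metis prod.collapse)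
    let ?S = "blk p u" and ?U = "blk q v"
    have "fin_bd ({..<P} \<times> ?S \<times> ?U) ({()} \<times> ?S \<times> ?U) ?K ?T"
    proof (rule fin_bdI)
      fix \<xi> :: "unit \<times> _ \<Rightarrow> complex"
      let ?v = "\<lambda>i j s t. \<Sum>s1\<in>?S. \<Sum>t1\<in>?U. \<rho> i s s1 * \<rho> j t t1 * \<xi> ((), s1, t1)"
      have ap: "(\<Sum>y\<in>{()} \<times> ?S \<times> ?U. ?T (l, s, t) y * \<xi> y) =
        (\<Sum>i<P. \<Sum>j<P. if (i + j) mod P = l then cnj (phase P i j) * ?v i j s t else 0)" for l s t
      proof -
        have "(\<Sum>y\<in>{()} \<times> ?S \<times> ?U. ?T (l, s, t) y * \<xi> y) = (\<Sum>(s1, t1, i, j)\<in>?S \<times> ?U \<times> {..<P} \<times> {..<P}.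
            (if (i + j) mod P = l then cnj (phase P i j) * (\<rho> i s s1 * \<rho> j t t1) else 0) * \<xi> ((), s1, t1))"
          unfolding sum.cartesian_product' by (simp add: T sum_distrib_right)
        also have "\<dots> = (\<Sum>(i, j, s1, t1)\<in>{..<P} \<times> {..<P} \<times> ?S \<times> ?U.
            (if (i + j) mod P = l then cnj (phase P i j) * (\<rho> i s s1 * \<rho> j t t1) else 0) * \<xi> ((), s1, t1))"
          by (rule sum.reindex_bij_witness[where i="\<lambda>(i, j, s1, t1). (s1, t1, i, j)" and
                j="\<lambda>(s1, t1, i, j). (i, j, s1, t1)"]) auto
        also have "\<dots> = (\<Sum>i<P. \<Sum>j<P. if (i + j) mod P = l then cnj (phase P i j) * ?v i j s t else 0)"
          unfolding sum.cartesian_product' by (intro sum.cong refl) (simp add: sum_distrib_left mult.assoc)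
        finally show ?thesis .
      qed
      have nx: "vnorm (?S \<times> ?U) (\<lambda>q. \<xi> ((), q)) = vnorm ({()} \<times> ?S \<times> ?U) \<xi>"
        unfolding L2_set_def sum.cartesian_product' by simp
      have "(vnorm ({..<P} \<times> ?S \<times> ?U) (\<lambda>x. \<Sum>y\<in>{()} \<times> ?S \<times> ?U. ?T x y * \<xi> y))\<^sup>2 =
        (\<Sum>(l, s, t)\<in>{..<P} \<times> ?S \<times> ?U. (cmod (\<Sum>i<P. \<Sum>j<P. if (i + j) mod P = l then cnj (phase P i j) * ?v i j s t else 0))\<^sup>2)"
        unfolding vnorm_square
      proof (rule sum.cong[OF refl])
        fix x assume "x \<in> {..<P} \<times> ?S \<times> ?U"
        obtain l s t where x: "x = (l, s, t)" by (cases x)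
        show "(cmod (\<Sum>y\<in>{()} \<times> ?S \<times> ?U. ?T x y * \<xi> y))\<^sup>2 = (case x of (l, s, t) \<Rightarrow>
            (cmod (\<Sum>i<P. \<Sum>j<P. if (i + j) mod P = l then cnj (phase P i j) * ?v i j s t else 0))\<^sup>2)"
          by (simp only: x ap prod.case)
      qed
      also have "\<dots> = (\<Sum>l<P. \<Sum>s\<in>?S. \<Sum>t\<in>?U. (cmod (\<Sum>i<P. \<Sum>j<P. if (i + j) mod P = l then cnj (phase P i j) * ?v i j s t else 0))\<^sup>2)"
        unfolding sum.cartesian_product' by simp
      also have "\<dots> \<le> 2 * (real P)\<^sup>2 * sqrt P * (vnorm (?S \<times> ?U) (\<lambda>q. \<xi> ((), q)))\<^sup>2"
        by (rule twisted_convolution_bound_nat[OF P finite_blk finite_blk rho rho])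
      also have "\<dots> = (?K * vnorm ({()} \<times> ?S \<times> ?U) \<xi>)\<^sup>2"
        unfolding nx power_mult_distrib by (subst real_sqrt_pow2) auto
      finally show "vnorm ({..<P} \<times> ?S \<times> ?U) (\<lambda>x. \<Sum>y\<in>{()} \<times> ?S \<times> ?U. ?T x y * \<xi> y)
          \<le> ?K * vnorm ({()} \<times> ?S \<times> ?U) \<xi>"
        by (rule power2_le_imp_le) simp
    qed
    then show "fin_bd ({..<P} \<times> ?D b) ({()} \<times> ?D b) ?K ?T"
      by (simp only: b fst_conv snd_conv)
  qed (auto simp: blk_def)
qed simp

text \<open>For c, d < P the tensor of the c-th and d-th diagonal functionals is sent to the phase
  at (c, d) times the matrix unit with row (c + d) mod P and column 0; column 0 is the
  vacuum.\<close>

definition mu_test :: "nat \<Rightarrow> ((nat \<times> nat \<Rightarrow> complex) \<times> (nat \<times> nat \<Rightarrow> complex) \<Rightarrow> complex) \<Rightarrow> nat \<Rightarrow> nat \<Rightarrow> complex" where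
  "mu_test P \<phi> s t = (\<Sum>c<P. \<Sum>d<P. \<phi> (diag_unit c, diag_unit d) *
     (if s = (c + d) mod P then if t = 0 then phase P c d else 0 else 0))"

text \<open>A cyclic shift with weights. Unimodular weights give a unitary for P > 0; the indicator
  of t = 0 as weight gives, for c < P, the rank one map from the vacuum to basis vector c. Both
  kinds occur as factors of \<open>mu_test\<close>.\<close>

definition shift_twist :: "nat \<Rightarrow> (nat \<Rightarrow> nat \<Rightarrow> complex) \<Rightarrow> nat \<Rightarrow> nat \<Rightarrow> nat \<Rightarrow> complex" where
  "shift_twist P e c s t = (if s = (c + t) mod P then e c t else 0)"

lemma fin_bd_shift_twist:
  assumes "0 < P" "\<And>t. cmod (e c t) \<le> 1"
  shows "fin_bd {..<P} {..<P} 1 (shift_twist P e c)"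
  unfolding shift_twist_def
  by (rule fin_bd_partial_permutation[OF _ _ inj_on_add_mod]) (use assms in auto)

text \<open>The right factor takes the vacuum to basis vector d and kills the other basis vectors;
  the left one then shifts by c and multiplies by \<open>e c d\<close>.\<close>

lemma shift_twist_mult:
  assumes "0 < P" "d < P"
  shows "(\<Sum>s'<P. shift_twist P e c s s' * shift_twist P (\<lambda>_ t. if t = 0 then 1 else 0) d s' t) =
    (if s = (c + d) mod P then if t = 0 then e c d else 0 else 0)"
proof (cases "t = 0")
  case True
  have "(\<Sum>s'<P. shift_twist P e c s s' * shift_twist P (\<lambda>_ t. if t = 0 then 1 else 0) d s' t) =
      (\<Sum>s'<P. if s' = d then shift_twist P e c s d else 0)"
    by (intro sum.cong refl) (use assms True in \<open>simp add: shift_twist_def\<close>)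
  then show ?thesis using assms True by (simp add: sum.delta shift_twist_def)
next
  case False
  then show ?thesis by (simp add: shift_twist_def)
qed

lemma mu_tensor_simps:
  "vecs (mu_tensor X Y) = alg_tensor (vecs X) (vecs Y)"
  "mnorm (mu_tensor X Y) n w = Inf {haagerup_norm X Y n w1 + haagerup_norm Y X n (flip w2) | w1 w2.
        w1 \<in> mats n n (alg_tensor (vecs X) (vecs Y)) \<and> w2 \<in> mats n n (alg_tensor (vecs X) (vecs Y)) \<and>
        (\<forall>i<n. \<forall>j<n. w i j = (\<lambda>p. w1 i j p + w2 i j p))}"
  by (simp_all add: mu_tensor_def)

text \<open>
  \<open>mu_test\<close> factors both as \<open>\<phi> \<otimes> \<psi> \<mapsto> \<alpha>(\<phi>) \<beta>(\<psi>)\<close> and as \<open>\<phi> \<otimes> \<psi> \<mapsto> \<beta>'(\<psi>) \<alpha>'(\<phi>)\<close> with complete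
  contractions into \<open>M\<^sub>P\<close>: the second factor sends the vacuum vector 0 to the basis vector given by
  its index, and the first one is a unimodular multiple of a cyclic shift.
\<close>

lemma mu_test_complete_contraction:
  assumes P: "0 < P"
  shows "mu_test P \<in> complete_contractions (mu_tensor compacts_dual compacts_dual) P"
  unfolding complete_contractions_def mu_tensor_simps
proof (intro CollectI conjI allI impI ballI)
  let ?X = "compacts_dual" and ?V = "alg_tensor (vecs compacts_dual) (vecs compacts_dual)"
  show "clinear_on ?V (\<lambda>\<phi>. mu_test P \<phi> i j)" for i j
    unfolding clinear_on_def mu_test_def
    by (simp only: distrib_right mult.assoc sum.distrib sum_distrib_left) simp
  fix m x assume x: "x \<in> mats m m ?V"
  let ?H = "{haagerup_norm ?X ?X m w1 + haagerup_norm ?X ?X m (flip w2) | w1 w2.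
        w1 \<in> mats m m ?V \<and> w2 \<in> mats m m ?V \<and> (\<forall>i<m. \<forall>j<m. x i j = (\<lambda>p. w1 i j p + w2 i j p))}"
  show "op_norm (amp m (corner P (mu_test P)) x) \<le> Inf ?H"
  proof (rule cInf_greatest)
    \<comment> \<open>The decomposition x = x + 0 shows that the infimum is over a nonempty
      set.\<close>
    have "(\<lambda>_ _ _. 0) \<in> mats m m ?V"
      unfolding mats_def using csubspace_zero[OF csubspace_alg_tensor[OF csubspace_compacts_dual csubspace_compacts_dual]] by simp
    then have "haagerup_norm ?X ?X m x + haagerup_norm ?X ?X m (flip (\<lambda>_ _ _. 0)) \<in> ?H"
      using x by (intro CollectI exI[of _ x] exI[of _ "\<lambda>_ _ _. 0"]) simp
    then show "?H \<noteq> {}" by blast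
    fix K assume "K \<in> ?H"
    then obtain w1 w2 where K: "K = haagerup_norm ?X ?X m w1 + haagerup_norm ?X ?X m (flip w2)"
      and w1: "w1 \<in> mats m m ?V" and w2: "w2 \<in> mats m m ?V"
      and xw: "\<And>i j. i < m \<Longrightarrow> j < m \<Longrightarrow> x i j = (\<lambda>p. w1 i j p + w2 i j p)" by blast
    have fw2: "flip w2 \<in> mats m m ?V" by (rule alg_tensor_flip[OF w2])
    let ?Q = "{..<m} \<times> {..<P}"
    let ?b = "shift_twist P (\<lambda>_ t. if t = 0 then 1 else 0)"
    \<comment> \<open>\<open>?a'\<close> carries the phase with its arguments exchanged: after the
      flip the index of the left factor comes from the second tensor leg.\<close>
    let ?a = "shift_twist P (phase P)" and ?a' = "shift_twist P (\<lambda>c t. phase P t c)"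
    have a: "fin_bd {..<P} {..<P} 1 (?a c)" and a': "fin_bd {..<P} {..<P} 1 (?a' c)"
      and b: "fin_bd {..<P} {..<P} 1 (?b c)" for c
      by (auto intro!: fin_bd_shift_twist P)
    let ?M1 = "\<lambda>(i, s) (j, t). \<Sum>c<P. \<Sum>d<P. w1 i j (diag_unit c, diag_unit d) * (\<Sum>s'<P. ?a c s s' * ?b d s' t)"
    let ?M2 = "\<lambda>(i, s) (j, t). \<Sum>c<P. \<Sum>d<P. flip w2 i j (diag_unit c, diag_unit d) * (\<Sum>s'<P. ?a' c s s' * ?b d s' t)"
    have "fin_bd ?Q ?Q K (\<lambda>y z. ?M1 y z + ?M2 y z)"
      unfolding K by (intro fin_bd_add haagerup_norm_bound(1) w1 fw2 a a' b)
    moreover have "?M1 y z + ?M2 y z = amp m (corner P (mu_test P)) x y z" if "y \<in> ?Q" "z \<in> ?Q" for y z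
    proof -
      obtain i s where y: "y = (i, s)" by (cases y)
      obtain j t where z: "z = (j, t)" by (cases z)
      have ij: "i < m" "j < m" "s < P" "t < P" using that unfolding y z by auto
      have 1: "?M1 y z = mu_test P (w1 i j) s t"
        unfolding y z prod.case mu_test_def
        by (intro sum.cong refl) (simp only: shift_twist_mult[OF P] lessThan_iff)
      have "?M2 y z = (\<Sum>c<P. \<Sum>d<P. w2 i j (diag_unit d, diag_unit c) *
          (if s = (c + d) mod P then if t = 0 then phase P d c else 0 else 0))"
        unfolding y z prod.case flip_def
        by (intro sum.cong refl) (simp only: shift_twist_mult[OF P] lessThan_iff)
      \<comment> \<open>Renaming c and d and using c + d = d + c identifies the product in reversed
        order with the same map. This is where the two factorizations agree.\<close>
      also have "\<dots> = mu_test P (w2 i j) s t"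
        unfolding mu_test_def by (subst sum.swap) (simp only: add.commute)
      finally have 2: "?M2 y z = mu_test P (w2 i j) s t" .
      have "amp m (corner P (mu_test P)) x y z = mu_test P (x i j) s t"
        unfolding y z amp_corner using ij by simp
      also have "\<dots> = mu_test P (w1 i j) s t + mu_test P (w2 i j) s t"
        unfolding xw[OF ij(1,2)] mu_test_def by (simp only: distrib_right sum.distrib)
      finally show ?thesis unfolding 1 2 by simp
    qed
    ultimately have "fin_bd ?Q ?Q K (amp m (corner P (mu_test P)) x)"
      by (subst (asm) fin_bd_cong) auto
    moreover have "0 \<le> K"
      unfolding K by (intro add_nonneg_nonneg haagerup_norm_bound(2)[OF w1 a b] haagerup_norm_bound(2)[OF fw2 a b])
    ultimately show "op_norm (amp m (corner P (mu_test P)) x) \<le> K"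
      by (rule op_norm_amp_corner_le)
  qed
qed

lemma mu_test_diag_pair:
  assumes "i < P" "j < P"
  shows "mu_test P (diag_pair (i, j)) s 0 = (if s = (i + j) mod P then phase P i j else 0)"
proof -
  let ?e = "if s = (i + j) mod P then phase P i j else 0"
  have "mu_test P (diag_pair (i, j)) s 0 = (\<Sum>c<P. \<Sum>d<P. if c = i then if d = j then ?e else 0 else 0)"
    unfolding mu_test_def diag_pair_def prod.case diag_functional_diag_unit
    by (intro sum.cong refl) auto
  also have "\<dots> = (\<Sum>c<P. if c = i then \<Sum>d<P. if d = j then ?e else 0 else 0)"
    by (intro sum.cong refl) (simp only: if_True if_False sum.neutral_const split: if_split, simp)
  also have "\<dots> = ?e" using assms by (simp add: sum.delta)
  finally show ?thesis .
qed

text \<open>In the block of the complete contraction \<open>mu_test P\<close> the vacuum is sent to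
  a vector with P entries equal to P, one for each column coordinate l. Its norm is the square root
  of P times P^2.\<close>

lemma mu_norm_witness:
  assumes P: "0 < P"
  shows "sqrt (real P ^ 3) \<le>
    cnorm (min_tensor column_space (realize (mu_tensor compacts_dual compacts_dual))) (witness P)"
  unfolding cnorm_def
proof -
  let ?X = "mu_tensor compacts_dual compacts_dual"
  let ?R = "realize ?X"
  let ?T = "rep (min_tensor column_space ?R) (witness P)"
  have V: "csubspace (vecs ?X)"
    unfolding mu_tensor_simps by (rule csubspace_alg_tensor[OF csubspace_compacts_dual csubspace_compacts_dual])
  have dm: "diag_pair ij \<in> vecs ?X" for ij unfolding mu_tensor_simps by (rule diag_pair_mem)
  have T: "?T (l, J) ((), I) = (\<Sum>ij\<in>{..<P} \<times> {..<P}. witness_vec P ij l * rep ?R (diag_pair ij) J I)" for l J I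
  proof -
    have "?T (l, J) ((), I) =
        (\<Sum>ij\<in>{..<P} \<times> {..<P}. rep column_space (witness_vec P ij) l () * rep ?R (diag_pair ij) J I)"
      unfolding witness_def
      by (rule rep_min_tensor[OF lin_rep_column lin_rep_realize[OF V]]) (auto simp: witness_vec_ell2 dm)
    then show ?thesis by simp
  qed
  \<comment> \<open>A crude bound, made nonnegative by the absolute value. Some bound must be known
    before a value of the operator can be compared with \<open>op_norm\<close>.\<close>
  define \<kappa> where "\<kappa> ij = \<bar>mnorm ?X 1 (\<lambda>_ _. diag_pair ij)\<bar>" for ij
  let ?K = "\<Sum>ij\<in>{..<P} \<times> {..<P}. vnorm {..<P} (witness_vec P ij) * \<kappa> ij"
  have "bd_by ?K ?T"
  proof (rule bd_by_blocks[where F="\<lambda>b. {..<P} \<times> blk (fst b) (snd b)" and G="\<lambda>b. {()} \<times> blk (fst b) (snd b)" and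
        f="\<lambda>(l, (p, u, s)). (p, u)" and g="\<lambda>(l, (p, u, s)). (p, u)"])
    fix x y assume "?T x y \<noteq> 0"
    moreover obtain l J where x: "x = (l, J)" by (cases x)
    moreover obtain I where y: "y = ((), I)" by (cases y) auto
    ultimately have "(\<Sum>ij\<in>{..<P} \<times> {..<P}. witness_vec P ij l * rep ?R (diag_pair ij) J I) \<noteq> 0"
      by (simp only: T) simp
    then obtain ij where "witness_vec P ij l * rep ?R (diag_pair ij) J I \<noteq> 0"
      by (rule sum.not_neutral_contains_not_neutral)
    then have 1: "witness_vec P ij l \<noteq> 0" and 2: "rep ?R (diag_pair ij) J I \<noteq> 0" by auto
    from 1 have "l < P" using P by (auto simp: witness_vec_def split_beta split: if_splits)
    moreover obtain p u where "J \<in> blk p u" "I \<in> blk p u" using rep_realize_support[OF 2] by blast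
    ultimately show "\<exists>b. x \<in> {..<P} \<times> blk (fst b) (snd b) \<and> y \<in> {()} \<times> blk (fst b) (snd b)"
      unfolding x y by (intro exI[of _ "(p, u)"]) auto
  next
    fix b :: "nat \<times> (((nat \<times> nat \<Rightarrow> complex) \<times> (nat \<times> nat \<Rightarrow> complex) \<Rightarrow> complex) \<Rightarrow> nat \<Rightarrow> nat \<Rightarrow> complex)"
    let ?S = "blk (fst b) (snd b)"
    let ?t = "\<lambda>ij (l, J) (_ :: unit, I). witness_vec P ij l * rep ?R (diag_pair ij) J I"
    have "fin_bd ({..<P} \<times> ?S) ({()} \<times> ?S) ?K (\<lambda>x y. \<Sum>ij\<in>{..<P} \<times> {..<P}. ?t ij x y)"
    proof (rule fin_bd_sum)
      fix ij
      have r: "fin_bd ?S ?S (\<kappa> ij) (rep ?R (diag_pair ij))"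
        by (rule fin_bd_realize_block[OF dm]) (auto simp: \<kappa>_def)
      show "fin_bd ({..<P} \<times> ?S) ({()} \<times> ?S) (vnorm {..<P} (witness_vec P ij) * \<kappa> ij) (?t ij)"
      proof (rule fin_bdI)
        fix \<xi> :: "unit \<times> _ \<Rightarrow> complex"
        let ?y = "\<lambda>J. \<Sum>I\<in>?S. rep ?R (diag_pair ij) J I * \<xi> ((), I)"
        have "(vnorm ({..<P} \<times> ?S) (\<lambda>x. \<Sum>y\<in>{()} \<times> ?S. ?t ij x y * \<xi> y))\<^sup>2 =
            (\<Sum>l<P. \<Sum>J\<in>?S. (cmod (witness_vec P ij l * ?y J))\<^sup>2)"
          unfolding vnorm_square sum.cartesian_product' by (simp add: sum_distrib_left mult.assoc)
        also have "\<dots> = (vnorm {..<P} (witness_vec P ij) * vnorm ?S ?y)\<^sup>2"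
          unfolding power_mult_distrib vnorm_square by (simp add: norm_mult power_mult_distrib sum_product)
        finally have "vnorm ({..<P} \<times> ?S) (\<lambda>x. \<Sum>y\<in>{()} \<times> ?S. ?t ij x y * \<xi> y) =
            vnorm {..<P} (witness_vec P ij) * vnorm ?S ?y"
          by (rule power2_eq_imp_eq) auto
        also have "\<dots> \<le> vnorm {..<P} (witness_vec P ij) * (\<kappa> ij * vnorm ?S (\<lambda>I. \<xi> ((), I)))"
          by (intro mult_left_mono fin_bdD[OF r]) auto
        also have "vnorm ?S (\<lambda>I. \<xi> ((), I)) = vnorm ({()} \<times> ?S) \<xi>"
          unfolding L2_set_def sum.cartesian_product' by simp
        finally show "vnorm ({..<P} \<times> ?S) (\<lambda>x. \<Sum>y\<in>{()} \<times> ?S. ?t ij x y * \<xi> y)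
            \<le> vnorm {..<P} (witness_vec P ij) * \<kappa> ij * vnorm ({()} \<times> ?S) \<xi>" by (simp only: mult.assoc)
      qed
    qed simp
    then show "fin_bd ({..<P} \<times> ?S) ({()} \<times> ?S) ?K ?T"
      by (subst (asm) fin_bd_cong[where b="?T"]) (auto simp only: T prod.case mem_Times_iff split: prod.split)
  qed (auto simp: blk_def \<kappa>_def intro!: sum_nonneg)
  \<comment> \<open>Compression to the vacuum column and to the rows where the column coordinate and
    the coordinate inside the block are both l.\<close>
  then have "fin_bd ((\<lambda>l. (l, (P, mu_test P, l))) ` {..<P}) ((\<lambda>_. ((), (P, mu_test P, 0))) ` {()}) (op_norm ?T) ?T"
    by (intro fin_bd_of_bd_by bd_by_op_norm) auto
  then have "fin_bd {..<P} {()} (op_norm ?T) (\<lambda>l _. ?T (l, (P, mu_test P, l)) ((), (P, mu_test P, 0)))"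
    by (subst (asm) fin_bd_reindex) (auto simp: inj_on_def)
  from fin_bdD[OF this, of "\<lambda>_. 1"]
  have le: "vnorm {..<P} (\<lambda>l. ?T (l, (P, mu_test P, l)) ((), (P, mu_test P, 0))) \<le> op_norm ?T"
    by (simp add: L2_set_def)
  have entry: "?T (l, (P, mu_test P, l)) ((), (P, mu_test P, 0)) = of_nat P" if l: "l < P" for l
  proof -
    have "?T (l, (P, mu_test P, l)) ((), (P, mu_test P, 0)) =
        (\<Sum>i<P. \<Sum>j<P. witness_vec P (i, j) l * mu_test P (diag_pair (i, j)) l 0)"
      unfolding T sum.cartesian_product' rep_realize using mu_test_complete_contraction[OF P] l P by simp
    \<comment> \<open>The conjugate phase of the witness meets the phase of \<open>mu_test\<close>,
      so each pair with i + j = l modulo P contributes 1, and every i has exactly one such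
      j.\<close>
    also have "\<dots> = (\<Sum>i<P. \<Sum>j<P. if j = nat ((int l - int i) mod int P) then 1 else 0)"
    proof (intro sum.cong refl)
      fix i j assume "i \<in> {..<P}" "j \<in> {..<P}"
      then have ij: "i < P" "j < P" by auto
      have "witness_vec P (i, j) l * mu_test P (diag_pair (i, j)) l 0 = (if (i + j) mod P = l then 1 else 0)"
        unfolding mu_test_diag_pair[OF ij] witness_vec_def
        using complex_norm_square[of "phase P i j"] by (auto simp: mult.commute)
      then show "witness_vec P (i, j) l * mu_test P (diag_pair (i, j)) l 0 =
          (if j = nat ((int l - int i) mod int P) then 1 else 0)"
        unfolding add_mod_eq_iff[OF l ij(2)] .
    qed
    also have "\<dots> = (\<Sum>i<P. 1)"
      using P by (intro sum.cong refl) (simp add: sum.delta nat_less_iff)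
    finally show ?thesis by simp
  qed
  have "vnorm {..<P} (\<lambda>l. ?T (l, (P, mu_test P, l)) ((), (P, mu_test P, 0))) = sqrt (real P ^ 3)"
    unfolding L2_set_def by (simp add: entry power3_eq_cube power2_eq_square mult.assoc)
  then show "sqrt (real P ^ 3) \<le> op_norm ?T" using le by simp
qed

theorem theorem1p1:
  "\<not> equivalent_norms_on
       (alg_tensor (cvecs column_space) (alg_tensor (vecs compacts_dual) (vecs compacts_dual)))
       (cnorm (min_tensor column_space (min_tensor (realize compacts_dual) (realize compacts_dual))))
       (cnorm (min_tensor column_space (realize (mu_tensor compacts_dual compacts_dual))))"
proof
  assume "equivalent_norms_on
       (alg_tensor (cvecs column_space) (alg_tensor (vecs compacts_dual) (vecs compacts_dual)))
       (cnorm (min_tensor column_space (min_tensor (realize compacts_dual) (realize compacts_dual))))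
       (cnorm (min_tensor column_space (realize (mu_tensor compacts_dual compacts_dual))))"
  then obtain C where C: "C > 0" and
    le: "\<And>P. cnorm (min_tensor column_space (realize (mu_tensor compacts_dual compacts_dual))) (witness P)
      \<le> C * cnorm (min_tensor column_space (min_tensor (realize compacts_dual) (realize compacts_dual))) (witness P)"
    unfolding equivalent_norms_on_def using witness_mem by blast
  \<comment> \<open>The two estimates give P^(3/2) \<le> C sqrt 2 P^(5/4), that is P \<le> 4 C^4,
    which the choice of P excludes; P > 2 makes the prime odd.\<close>
  obtain P :: nat where P: "prime P" "P > max 2 (nat \<lceil>4 * C ^ 4\<rceil>)" using bigger_prime by blast
  have P2: "P \<noteq> 2" "0 < P" using P by auto
  have "sqrt (real P ^ 3) \<le> C * sqrt (2 * (real P)\<^sup>2 * sqrt P)"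
    using mu_norm_witness[OF P2(2)] le[of P] mult_left_mono[OF min_norm_witness[OF P(1) P2(1)], of C] C by linarith
  then have "(sqrt (real P ^ 3))\<^sup>2 \<le> (C * sqrt (2 * (real P)\<^sup>2 * sqrt P))\<^sup>2"
    by (rule power_mono) simp
  then have "(real P)\<^sup>2 * real P \<le> (real P)\<^sup>2 * (2 * C\<^sup>2 * sqrt P)"
    by (simp add: power_mult_distrib power3_eq_cube power2_eq_square mult_ac)
  then have "real P \<le> 2 * C\<^sup>2 * sqrt P" using P2 by simp
  then have "sqrt P * sqrt P \<le> 2 * C\<^sup>2 * sqrt P" by simp
  then have "sqrt P \<le> 2 * C\<^sup>2" by (rule mult_right_le_imp_le) (use P2 in simp)
  then have "(sqrt P)\<^sup>2 \<le> (2 * C\<^sup>2)\<^sup>2" by (rule power_mono) simp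
  then have "real P \<le> 4 * C ^ 4" by (simp add: power_mult_distrib flip: power_mult)
  then show False using P(2) by linarith
qed

end
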